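(* Suppose that the Goursat problem $$\frac{\partial^{2} u(x,y)}{\partial x\partial y}+\mathbb{N}(u(x,y))=f(x,y),\quad (x,y)\in D,\qquad u(x,0)=\psi(x),\quad u(0,y)=\phi(y),\quad \psi(0)=\phi(0),$$ satisfies the following conditions: (1) $\mathbb{N}(u)=u\sum_{k=0}^{\infty}\nu_k u^k$, $\nu_k\in\mathbb{R}$, for all $u\in\mathbb{R}$ (the series converging for all $u\in\mathbb{R}$); (2) $\psi\in C^{1}(D_1)\cap C(\bar D_1)$, $\phi\in C^{1}(D_2)\cap C(\bar D_2)$ (with $\psi',\phi'$ bounded), and $f\in C(\bar D)$. Then the FD-method described in the context converges superexponentially to the exact solution $u(x,y)$ of the problem, in the following sense: there exist positive real constants $c,R,\varepsilon$, depending only on the input data of the Goursat problem, such that for every mesh with $h=\sqrt{h_1^2+h_2^2}<R$ the inequalities $$\Bigl\|u(x,y)-\sum_{k=0}^{m}u^{(k)}(x,y)\Bigr\|_{1,\bar D}\le \frac{cR}{(m+1)^{1+\varepsilon}(R-h)}\left(\frac{h}{R}\right)^{m+1},\qquad m\in\mathbb{N}\cup\{0\},$$ hold true.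
   Context: Let $X,Y>0$, $D=\{(x,y):0<x<X,\ 0<y<Y\}$, $D_1=(0,X)$, $D_2=(0,Y)$; a bar denotes closure. Put $N(u)=\sum_{k\ge0}\nu_k u^k$, so $\mathbb{N}(u)=N(u)u$. The exact solution $u\in C^{1,1}(D)\cap C(\bar D)$ is assumed to exist and be unique, where $C^{1,1}$ means that $\partial_x u,\partial_y u,\partial_x\partial_y u$ exist and are continuous. Mesh: for integers $N_1,N_2\ge1$, $h_1=X/N_1$, $h_2=Y/N_2$, $x_i=h_1i$ ($0\le i\le N_1$), $y_j=h_2j$ ($0\le j\le N_2$), $P_{i,j}=(x_{i-1},x_i)\times(y_{j-1},y_j)$ for $1\le i\le N_1$, $1\le j\le N_2$. Adomian polynomials: $A_n(N;v_0,\dots,v_n)=\frac{1}{n!}\frac{d^n}{d\tau^n}N\bigl(\sum_{s=0}^{n}v_s\tau^s\bigr)\big|_{\tau=0}$. FD-method: the approximation of rank $m$ is $\sum_{k=0}^m u^{(k)}(x,y)$, where the functions $u^{(k)}\in C(\bar D)$ are defined as follows. For a cell $P_{i,j}$ write $u^{(k)}_{i,j}=u^{(k)}(x_{i-1},y_{j-1})$. All differential equations below hold on each cell $P_{i,j}$ (and, by continuous extension from the cell, on $\bar P_{i,j}$). The function $u^{(0)}$ is the solution of $$\frac{\partial^2u^{(0)}(x,y)}{\partial x\partial y}+N\bigl(u^{(0)}_{i,j}\bigr)u^{(0)}(x,y)=f(x,y),\quad (x,y)\in\bar P_{i,j},$$ for all $i,j$, with $u^{(0)}(x,0)=\psi(x)$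 and $u^{(0)}(0,y)=\phi(y)$ for $x\in[0,X]$, $y\in[0,Y]$. For $k\ge1$, $u^{(k)}$ is the solution of the linear Goursat problem $$\frac{\partial^2u^{(k)}(x,y)}{\partial x\partial y}+N\bigl(u^{(0)}_{i,j}\bigr)u^{(k)}(x,y)+N'\bigl(u^{(0)}_{i,j}\bigr)u^{(0)}(x,y)\,u^{(k)}_{i,j}=F^{(k)}(x,y),\quad (x,y)\in\bar P_{i,j},$$ for all $i,j$, with $u^{(k)}(x,0)=u^{(k)}(0,y)=0$ for $x\in[0,X]$, $y\in[0,Y]$, where on the cell $\bar P_{i,j}$ $$F^{(k)}(x,y)=-\sum_{s=1}^{k-1}A_{k-s}\bigl(N;u^{(0)}_{i,j},\dots,u^{(k-s)}_{i,j}\bigr)u^{(s)}(x,y)-A_k\bigl(N;u^{(0)}_{i,j},\dots,u^{(k-1)}_{i,j},0\bigr)u^{(0)}(x,y)$$ $$+\sum_{s=0}^{k-1}\Bigl[A_{k-1-s}\bigl(N;u^{(0)}_{i,j},\dots,u^{(k-1-s)}_{i,j}\bigr)-A_{k-1-s}\bigl(N;u^{(0)}(x,y),\dots,u^{(k-1-s)}(x,y)\bigr)\Bigr]u^{(s)}(x,y).$$ Norms: $\|g\|_{S}=\sup_{(x,y)\in S}|g(x,y)|$, and for $g\in C(\bar D)$ with $g\in C^{1,1}(P_{i,j})$ for all $i,j$, $$\|g\|_{1,\bar D}=\max\Bigl\{\|g\|_{\bar D},\ \max_{i,j}\bigl[\|\partial_xg\|_{P_{i,j}}^2+\|\partial_yg\|_{P_{i,j}}^2\bigr]^{1/2}\Bigr\}.$$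 *)

theory Defs
  imports "HOL-Analysis.Analysis"
begin

definition dx :: "(real \<times> real \<Rightarrow> real) \<Rightarrow> real \<times> real \<Rightarrow> real" where
  "dx g p = deriv (\<lambda>s. g (s, snd p)) (fst p)"

definition dy :: "(real \<times> real \<Rightarrow> real) \<Rightarrow> real \<times> real \<Rightarrow> real" where
  "dy g p = deriv (\<lambda>t. g (fst p, t)) (snd p)"

text \<open>The class \<open>C\<^sup>1\<^sup>,\<^sup>1\<close> on an open set: the partial derivatives \<open>g\<^sub>x\<close>, \<open>g\<^sub>y\<close> and the mixed
  derivative \<open>(g\<^sub>y)\<^sub>x\<close> exist and are continuous. Differentiability is required explicitly because
  \<^const>\<open>deriv\<close> is a total function.\<close>

definition C11_on :: "(real \<times> real) set \<Rightarrow> (real \<times> real \<Rightarrow> real) \<Rightarrow> bool" where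
  "C11_on S g \<longleftrightarrow>
     (\<forall>(x, y)\<in>S. (\<lambda>s. g (s, y)) differentiable (at x) \<and>
                 (\<lambda>t. g (x, t)) differentiable (at y) \<and>
                 (\<lambda>s. dy g (s, y)) differentiable (at x)) \<and>
     continuous_on S (dx g) \<and> continuous_on S (dy g) \<and> continuous_on S (dx (dy g))"

definition dom :: "real \<Rightarrow> real \<Rightarrow> (real \<times> real) set" where
  "dom X Y = {0<..<X} \<times> {0<..<Y}"

definition cdom :: "real \<Rightarrow> real \<Rightarrow> (real \<times> real) set" where
  "cdom X Y = {0..X} \<times> {0..Y}"

text \<open>The function \<open>N\<close>; the nonlinearity of the Goursat problem is \<open>N(u) u\<close>.\<close>

definition Nfun :: "(nat \<Rightarrow> real) \<Rightarrow> real \<Rightarrow> real" where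
  "Nfun \<nu> v = (\<Sum>k. \<nu> k * v ^ k)"

definition goursat_solution ::
  "real \<Rightarrow> real \<Rightarrow> (nat \<Rightarrow> real) \<Rightarrow> (real \<times> real \<Rightarrow> real) \<Rightarrow> (real \<Rightarrow> real) \<Rightarrow> (real \<Rightarrow> real)
   \<Rightarrow> (real \<times> real \<Rightarrow> real) \<Rightarrow> bool" where
  "goursat_solution X Y \<nu> f \<psi> \<phi> u \<longleftrightarrow>
     C11_on (dom X Y) u \<and> continuous_on (cdom X Y) u \<and>
     (\<forall>p\<in>dom X Y. dx (dy u) p + Nfun \<nu> (u p) * u p = f p) \<and>
     (\<forall>x\<in>{0..X}. u (x, 0) = \<psi> x) \<and> (\<forall>y\<in>{0..Y}. u (0, y) = \<phi> y)"

text \<open>Node number \<open>i\<close> of the uniform partition of \<open>[0, L]\<close> into \<open>n\<close> intervals.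
  Cells are indexed by \<open>1 \<le> i \<le> N1\<close>, \<open>1 \<le> j \<le> N2\<close>.\<close>

definition node :: "real \<Rightarrow> nat \<Rightarrow> nat \<Rightarrow> real" where
  "node L n i = (L / real n) * real i"

definition cell :: "real \<Rightarrow> real \<Rightarrow> nat \<Rightarrow> nat \<Rightarrow> nat \<Rightarrow> nat \<Rightarrow> (real \<times> real) set" where
  "cell X Y N1 N2 i j =
     {node X N1 (i - 1)<..<node X N1 i} \<times> {node Y N2 (j - 1)<..<node Y N2 j}"

definition corner :: "real \<Rightarrow> real \<Rightarrow> nat \<Rightarrow> nat \<Rightarrow> nat \<Rightarrow> nat \<Rightarrow> real \<times> real" where
  "corner X Y N1 N2 i j = (node X N1 (i - 1), node Y N2 (j - 1))"

text \<open>Adomian polynomial \<open>A\<^sub>n(N; v\<^sub>0, \<dots>, v\<^sub>n)\<close>; only the first \<open>n + 1\<close> entries of \<open>v\<close> matter.\<close>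

definition adomian :: "(real \<Rightarrow> real) \<Rightarrow> nat \<Rightarrow> (nat \<Rightarrow> real) \<Rightarrow> real" where
  "adomian N n v = (deriv ^^ n) (\<lambda>\<tau>. N (\<Sum>s\<le>n. v s * \<tau> ^ s)) 0 / fact n"

text \<open>Right-hand side \<open>F\<^sup>(\<^sup>k\<^sup>)(p)\<close> on a cell with lower left corner \<open>q\<close>. The update \<open>(k := 0)\<close>
  replaces the last argument of \<open>A\<^sub>k\<close> by zero.\<close>

definition fd_rhs ::
  "(real \<Rightarrow> real) \<Rightarrow> (nat \<Rightarrow> real \<times> real \<Rightarrow> real) \<Rightarrow> nat \<Rightarrow> real \<times> real \<Rightarrow> real \<times> real \<Rightarrow> real" where
  "fd_rhs N U k q p =
     - (\<Sum>s\<in>{1..<k}. adomian N (k - s) (\<lambda>r. U r q) * U s p)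
     - adomian N k ((\<lambda>r. U r q)(k := 0)) * U 0 p
     + (\<Sum>s<k. (adomian N (k - 1 - s) (\<lambda>r. U r q) - adomian N (k - 1 - s) (\<lambda>r. U r p)) * U s p)"

text \<open>The sequence \<open>u\<^sup>(\<^sup>0\<^sup>)\<close>, \<open>u\<^sup>(\<^sup>1\<^sup>)\<close>, \dots of the FD-method on the mesh with \<open>N1 \<times> N2\<close> cells. The
  differential equations are imposed on the open cells. Since every term other than the mixed
  derivative is continuous on the closed cell, the mixed derivative then extends continuously to the
  closed cell and the equations hold there for the extension.\<close>

definition fd_method ::
  "real \<Rightarrow> real \<Rightarrow> (nat \<Rightarrow> real) \<Rightarrow> (real \<times> real \<Rightarrow> real) \<Rightarrow> (real \<Rightarrow> real) \<Rightarrow> (real \<Rightarrow> real)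
   \<Rightarrow> nat \<Rightarrow> nat \<Rightarrow> (nat \<Rightarrow> real \<times> real \<Rightarrow> real) \<Rightarrow> bool" where
  "fd_method X Y \<nu> f \<psi> \<phi> N1 N2 U \<longleftrightarrow>
     (\<forall>k. continuous_on (cdom X Y) (U k)) \<and>
     (\<forall>k. \<forall>i\<in>{1..N1}. \<forall>j\<in>{1..N2}. C11_on (cell X Y N1 N2 i j) (U k)) \<and>
     (\<forall>i\<in>{1..N1}. \<forall>j\<in>{1..N2}. \<forall>p\<in>cell X Y N1 N2 i j.
        dx (dy (U 0)) p + Nfun \<nu> (U 0 (corner X Y N1 N2 i j)) * U 0 p = f p) \<and>
     (\<forall>x\<in>{0..X}. U 0 (x, 0) = \<psi> x) \<and> (\<forall>y\<in>{0..Y}. U 0 (0, y) = \<phi> y) \<and>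
     (\<forall>k\<ge>1. \<forall>i\<in>{1..N1}. \<forall>j\<in>{1..N2}. \<forall>p\<in>cell X Y N1 N2 i j.
        dx (dy (U k)) p
          + Nfun \<nu> (U 0 (corner X Y N1 N2 i j)) * U k p
          + deriv (Nfun \<nu>) (U 0 (corner X Y N1 N2 i j)) * U 0 p * U k (corner X Y N1 N2 i j)
        = fd_rhs (Nfun \<nu>) U k (corner X Y N1 N2 i j) p) \<and>
     (\<forall>k\<ge>1. (\<forall>x\<in>{0..X}. U k (x, 0) = 0) \<and> (\<forall>y\<in>{0..Y}. U k (0, y) = 0))"

text \<open>The norms take values in the extended reals, so that the norm of an unbounded function is
  \<open>\<infinity>\<close> and an upper bound by a real number includes boundedness.\<close>

definition sup_norm :: "(real \<times> real) set \<Rightarrow> (real \<times> real \<Rightarrow> real) \<Rightarrow> ereal" where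
  "sup_norm S g = (SUP p\<in>S. ereal \<bar>g p\<bar>)"

definition ereal_sqrt :: "ereal \<Rightarrow> ereal" where
  "ereal_sqrt a = (if a = \<infinity> then \<infinity> else ereal (sqrt (real_of_ereal a)))"

definition norm1 ::
  "real \<Rightarrow> real \<Rightarrow> nat \<Rightarrow> nat \<Rightarrow> (real \<times> real \<Rightarrow> real) \<Rightarrow> ereal" where
  "norm1 X Y N1 N2 g =
     max (sup_norm (cdom X Y) g)
         (Max ((\<lambda>(i, j). ereal_sqrt ((sup_norm (cell X Y N1 N2 i j) (dx g))\<^sup>2
                                   + (sup_norm (cell X Y N1 N2 i j) (dy g))\<^sup>2))
               ` ({1..N1} \<times> {1..N2})))"

end

theory Submission
  imports Defs
begin

text \<open>Insert a parameter \<open>\<tau>\<close> in front of the error of freezing the coefficient and consider, on a cell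
  with lower left corner \<open>q\<close>,
  \<open>w\<^sub>x\<^sub>y + N(w(q)) w + \<tau> (N(w) - N(w(q))) w = f\<close>.
  The equations of the FD-method say that \<open>u\<^sup>(\<^sup>k\<^sup>)\<close> is the coefficient of \<open>\<tau>\<^sup>k\<close> of the formal power series
  solution, and \<open>\<tau> = 1\<close> gives back the Goursat problem. So it suffices to show that the coefficients
  are at most of the size \<open>(h/R)\<^sup>k / (k + 1)\<^sup>2\<close> together with their first derivatives; the series
  then converges, its sum is the exact solution, and the remainder after the term \<open>m\<close> is what the
  theorem claims with \<open>\<epsilon> = 1\<close>.

  Two tools carry the argument.

  The first is a Gronwall estimate for mixed derivatives that needs no integration. A function whose
  mixed derivative is nonnegative on every cell has nonnegative increments over all rectangles: inside
  a cell two applications of the mean value theorem show it, and increments add up across the mesh. A bound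
  on \<open>g\<^sub>x\<^sub>y\<close> by the mixed derivative of an explicit function thus bounds the increments of \<open>g\<close>. The
  comparison function \<open>exp (\<mu> (x + y))\<close> and a smallest violating point give \<open>exponential_barrier\<close>, and
  from it \<open>conditional_goursat_estimate\<close>: if \<open>\<bar>g\<^sub>x\<^sub>y(p)\<bar> \<le> a (\<bar>g(p)\<bar> + \<bar>g(q)\<bar>) + \<epsilon>\<close> and \<open>g\<close> vanishes on
  the axes, then \<open>g\<close> and its Lipschitz constants are at most \<open>\<epsilon>\<close> times a constant that does not depend
  on the mesh. Lipschitz constants serve as bounds of the first derivatives, and they also bound
  the variation of \<open>u\<^sup>(\<^sup>k\<^sup>)\<close> over a cell, which produces the factor \<open>h\<close>.

  The second is a bound of the Adomian polynomials. They are the coefficients of the composition of the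
  Taylor series of \<open>N\<close> at \<open>v\<^sub>0\<close> with \<open>\<Sum>v\<^sub>s \<tau>\<^sup>s\<close> (\<open>adomian_eq\<close>). The weights
  \<open>r\<^sup>n / (n + 1)\<^sup>2\<close> are, up to the factor 8, stable under convolution, so sequences of size \<open>\<eta>\<close> in this
  weight form an algebra in which the \<open>j\<close>-th power has size about \<open>\<eta>\<^sup>j\<close>.

  Take \<open>r = h/R\<close>. In \<open>F\<^sup>(\<^sup>k\<^sup>)\<close> the terms with frozen arguments are quadratic in \<open>\<eta>\<close>, and the
  differences of Adomian polynomials are of order \<open>h\<close> with one power of \<open>r\<close> less, that is, of order
  \<open>h/r = R\<close> (\<open>fd_rhs_bound\<close>). Hence the size \<open>\<eta>\<close> reproduces itself under the recursion once \<open>\<eta>\<close> is small and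
  then \<open>R\<close> is small compared with \<open>\<eta>\<close> (\<open>U_controlled\<close>). For \<open>u\<^sup>(\<^sup>0\<^sup>)\<close> the estimate is conditional on \<open>u\<^sup>(\<^sup>0\<^sup>)\<close>
  being close to \<open>u\<close>; the barrier makes this a consequence for small \<open>h\<close> (\<open>U0_close\<close>).\<close>

section \<open>Weighted sequences and power series\<close>
text \<open>Geometric decay alone would not survive composition: the powers of \<open>\<Sum>r\<^sup>s \<tau>\<^sup>s\<close> have coefficients with
  growing binomial factors. The quadratic factor in the denominator removes this effect.\<close>

definition weight :: "real \<Rightarrow> nat \<Rightarrow> real" where
  "weight r n = r ^ n / (real n + 1)\<^sup>2"

lemma weight_nonneg: "r \<ge> 0 \<Longrightarrow> weight r n \<ge> 0"
  by (simp add: weight_def)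

lemma weight_0 [simp]: "weight r 0 = 1"
  by (simp add: weight_def)

lemma summable_inverse_squares: "summable (\<lambda>n. 1 / (real n + 1)\<^sup>2)"
proof -
  have "summable (\<lambda>n. inverse (real (Suc n) ^ 2))"
    by (subst summable_Suc_iff) (rule inverse_power_summable, simp)
  then show ?thesis by (simp add: field_simps)
qed

lemma weight_summable: "r > 0 \<Longrightarrow> r \<le> 1 \<Longrightarrow> summable (weight r)"
  by (rule summable_comparison_test'[OF summable_inverse_squares])
     (auto simp: weight_def intro!: divide_right_mono power_le_one)

lemma sum_inverse_squares_le: "(\<Sum>i\<le>n. 1 / (real i + 1)\<^sup>2) \<le> 2"
proof -
  have "(\<Sum>i\<le>n. 1 / (real i + 1)\<^sup>2) \<le> 2 - 1 / (real n + 1)" for n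
  proof (induction n)
    case (Suc n)
    have "1 / (real (Suc n) + 1)\<^sup>2 \<le> 1 / (real n + 1) - 1 / (real (Suc n) + 1)"
    proof -
      have "1 / (real (Suc n) + 1)\<^sup>2 \<le> 1 / ((real n + 1) * (real (Suc n) + 1))"
        by (rule divide_left_mono) (auto simp: power2_eq_square intro!: mult_right_mono)
      also have "\<dots> = 1 / (real n + 1) - 1 / (real (Suc n) + 1)"
        by (simp add: divide_simps)
      finally show ?thesis .
    qed
    with Suc show ?case by simp
  qed simp
  from this[of n] show ?thesis
    by (smt (verit) divide_nonneg_nonneg of_nat_0_le_iff)
qed

text \<open>From \<open>1/((i+1)(n-i+1)) = (1/(i+1) + 1/(n-i+1)) / (n+2)\<close>: after squaring, the sum over \<open>i\<close> is at most
  four times a partial sum of \<open>\<Sum>1/(i+1)\<^sup>2 \<le> 2\<close>.\<close>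

lemma weight_convolution:
  assumes "r \<ge> 0"
  shows "(\<Sum>i\<le>n. weight r i * weight r (n - i)) \<le> 8 * weight r n"
proof -
  have pt: "weight r i * weight r (n - i)
      \<le> r ^ n * (2 / (real n + 1)\<^sup>2) * (1 / (real i + 1)\<^sup>2 + 1 / (real (n - i) + 1)\<^sup>2)"
    if "i \<le> n" for i
  proof -
    define a b where "a = real i + 1" and "b = real (n - i) + 1"
    have ab: "a \<ge> 1" "b \<ge> 1" "a + b = real n + 2" using that by (auto simp: a_def b_def)
    have "1 / (a\<^sup>2 * b\<^sup>2) = (1 / (a + b)\<^sup>2) * (1 / a + 1 / b)\<^sup>2"
      using ab by (simp add: divide_simps power2_eq_square) (simp add: algebra_simps)
    also have "\<dots> \<le> (1 / (real n + 1)\<^sup>2) * (2 * (1 / a\<^sup>2 + 1 / b\<^sup>2))"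
    proof (rule mult_mono)
      show "1 / (a + b)\<^sup>2 \<le> 1 / (real n + 1)\<^sup>2"
        by (rule divide_left_mono) (use ab in \<open>auto intro!: power_mono\<close>)
      have "0 \<le> (1 / a - 1 / b)\<^sup>2" by simp
      then show "(1 / a + 1 / b)\<^sup>2 \<le> 2 * (1 / a\<^sup>2 + 1 / b\<^sup>2)"
        by (simp add: power2_sum power2_diff power_one_over)
    qed auto
    finally have *: "1 / (a\<^sup>2 * b\<^sup>2) \<le> (1 / (real n + 1)\<^sup>2) * (2 * (1 / a\<^sup>2 + 1 / b\<^sup>2))" .
    have "weight r i * weight r (n - i) = r ^ n * (1 / (a\<^sup>2 * b\<^sup>2))"
      using that by (simp add: weight_def a_def b_def flip: power_add)
    also have "\<dots> \<le> r ^ n * ((1 / (real n + 1)\<^sup>2) * (2 * (1 / a\<^sup>2 + 1 / b\<^sup>2)))"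
      by (rule mult_left_mono[OF *]) (use assms in simp)
    finally show ?thesis by (simp add: a_def b_def algebra_simps)
  qed
  have refl: "(\<Sum>i\<le>n. 1 / (real (n - i) + 1)\<^sup>2) = (\<Sum>i\<le>n. 1 / (real i + 1)\<^sup>2)"
    by (rule sum.reindex_bij_witness[of _ "\<lambda>i. n - i" "\<lambda>i. n - i"]) auto
  have "(\<Sum>i\<le>n. weight r i * weight r (n - i))
      \<le> (\<Sum>i\<le>n. r ^ n * (2 / (real n + 1)\<^sup>2) * (1 / (real i + 1)\<^sup>2 + 1 / (real (n - i) + 1)\<^sup>2))"
    by (rule sum_mono) (use pt in simp)
  also have "\<dots> = r ^ n * (2 / (real n + 1)\<^sup>2) * (2 * (\<Sum>i\<le>n. 1 / (real i + 1)\<^sup>2))"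
    by (subst sum_distrib_left[symmetric], subst sum.distrib, subst refl) simp
  also have "\<dots> \<le> r ^ n * (2 / (real n + 1)\<^sup>2) * (2 * 2)"
    by (intro mult_left_mono sum_inverse_squares_le) (use assms in auto)
  finally show ?thesis by (simp add: weight_def)
qed

text \<open>The price of lowering the index by one is the factor \<open>1/r\<close>. With \<open>r = h/R\<close> it turns a factor \<open>h\<close>
  into a factor \<open>R\<close>.\<close>

lemma weight_pred_le:
  assumes "n \<ge> 1" and r: "r > 0"
  shows "weight r (n - 1) \<le> 4 / r * weight r n"
proof -
  obtain m where m: "n = Suc m" using assms(1) by (cases n) auto
  have "1 / (real m + 1)\<^sup>2 = 4 / (2 * (real m + 1))\<^sup>2" by (simp add: power_mult_distrib del: distrib_left_numeral)
  also have "\<dots> \<le> 4 / (real m + 2)\<^sup>2"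
    by (intro divide_left_mono power_mono) auto
  finally have "1 / (real m + 1)\<^sup>2 \<le> 4 / (real m + 2)\<^sup>2" .
  from mult_left_mono[OF this, of "r ^ m"] show ?thesis using r by (simp add: m weight_def add_ac field_simps)
qed

definition wbounded :: "real \<Rightarrow> real \<Rightarrow> real fps \<Rightarrow> bool" where
  "wbounded K r b \<longleftrightarrow> (\<forall>n. \<bar>fps_nth b n\<bar> \<le> K * weight r n)"

lemma convolution_bound:
  assumes r: "r \<ge> 0" and "K \<ge> 0"
    and a: "\<And>i. i \<le> n \<Longrightarrow> \<bar>a i\<bar> \<le> K * weight r i"
    and b: "\<And>i. i \<le> n \<Longrightarrow> \<bar>b i\<bar> \<le> L * weight r i"
  shows "(\<Sum>i\<le>n. \<bar>a i * b (n - i)\<bar>) \<le> 8 * K * L * weight r n"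
proof -
  have L: "L \<ge> 0" using b[of 0] by simp
  have "(\<Sum>i\<le>n. \<bar>a i * b (n - i)\<bar>) \<le> (\<Sum>i\<le>n. (K * weight r i) * (L * weight r (n - i)))"
    unfolding abs_mult
    by (intro sum_mono mult_mono a b) (use assms L in \<open>auto simp: weight_nonneg\<close>)
  also have "\<dots> = K * L * (\<Sum>i\<le>n. weight r i * weight r (n - i))"
    by (simp add: sum_distrib_left algebra_simps)
  also have "\<dots> \<le> K * L * (8 * weight r n)"
    by (intro mult_left_mono weight_convolution) (use assms L in auto)
  finally show ?thesis by (simp add: algebra_simps)
qed

lemma wbounded_mono: "wbounded K r b \<Longrightarrow> K \<le> L \<Longrightarrow> r \<ge> 0 \<Longrightarrow> wbounded L r b"
  unfolding wbounded_def by (meson mult_right_mono order_trans weight_nonneg)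

lemma wbounded_nonneg: "wbounded K r b \<Longrightarrow> K \<ge> 0"
  unfolding wbounded_def by (metis abs_ge_zero mult.right_neutral order_trans weight_0)

lemma wbounded_add: "wbounded K r a \<Longrightarrow> wbounded L r b \<Longrightarrow> wbounded (K + L) r (a + b)"
  unfolding wbounded_def by (auto simp: algebra_simps intro: order_trans[OF abs_triangle_ineq] add_mono)

lemma wbounded_mult:
  assumes "r \<ge> 0" "wbounded K r a" "wbounded L r b"
  shows "wbounded (8 * K * L) r (a * b)"
  unfolding wbounded_def
proof
  fix n
  have "\<bar>fps_nth (a * b) n\<bar> \<le> (\<Sum>i\<le>n. \<bar>fps_nth a i * fps_nth b (n - i)\<bar>)"
    by (simp add: fps_mult_nth atLeast0AtMost)
  also have "\<dots> \<le> 8 * K * L * weight r n"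
    by (rule convolution_bound) (use assms wbounded_nonneg in \<open>auto simp: wbounded_def\<close>)
  finally show "\<bar>fps_nth (a * b) n\<bar> \<le> 8 * K * L * weight r n" .
qed

text \<open>The condition \<open>8 \<eta> \<le> 1\<close> makes multiplication by a series of size \<open>\<eta>\<close> a contraction of the weighted
  norm, so that a power is no larger than its first factor. This makes all bounds uniform in \<open>j\<close>.\<close>

lemma wbounded_power:
  assumes r: "r \<ge> 0" and b: "wbounded \<eta> r b" and \<eta>: "8 * \<eta> \<le> 1"
  shows wbounded_power_1: "wbounded 1 r (b ^ j)"
    and wbounded_power_linear: "j \<ge> 1 \<Longrightarrow> wbounded \<eta> r (b ^ j)"
    and wbounded_power_quadratic: "j \<ge> 2 \<Longrightarrow> wbounded (8 * \<eta>\<^sup>2) r (b ^ j)"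
proof -
  have \<eta>0: "\<eta> \<ge> 0" using b by (rule wbounded_nonneg)
  show lin: "wbounded \<eta> r (b ^ j)" if "j \<ge> 1" for j
    using that
  proof (induction j rule: dec_induct)
    case (step j)
    have "wbounded (8 * \<eta> * \<eta>) r (b * b ^ j)" by (rule wbounded_mult[OF r b step.IH])
    then show ?case
      by (simp, elim wbounded_mono[OF _ _ r]) (use \<eta> \<eta>0 in \<open>simp add: mult_left_le_one_le\<close>)
  qed (use b in simp)
  show "wbounded 1 r (b ^ j)"
  proof (cases "j = 0")
    case True
    then show ?thesis using r by (auto simp: wbounded_def weight_nonneg)
  next
    case False
    then show ?thesis using wbounded_mono[OF lin _ r, of j 1] \<eta> \<eta>0 by auto
  qed
  show "wbounded (8 * \<eta>\<^sup>2) r (b ^ j)" if "j \<ge> 2"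
  proof -
    obtain i where i: "j = Suc i" "i \<ge> 1" by (rule that[of "j - 1"]) (use \<open>j \<ge> 2\<close> in auto)
    have "wbounded (8 * \<eta> * \<eta>) r (b * b ^ i)" by (rule wbounded_mult[OF r b lin[OF i(2)]])
    then show ?thesis using i by (simp add: power2_eq_square mult.assoc)
  qed
qed

text \<open>Induction on \<open>j\<close> with \<open>b\<^sup>j\<^sup>+\<^sup>1 - b'\<^sup>j\<^sup>+\<^sup>1 = b (b\<^sup>j - b'\<^sup>j) + (b - b') b'\<^sup>j\<close>: both products gain the factor
  \<open>8 \<eta> \<le> 1/2\<close>.\<close>

lemma wbounded_power_diff:
  assumes r: "r \<ge> 0" and b: "wbounded \<eta> r b" and b': "wbounded \<eta> r b'" and \<eta>: "16 * \<eta> \<le> 1"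
    and d: "wbounded \<theta> r (b - b')"
  shows "wbounded (2 * \<theta>) r (b ^ j - b' ^ j)"
proof (induction j)
  case 0
  show ?case using r wbounded_nonneg[OF d] by (auto simp: wbounded_def weight_nonneg)
next
  case (Suc j)
  have \<eta>0: "\<eta> \<ge> 0" using b by (rule wbounded_nonneg)
  have \<theta>0: "\<theta> \<ge> 0" using d by (rule wbounded_nonneg)
  show ?case
  proof (cases "j = 0")
    case True
    then show ?thesis using wbounded_mono[OF d _ r] \<theta>0 by simp
  next
    case False
    have eq: "b ^ Suc j - b' ^ Suc j = b * (b ^ j - b' ^ j) + (b - b') * b' ^ j"
      by (simp add: algebra_simps)
    have p: "wbounded \<eta> r (b' ^ j)"
      by (rule wbounded_power_linear[OF r b']) (use \<eta> \<eta>0 False in auto)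
    have "wbounded (8 * \<eta> * (2 * \<theta>) + 8 * \<theta> * \<eta>) r (b ^ Suc j - b' ^ Suc j)"
      unfolding eq by (intro wbounded_add wbounded_mult r b d p Suc.IH)
    moreover have "8 * \<eta> * (2 * \<theta>) + 8 * \<theta> * \<eta> \<le> 2 * \<theta>"
      using mult_right_mono[OF \<eta> \<theta>0] mult_nonneg_nonneg[OF \<eta>0 \<theta>0] by (simp add: algebra_simps)
    ultimately show ?thesis using wbounded_mono r by blast
  qed
qed

lemma fps_power_nth_cong:
  fixes a b :: "real fps"
  assumes "\<And>i. i \<le> n \<Longrightarrow> fps_nth a i = fps_nth b i"
  shows "fps_nth (a ^ j) n = fps_nth (b ^ j) n"
  using assms
proof (induction j arbitrary: n)
  case (Suc j)
  have "fps_nth a i * fps_nth (a ^ j) (n - i) = fps_nth b i * fps_nth (b ^ j) (n - i)" if "i \<le> n" for i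
    using Suc that by (metis diff_le_self order_trans)
  then show ?case by (simp add: fps_mult_nth)
qed simp

text \<open>In a product of at least two factors without constant term, a coefficient of index \<open>n\<close> in one factor
  meets only constant terms of the others. This is why \<open>A\<^sub>n\<close> depends linearly on \<open>v\<^sub>n\<close>.\<close>

lemma fps_power_nth_top_irrelevant:
  fixes a b :: "real fps"
  assumes "\<And>i. i < n \<Longrightarrow> fps_nth a i = fps_nth b i" and a0: "fps_nth a 0 = 0" and b0: "fps_nth b 0 = 0"
    and j: "j \<ge> 2"
  shows "fps_nth (a ^ j) n = fps_nth (b ^ j) n"
proof -
  obtain i where i: "j = Suc i" "i \<ge> 1" by (rule that[of "j - 1"]) (use j in auto)
  have "fps_nth a s * fps_nth (a ^ i) (n - s) = fps_nth b s * fps_nth (b ^ i) (n - s)"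
    if "s \<le> n" for s
  proof -
    consider "s = 0" | "s > 0" "s = n" | "s > 0" "s < n" using \<open>s \<le> n\<close> by linarith
    then show ?thesis
    proof cases
      case 3
      have "fps_nth (a ^ i) (n - s) = fps_nth (b ^ i) (n - s)"
        by (rule fps_power_nth_cong) (use assms 3 in auto)
      then show ?thesis using assms 3 by simp
    qed (use a0 b0 i in \<open>auto simp: fps_power_zeroth\<close>)
  qed
  then show ?thesis by (simp add: i fps_mult_nth)
qed

text \<open>Fubini for absolutely convergent double series, stated with \<^const>\<open>suminf\<close> and \<^const>\<open>sums\<close>.\<close>

lemma sums_swap:
  fixes f :: "nat \<Rightarrow> nat \<Rightarrow> real"
  assumes f: "\<And>i. summable (\<lambda>j. \<bar>f i j\<bar>)" and s: "summable (\<lambda>i. \<Sum>j. \<bar>f i j\<bar>)"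
  shows "(\<lambda>j. \<Sum>i. f i j) sums (\<Sum>i. \<Sum>j. f i j)"
    and "summable (\<lambda>i. \<bar>f i j\<bar>)"
    and "summable (\<lambda>j. \<Sum>i. \<bar>f i j\<bar>)"
    and "(\<Sum>j. \<Sum>i. \<bar>f i j\<bar>) = (\<Sum>i. \<Sum>j. \<bar>f i j\<bar>)"
proof -
  have hs: "((\<lambda>j. \<bar>f i j\<bar>) has_sum (\<Sum>j. \<bar>f i j\<bar>)) UNIV" for i
    by (rule sums_nonneg_imp_has_sum) (use f in \<open>auto intro: summable_sums\<close>)
  have so: "(\<lambda>i. \<Sum>j. \<bar>f i j\<bar>) summable_on UNIV"
    by (subst summable_on_UNIV_nonneg_real_iff) (use s f in \<open>auto intro: suminf_nonneg\<close>)
  have abs: "(\<lambda>(i, j). \<bar>f i j\<bar>) summable_on (UNIV \<times> UNIV)"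
    by (rule summable_on_SigmaI[OF _ so]) (use hs in auto)
  have one: "(\<lambda>j. \<Sum>i. g i j) sums (\<Sum>i. \<Sum>j. g i j)" "summable (\<lambda>i. \<bar>g i j\<bar>)"
    if g: "\<And>i j. \<bar>g i j\<bar> = \<bar>f i j\<bar>" for g :: "nat \<Rightarrow> nat \<Rightarrow> real" and j
  proof -
    have ab: "(\<lambda>p. norm (case p of (i, j) \<Rightarrow> g i j)) summable_on (UNIV \<times> UNIV)"
      using abs by (simp add: case_prod_unfold g)
    have sm: "(\<lambda>(i, j). g i j) summable_on (UNIV \<times> UNIV)"
      by (rule abs_summable_summable[OF ab])
    have sm': "(\<lambda>(j, i). g i j) summable_on (UNIV \<times> UNIV)"
      using sm by (subst (asm) summable_on_swap) simp
    have col: "(\<lambda>i. g i j) summable_on UNIV" for j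
      using summable_on_Sigma_banach[OF sm'] summable_on_SigmaD1[OF sm', of j] by simp
    have row: "g i summable_on UNIV" for i
      using summable_on_SigmaD1[OF sm, of i] by simp
    have absum: "summable (\<lambda>i. \<bar>g i j\<bar>)" for j :: nat
      using summable_on_iff_abs_summable_on_real[THEN iffD1, OF col[of j]]
      by (subst (asm) summable_on_UNIV_nonneg_real_iff) auto
    have eq: "infsum h UNIV = (\<Sum>i. h i)" if "summable (\<lambda>i. \<bar>h i\<bar>)" for h :: "nat \<Rightarrow> real"
      by (rule infsumI, rule norm_summable_imp_has_sum)
        (use that in \<open>simp_all add: summable_sums summable_rabs_cancel\<close>)
    have ci: "infsum (\<lambda>i. g i j) UNIV = (\<Sum>i. g i j)" for j
      by (rule eq[OF absum])
    have ri: "infsum (g i) UNIV = (\<Sum>j. g i j)" for i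
      by (rule eq) (simp add: g f)
    have "infsum (\<lambda>i. infsum (g i) UNIV) UNIV = infsum (\<lambda>j. infsum (\<lambda>i. g i j) UNIV) UNIV"
      using infsum_swap_banach[OF sm] .
    then have e: "infsum (\<lambda>i. \<Sum>j. g i j) UNIV = infsum (\<lambda>j. \<Sum>i. g i j) UNIV"
      by (simp add: ci ri)
    have s1: "(\<lambda>i. \<Sum>j. g i j) summable_on UNIV"
      using summable_on_Sigma_banach[OF sm] by (simp add: ri)
    have s2: "(\<lambda>j. \<Sum>i. g i j) summable_on UNIV"
      using summable_on_Sigma_banach[OF sm'] by (simp add: ci)
    have "(\<lambda>i. \<Sum>j. g i j) sums infsum (\<lambda>i. \<Sum>j. g i j) UNIV"
      "(\<lambda>j. \<Sum>i. g i j) sums infsum (\<lambda>j. \<Sum>i. g i j) UNIV"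
      using s1 s2 by (simp_all add: has_sum_imp_sums has_sum_infsum)
    then show "(\<lambda>j. \<Sum>i. g i j) sums (\<Sum>i. \<Sum>j. g i j)"
      using e by (auto simp: sums_iff)
    show "summable (\<lambda>i. \<bar>g i j\<bar>)" by (rule absum)
  qed
  show "(\<lambda>j. \<Sum>i. f i j) sums (\<Sum>i. \<Sum>j. f i j)" "summable (\<lambda>i. \<bar>f i j\<bar>)"
    using one[of f] by auto
  show "summable (\<lambda>j. \<Sum>i. \<bar>f i j\<bar>)" "(\<Sum>j. \<Sum>i. \<bar>f i j\<bar>) = (\<Sum>i. \<Sum>j. \<bar>f i j\<bar>)"
    using one(1)[of "\<lambda>i j. \<bar>f i j\<bar>"] by (simp_all add: sums_iff)
qed

section \<open>The nonlinearity and its Taylor coefficients\<close>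

lemma power_diff_le:
  fixes v w M :: real
  assumes "\<bar>v\<bar> \<le> M" "\<bar>w\<bar> \<le> M"
  shows "\<bar>v ^ n - w ^ n\<bar> \<le> (M + 1) ^ n * \<bar>v - w\<bar>"
proof (induction n)
  case (Suc n)
  have M: "M \<ge> 0" using assms by linarith
  have "v ^ Suc n - w ^ Suc n = v * (v ^ n - w ^ n) + w ^ n * (v - w)"
    by (simp add: algebra_simps)
  then have "\<bar>v ^ Suc n - w ^ Suc n\<bar> \<le> \<bar>v\<bar> * \<bar>v ^ n - w ^ n\<bar> + \<bar>w\<bar> ^ n * \<bar>v - w\<bar>"
    by (metis abs_mult abs_triangle_ineq power_abs)
  also have "\<dots> \<le> M * ((M + 1) ^ n * \<bar>v - w\<bar>) + (M + 1) ^ n * \<bar>v - w\<bar>"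
    by (intro add_mono mult_mono Suc.IH mult_right_mono power_mono) (use assms M in auto)
  finally show ?case by (simp add: algebra_simps)
qed simp

text \<open>For \<open>j > k\<close> the binomial coefficient vanishes, so the truncated subtraction in the exponent is harmless.\<close>

definition taylor_coeff :: "(nat \<Rightarrow> real) \<Rightarrow> real \<Rightarrow> nat \<Rightarrow> real" where
  "taylor_coeff \<nu> v j = (\<Sum>k. \<nu> k * real (k choose j) * v ^ (k - j))"

definition majorant :: "(nat \<Rightarrow> real) \<Rightarrow> real \<Rightarrow> real" where
  "majorant \<nu> B = (\<Sum>k. \<bar>\<nu> k\<bar> * B ^ k)"

definition entire_series :: "(nat \<Rightarrow> real) \<Rightarrow> bool" where
  "entire_series \<nu> \<longleftrightarrow> (\<forall>v. summable (\<lambda>k. \<nu> k * v ^ k))"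

lemma majorant_summable:
  assumes "entire_series \<nu>" "B \<ge> 0"
  shows "summable (\<lambda>k. \<bar>\<nu> k\<bar> * B ^ k)"
proof -
  have "summable (\<lambda>k. norm (\<nu> k * B ^ k))"
    by (rule powser_insidea[of _ "B + 1"]) (use assms in \<open>auto simp: entire_series_def\<close>)
  then show ?thesis using assms(2) by (simp add: abs_mult power_abs)
qed

lemma majorant_nonneg: "entire_series \<nu> \<Longrightarrow> B \<ge> 0 \<Longrightarrow> majorant \<nu> B \<ge> 0"
  unfolding majorant_def by (intro suminf_nonneg majorant_summable) auto

lemma binomial_row_sums:
  fixes x y :: real
  shows "(\<lambda>j. real (k choose j) * y ^ (k - j) * x ^ j) sums (x + y) ^ k"
proof -
  have "(\<lambda>j. real (k choose j) * y ^ (k - j) * x ^ j) sums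
      (\<Sum>j\<le>k. real (k choose j) * y ^ (k - j) * x ^ j)"
    by (rule sums_finite) (auto simp: not_le binomial_eq_0)
  moreover have "(\<Sum>j\<le>k. real (k choose j) * y ^ (k - j) * x ^ j) = (x + y) ^ k"
    unfolding binomial_ring[of x y k] by (intro sum.cong) auto
  ultimately show ?thesis by simp
qed

text \<open>Everything comes from interchanging the sums in
  \<open>\<Sum>\<^sub>k \<nu>\<^sub>k (v + x)\<^sup>k = \<Sum>\<^sub>k \<Sum>\<^sub>j \<nu>\<^sub>k (k choose j) v\<^sup>k\<^sup>-\<^sup>j x\<^sup>j\<close>. At \<open>x = 1\<close> the interchange also bounds the sum of the
  Taylor coefficients, and the Lipschitz estimate follows from
  \<open>\<bar>v\<^sup>n - w\<^sup>n\<bar> \<le> (M + 1)\<^sup>n \<bar>v - w\<bar>\<close>, which only enlarges the point at which the majorant is taken.\<close>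

lemma Nfun_recentred:
  assumes \<nu>: "entire_series \<nu>"
  shows taylor_coeff_sums: "(\<lambda>j. taylor_coeff \<nu> v j * x ^ j) sums Nfun \<nu> (v + x)"
    and taylor_coeff_summable: "summable (\<lambda>j. \<bar>taylor_coeff \<nu> v j\<bar>)"
    and taylor_coeff_abs_sum_le: "\<bar>v\<bar> \<le> M \<Longrightarrow> (\<Sum>j. \<bar>taylor_coeff \<nu> v j\<bar>) \<le> majorant \<nu> (M + 1)"
    and taylor_coeff_lipschitz: "\<bar>v\<bar> \<le> M \<Longrightarrow> \<bar>w\<bar> \<le> M \<Longrightarrow>
      (\<Sum>j. \<bar>taylor_coeff \<nu> v j - taylor_coeff \<nu> w j\<bar>) \<le> majorant \<nu> (M + 2) * \<bar>v - w\<bar>"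
proof -
  have row: "(\<lambda>j. \<bar>\<nu> k * (real (k choose j) * v ^ (k - j) * x ^ j)\<bar>) sums (\<bar>\<nu> k\<bar> * (\<bar>x\<bar> + \<bar>v\<bar>) ^ k)" for k v x
    using sums_mult[OF binomial_row_sums[of k "\<bar>v\<bar>" "\<bar>x\<bar>"], of "\<bar>\<nu> k\<bar>"]
    by (simp add: abs_mult power_abs)
  have row': "(\<lambda>j. \<nu> k * (real (k choose j) * v ^ (k - j) * x ^ j)) sums (\<nu> k * (x + v) ^ k)" for k v x
    by (rule sums_mult[OF binomial_row_sums])
  note sw = sums_swap[of "\<lambda>k j. \<nu> k * (real (k choose j) * v ^ (k - j) * x ^ j)" for v x,
      OF sums_summable[OF row], unfolded sums_unique[OF row, symmetric],
      OF majorant_summable[OF \<nu>]]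
  have sm: "summable (\<lambda>k. \<bar>\<nu> k * real (k choose j) * v ^ (k - j)\<bar>)" for j v
    using sw(2)[of 1 v j] by (simp add: mult.assoc)
  have t1: "(\<lambda>j. \<Sum>k. \<nu> k * (real (k choose j) * v ^ (k - j) * x ^ j)) = (\<lambda>j. taylor_coeff \<nu> v j * x ^ j)" for x v
    unfolding taylor_coeff_def
    by (subst suminf_mult2[OF summable_rabs_cancel[OF sm]]) (simp add: mult.assoc)
  show "(\<lambda>j. taylor_coeff \<nu> v j * x ^ j) sums Nfun \<nu> (v + x)"
    using sw(1)[of x v] unfolding t1 sums_unique[OF row', symmetric] Nfun_def by (simp add: add.commute)
  have col: "\<bar>taylor_coeff \<nu> v j\<bar> \<le> (\<Sum>k. \<bar>\<nu> k * real (k choose j) * v ^ (k - j)\<bar>)" for j v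
    unfolding taylor_coeff_def by (rule summable_rabs[OF sm])
  have cs: "summable (\<lambda>j. \<Sum>k. \<bar>\<nu> k * real (k choose j) * v ^ (k - j)\<bar>)" for v
    using sw(3)[of 1 v] by (simp add: mult.assoc)
  show ts: "summable (\<lambda>j. \<bar>taylor_coeff \<nu> v j\<bar>)" for v
    by (rule summable_comparison_test'[OF cs[of v]]) (use col in auto)
  show "(\<Sum>j. \<bar>taylor_coeff \<nu> v j\<bar>) \<le> majorant \<nu> (M + 1)" if "\<bar>v\<bar> \<le> M"
  proof -
    have "(\<Sum>j. \<bar>taylor_coeff \<nu> v j\<bar>) \<le> (\<Sum>j. \<Sum>k. \<bar>\<nu> k * real (k choose j) * v ^ (k - j)\<bar>)"
      by (intro suminf_le col ts cs)
    also have "\<dots> = (\<Sum>k. \<bar>\<nu> k\<bar> * (1 + \<bar>v\<bar>) ^ k)"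
      using sw(4)[of 1 v] by (simp add: mult.assoc)
    also have "\<dots> \<le> majorant \<nu> (M + 1)"
      unfolding majorant_def
      by (intro suminf_le majorant_summable[OF \<nu>] mult_left_mono power_mono) (use that in auto)
    finally show ?thesis .
  qed
  show "(\<Sum>j. \<bar>taylor_coeff \<nu> v j - taylor_coeff \<nu> w j\<bar>) \<le> majorant \<nu> (M + 2) * \<bar>v - w\<bar>"
    if v: "\<bar>v\<bar> \<le> M" and w: "\<bar>w\<bar> \<le> M"
  proof -
    have M: "M \<ge> 0" using v by linarith
    have d: "\<bar>taylor_coeff \<nu> v j - taylor_coeff \<nu> w j\<bar>
        \<le> (\<Sum>k. \<bar>\<nu> k * real (k choose j) * (M + 1) ^ (k - j)\<bar>) * \<bar>v - w\<bar>" for j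
    proof -
      have le: "\<bar>\<nu> k * real (k choose j) * v ^ (k - j) - \<nu> k * real (k choose j) * w ^ (k - j)\<bar>
          \<le> \<bar>\<nu> k * real (k choose j) * (M + 1) ^ (k - j)\<bar> * \<bar>v - w\<bar>" for k
        using mult_left_mono[OF power_diff_le[OF v w, of "k - j"], of "\<bar>\<nu> k * real (k choose j)\<bar>"] M
        by (simp add: abs_mult mult.assoc flip: right_diff_distrib)
      have s2: "summable (\<lambda>k. \<bar>\<nu> k * real (k choose j) * (M + 1) ^ (k - j)\<bar> * \<bar>v - w\<bar>)"
        by (rule summable_mult2[OF sm])
      have s1: "summable (\<lambda>k. \<bar>\<nu> k * real (k choose j) * v ^ (k - j) - \<nu> k * real (k choose j) * w ^ (k - j)\<bar>)"
        by (rule summable_comparison_test'[OF s2]) (use le in auto)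
      have "\<bar>taylor_coeff \<nu> v j - taylor_coeff \<nu> w j\<bar>
          = \<bar>\<Sum>k. \<nu> k * real (k choose j) * v ^ (k - j) - \<nu> k * real (k choose j) * w ^ (k - j)\<bar>"
        unfolding taylor_coeff_def by (subst suminf_diff) (auto intro: summable_rabs_cancel[OF sm])
      also have "\<dots> \<le> (\<Sum>k. \<bar>\<nu> k * real (k choose j) * v ^ (k - j) - \<nu> k * real (k choose j) * w ^ (k - j)\<bar>)"
        by (rule summable_rabs[OF s1])
      also have "\<dots> \<le> (\<Sum>k. \<bar>\<nu> k * real (k choose j) * (M + 1) ^ (k - j)\<bar> * \<bar>v - w\<bar>)"
        by (rule suminf_le[OF le s1 s2])
      also have "\<dots> = (\<Sum>k. \<bar>\<nu> k * real (k choose j) * (M + 1) ^ (k - j)\<bar>) * \<bar>v - w\<bar>"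
        by (rule suminf_mult2[symmetric, OF sm])
      finally show ?thesis .
    qed
    have s2: "summable (\<lambda>j. (\<Sum>k. \<bar>\<nu> k * real (k choose j) * (M + 1) ^ (k - j)\<bar>) * \<bar>v - w\<bar>)"
      by (rule summable_mult2[OF cs])
    have s1: "summable (\<lambda>j. \<bar>taylor_coeff \<nu> v j - taylor_coeff \<nu> w j\<bar>)"
      by (rule summable_comparison_test'[OF s2]) (use d in auto)
    have "(\<Sum>j. \<bar>taylor_coeff \<nu> v j - taylor_coeff \<nu> w j\<bar>)
        \<le> (\<Sum>j. (\<Sum>k. \<bar>\<nu> k * real (k choose j) * (M + 1) ^ (k - j)\<bar>) * \<bar>v - w\<bar>)"
      by (rule suminf_le[OF d s1 s2])
    also have "\<dots> = (\<Sum>j. \<Sum>k. \<bar>\<nu> k * real (k choose j) * (M + 1) ^ (k - j)\<bar>) * \<bar>v - w\<bar>"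
      by (rule suminf_mult2[symmetric, OF cs])
    also have "(\<Sum>j. \<Sum>k. \<bar>\<nu> k * real (k choose j) * (M + 1) ^ (k - j)\<bar>) = majorant \<nu> (M + 2)"
      using sw(4)[of 1 "M + 1"] M unfolding majorant_def by (simp add: mult.assoc add.commute)
    finally show ?thesis .
  qed
qed

lemma taylor_coeff_diff_summable:
  assumes "entire_series \<nu>"
  shows "summable (\<lambda>j. \<bar>taylor_coeff \<nu> v j - taylor_coeff \<nu> w j\<bar>)"
  by (rule summable_comparison_test'[OF summable_add[OF taylor_coeff_summable[OF assms, of v] taylor_coeff_summable[OF assms, of w]]])
     auto

lemma taylor_coeff_0: "taylor_coeff \<nu> v 0 = Nfun \<nu> v"
  by (simp add: taylor_coeff_def Nfun_def)

lemma taylor_coeff_partial_sum_le: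
  assumes "entire_series \<nu>" "\<bar>v\<bar> \<le> M" "finite A"
  shows "(\<Sum>j\<in>A. \<bar>taylor_coeff \<nu> v j\<bar>) \<le> majorant \<nu> (M + 2)"
proof -
  have "(\<Sum>j\<in>A. \<bar>taylor_coeff \<nu> v j\<bar>) \<le> (\<Sum>j. \<bar>taylor_coeff \<nu> v j\<bar>)"
    by (rule sum_le_suminf[OF taylor_coeff_summable]) (use assms in auto)
  also have "\<dots> \<le> majorant \<nu> (M + 1 + 1)"
    by (rule taylor_coeff_abs_sum_le) (use assms in auto)
  finally show ?thesis by (simp add: add.assoc)
qed

lemma taylor_coeff_diff_partial_sum_le:
  assumes "entire_series \<nu>" "\<bar>v\<bar> \<le> M" "\<bar>w\<bar> \<le> M" "finite A"
  shows "(\<Sum>j\<in>A. \<bar>taylor_coeff \<nu> v j - taylor_coeff \<nu> w j\<bar>) \<le> majorant \<nu> (M + 2) * \<bar>v - w\<bar>"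
proof -
  have "(\<Sum>j\<in>A. \<bar>taylor_coeff \<nu> v j - taylor_coeff \<nu> w j\<bar>) \<le> (\<Sum>j. \<bar>taylor_coeff \<nu> v j - taylor_coeff \<nu> w j\<bar>)"
    by (rule sum_le_suminf[OF taylor_coeff_diff_summable]) (use assms in auto)
  then show ?thesis using taylor_coeff_lipschitz[OF assms(1-3)] by linarith
qed

lemma Nfun_bound: "entire_series \<nu> \<Longrightarrow> \<bar>v\<bar> \<le> M \<Longrightarrow> \<bar>Nfun \<nu> v\<bar> \<le> majorant \<nu> (M + 2)"
  using taylor_coeff_partial_sum_le[of \<nu> v M "{0}"] by (simp add: taylor_coeff_0)

lemma Nfun_lipschitz:
  "entire_series \<nu> \<Longrightarrow> \<bar>v\<bar> \<le> M \<Longrightarrow> \<bar>w\<bar> \<le> M \<Longrightarrow>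
    \<bar>Nfun \<nu> v - Nfun \<nu> w\<bar> \<le> majorant \<nu> (M + 2) * \<bar>v - w\<bar>"
  using taylor_coeff_diff_partial_sum_le[of \<nu> v M w "{0}"] by (simp add: taylor_coeff_0)

text \<open>Repeated termwise differentiation: each derivative is again the sum of a power series on the same
  interval.\<close>

lemma power_series_higher_deriv_at_0:
  fixes f :: "real \<Rightarrow> real"
  assumes "\<rho> > 0" and "\<And>x. \<bar>x\<bar> < \<rho> \<Longrightarrow> (\<lambda>n. a n * x ^ n) sums f x"
  shows "(deriv ^^ n) f 0 = fact n * a n"
  using assms(2)
proof (induction n arbitrary: f a)
  case 0
  have "(\<lambda>n. a n * 0 ^ n) sums f 0" using 0[of 0] assms(1) by (simp del: power_0_left)
  then have "f 0 = a 0" using powser_sums_zero_iff[of a "f 0"] by simp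
  then show ?case by simp
next
  case (Suc n)
  have sm: "summable (\<lambda>n. a n * x ^ n)" if "norm x < \<rho>" for x
    using Suc.prems[of x] that by (auto simp: sums_iff)
  have D: "(\<lambda>n. diffs a n * x ^ n) sums deriv f x" if x: "\<bar>x\<bar> < \<rho>" for x
  proof -
    have "((\<lambda>x. \<Sum>n. a n * x ^ n) has_field_derivative (\<Sum>n. diffs a n * x ^ n)) (at x)"
      by (rule termdiffs_strong'[OF sm]) (use x in auto)
    moreover have "(\<Sum>n. a n * y ^ n) = f y" if "\<bar>y\<bar> < \<rho>" for y
      using Suc.prems[OF that] by (simp add: sums_iff)
    ultimately have "(f has_field_derivative (\<Sum>n. diffs a n * x ^ n)) (at x)"
      by (elim has_field_derivative_transform_within_open[where S = "ball 0 \<rho>"]) (use x in auto)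
    then have "deriv f x = (\<Sum>n. diffs a n * x ^ n)" by (rule DERIV_imp_deriv)
    moreover have "summable (\<lambda>n. diffs a n * x ^ n)"
      by (rule termdiff_converges[of x \<rho>]) (use x sm in auto)
    ultimately show ?thesis by (simp add: sums_iff)
  qed
  have "(deriv ^^ Suc n) f 0 = (deriv ^^ n) (deriv f) 0"
    by (simp add: funpow_Suc_right del: funpow.simps)
  also have "\<dots> = fact n * diffs a n" by (rule Suc.IH[OF D])
  finally show ?case by (simp add: diffs_def)
qed

lemma deriv_Nfun:
  assumes "entire_series \<nu>"
  shows "deriv (Nfun \<nu>) v = taylor_coeff \<nu> v 1"
proof -
  have "(deriv ^^ 1) (\<lambda>x. Nfun \<nu> (v + x)) 0 = fact 1 * taylor_coeff \<nu> v 1"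
    by (rule power_series_higher_deriv_at_0[of 1]) (use taylor_coeff_sums[OF assms] in auto)
  moreover have "deriv (\<lambda>x. Nfun \<nu> (v + x)) 0 = deriv (Nfun \<nu>) v"
    unfolding deriv_def using DERIV_shift[of "Nfun \<nu>" _ 0 v] by (simp add: add.commute)
  ultimately show ?thesis by simp
qed

section \<open>Adomian polynomials\<close>

text \<open>The inner series \<open>\<Sum>\<^sub>s\<^sub>\<ge>\<^sub>1 v\<^sub>s \<tau>\<^sup>s\<close> of the composition; \<open>v\<^sub>0\<close> is the centre of the Taylor expansion of the outer
  function.\<close>

definition tail_fps :: "(nat \<Rightarrow> real) \<Rightarrow> real fps" where
  "tail_fps v = Abs_fps (v(0 := 0))"

lemma tail_fps_nth: "fps_nth (tail_fps v) n = (if n = 0 then 0 else v n)"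
  by (simp add: tail_fps_def)

lemma abs_power_nth_le:
  assumes "r \<ge> 0" "wbounded (1/8) r b" "\<bar>\<tau>\<bar> * r \<le> 1"
  shows "\<bar>fps_nth (b ^ j) n * \<tau> ^ n\<bar> \<le> 1 / (real n + 1)\<^sup>2"
proof -
  have "\<bar>fps_nth (b ^ j) n * \<tau> ^ n\<bar> \<le> weight r n * \<bar>\<tau>\<bar> ^ n"
    using wbounded_power_1[OF assms(1,2), of j]
    by (auto simp: wbounded_def abs_mult power_abs intro!: mult_right_mono)
  also have "\<dots> = (\<bar>\<tau>\<bar> * r) ^ n / (real n + 1)\<^sup>2" by (simp add: weight_def power_mult_distrib)
  also have "\<dots> \<le> 1 / (real n + 1)\<^sup>2"
    by (rule divide_right_mono[OF power_le_one]) (use assms in auto)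
  finally show ?thesis .
qed

lemma fps_power_sums:
  assumes "r \<ge> 0" "wbounded (1/8) r b" "\<bar>\<tau>\<bar> * r \<le> 1"
  shows "summable (\<lambda>n. \<bar>fps_nth (b ^ j) n * \<tau> ^ n\<bar>)"
    and "(\<lambda>n. fps_nth (b ^ j) n * \<tau> ^ n) sums (\<Sum>n. fps_nth b n * \<tau> ^ n) ^ j"
proof -
  show sm: "summable (\<lambda>n. \<bar>fps_nth (b ^ j) n * \<tau> ^ n\<bar>)" for j
    by (rule summable_comparison_test'[OF summable_inverse_squares])
       (use abs_power_nth_le[OF assms] in auto)
  show "(\<lambda>n. fps_nth (b ^ j) n * \<tau> ^ n) sums (\<Sum>n. fps_nth b n * \<tau> ^ n) ^ j"
  proof (induction j)
    case 0
    show ?case using sums_finite[of "{0}" "\<lambda>n. fps_nth 1 n * \<tau> ^ n"] by simp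
  next
    case (Suc j)
    have "(\<lambda>n. \<Sum>i\<le>n. (fps_nth b i * \<tau> ^ i) * (fps_nth (b ^ j) (n - i) * \<tau> ^ (n - i))) sums
        ((\<Sum>n. fps_nth b n * \<tau> ^ n) * (\<Sum>n. fps_nth (b ^ j) n * \<tau> ^ n))"
      by (rule Cauchy_product_sums) (use sm[of 1] sm[of j] in auto)
    moreover have "(\<Sum>i\<le>n. (fps_nth b i * \<tau> ^ i) * (fps_nth (b ^ j) (n - i) * \<tau> ^ (n - i)))
        = fps_nth (b ^ Suc j) n * \<tau> ^ n" for n
      by (simp add: fps_mult_nth atLeast0AtMost sum_distrib_right)
         (intro sum.cong, auto simp: mult_ac simp flip: power_add)
    ultimately show ?case using Suc.IH by (simp add: sums_iff)
  qed
qed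

text \<open>Composition of convergent power series. The size \<open>1/8\<close> of the inner series keeps the coefficients of all
  its powers below one fixed summable sequence, so the sums over \<open>j\<close> and \<open>n\<close> can be interchanged.\<close>

lemma composition_sums:
  assumes "r \<ge> 0" "wbounded (1/8) r b" "\<bar>\<tau>\<bar> * r \<le> 1" and b0: "fps_nth b 0 = 0"
    and c: "summable (\<lambda>j. \<bar>c j\<bar>)"
  shows "(\<lambda>n. (\<Sum>j\<le>n. c j * fps_nth (b ^ j) n) * \<tau> ^ n) sums
      (\<Sum>j. c j * (\<Sum>n. fps_nth b n * \<tau> ^ n) ^ j)"
proof -
  let ?f = "\<lambda>j n. c j * (fps_nth (b ^ j) n * \<tau> ^ n)"
  have s1: "summable (\<lambda>n. \<bar>?f j n\<bar>)" for j
    using summable_mult[OF fps_power_sums(1)[OF assms(1-3), of j], of "\<bar>c j\<bar>"] by (simp add: abs_mult)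
  have le: "\<bar>?f j n\<bar> \<le> \<bar>c j\<bar> * (1 / (real n + 1)\<^sup>2)" for j n
    unfolding abs_mult[of "c j"]
    by (intro mult_left_mono abs_power_nth_le[OF assms(1-3)]) simp
  have s2: "summable (\<lambda>j. \<Sum>n. \<bar>?f j n\<bar>)"
  proof (rule summable_comparison_test')
    show "summable (\<lambda>j. \<bar>c j\<bar> * (\<Sum>n. 1 / (real n + 1)\<^sup>2))" by (rule summable_mult2[OF c])
    fix j
    have "(\<Sum>n. \<bar>?f j n\<bar>) \<le> (\<Sum>n. \<bar>c j\<bar> * (1 / (real n + 1)\<^sup>2))"
      by (rule suminf_le[OF le s1]) (rule summable_mult[OF summable_inverse_squares])
    also have "\<dots> = \<bar>c j\<bar> * (\<Sum>n. 1 / (real n + 1)\<^sup>2)"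
      by (rule suminf_mult[OF summable_inverse_squares])
    finally show "norm (\<Sum>n. \<bar>?f j n\<bar>) \<le> \<bar>c j\<bar> * (\<Sum>n. 1 / (real n + 1)\<^sup>2)"
      using suminf_nonneg[OF s1[of j]] by simp
  qed
  have "(\<lambda>n. \<Sum>j. ?f j n) sums (\<Sum>j. \<Sum>n. ?f j n)" by (rule sums_swap(1)[OF s1 s2])
  moreover have "(\<Sum>n. ?f j n) = c j * (\<Sum>n. fps_nth b n * \<tau> ^ n) ^ j" for j
    using sums_unique[OF sums_mult[OF fps_power_sums(2)[OF assms(1-3), of j], of "c j"]] by simp
  moreover have "(\<Sum>j. ?f j n) = (\<Sum>j\<le>n. c j * fps_nth (b ^ j) n) * \<tau> ^ n" for n
  proof -
    have "(\<Sum>j. ?f j n) = (\<Sum>j\<le>n. ?f j n)"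
    proof (rule suminf_finite)
      fix j assume "j \<notin> {..n}"
      then show "?f j n = 0" using startsby_zero_power_prefix[OF b0, of j] by simp
    qed simp
    then show ?thesis by (simp add: sum_distrib_right mult.assoc)
  qed
  ultimately show ?thesis by simp
qed

text \<open>The derivatives in the definition of \<open>A\<^sub>n\<close> are read off from the power series of
  \<open>\<tau> \<mapsto> N(\<Sum>\<^sub>s\<^sub>\<le>\<^sub>n v\<^sub>s \<tau>\<^sup>s)\<close>. The inner sum is finite, so a large enough \<open>r\<close> puts it in the scope of
  \<open>composition_sums\<close> for \<open>\<bar>\<tau>\<bar> \<le> 1/r\<close>.\<close>

lemma adomian_eq:
  assumes \<nu>: "entire_series \<nu>"
  shows "adomian (Nfun \<nu>) n v = (\<Sum>j\<le>n. taylor_coeff \<nu> (v 0) j * fps_nth (tail_fps v ^ j) n)"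
proof -
  \<comment> \<open>This value of \<open>r\<close> makes \<open>8 \<bar>v\<^sub>s\<bar> (s + 1)\<^sup>2 \<le> r \<le> r\<^sup>s\<close> for all \<open>1 \<le> s \<le> n\<close>.\<close>
  define b where "b = Abs_fps (\<lambda>s. if 1 \<le> s \<and> s \<le> n then v s else 0)"
  define r where "r = 1 + (\<Sum>s\<le>n. 8 * \<bar>v s\<bar> * (real s + 1)\<^sup>2)"
  have r1: "r \<ge> 1" unfolding r_def by (simp add: sum_nonneg)
  have wb: "wbounded (1/8) r b"
    unfolding wbounded_def
  proof
    fix s
    show "\<bar>fps_nth b s\<bar> \<le> 1/8 * weight r s"
    proof (cases "1 \<le> s \<and> s \<le> n")
      case True
      have "8 * \<bar>v s\<bar> * (real s + 1)\<^sup>2 \<le> (\<Sum>s\<le>n. 8 * \<bar>v s\<bar> * (real s + 1)\<^sup>2)"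
        by (rule member_le_sum) (use True in auto)
      also have "\<dots> \<le> r" by (simp add: r_def)
      also have "r \<le> r ^ s" using r1 True by (intro self_le_power) auto
      finally show ?thesis using True by (simp add: b_def weight_def field_simps)
    qed (use r1 in \<open>auto simp: b_def weight_nonneg\<close>)
  qed
  have b0: "fps_nth b 0 = 0" by (simp add: b_def)
  have ev: "(\<Sum>s. fps_nth b s * \<tau> ^ s) = (\<Sum>s\<in>{1..n}. v s * \<tau> ^ s)" for \<tau>
    by (subst suminf_finite[of "{1..n}"]) (auto simp: b_def)
  have N: "Nfun \<nu> (\<Sum>s\<le>n. v s * \<tau> ^ s) = (\<Sum>j. taylor_coeff \<nu> (v 0) j * (\<Sum>s. fps_nth b s * \<tau> ^ s) ^ j)" for \<tau>
  proof -
    have "(\<Sum>s\<le>n. v s * \<tau> ^ s) = v 0 + (\<Sum>s\<in>{1..n}. v s * \<tau> ^ s)"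
      using sum.atLeast_Suc_atMost[of 0 n "\<lambda>s. v s * \<tau> ^ s"] by (simp add: atLeast0AtMost)
    then show ?thesis unfolding ev using taylor_coeff_sums[OF \<nu>, of "v 0" "\<Sum>s\<in>{1..n}. v s * \<tau> ^ s"]
      by (simp add: sums_iff)
  qed
  have "(deriv ^^ n) (\<lambda>\<tau>. Nfun \<nu> (\<Sum>s\<le>n. v s * \<tau> ^ s)) 0
      = fact n * (\<Sum>j\<le>n. taylor_coeff \<nu> (v 0) j * fps_nth (b ^ j) n)"
  proof (rule power_series_higher_deriv_at_0[of "1 / r"])
    fix x :: real assume "\<bar>x\<bar> < 1 / r"
    then have "\<bar>x\<bar> * r \<le> 1" using r1 by (simp add: field_simps)
    then show "(\<lambda>m. (\<Sum>j\<le>m. taylor_coeff \<nu> (v 0) j * fps_nth (b ^ j) m) * x ^ m) sums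
        Nfun \<nu> (\<Sum>s\<le>n. v s * x ^ s)"
      unfolding N by (intro composition_sums[OF _ wb _ b0]) (use r1 taylor_coeff_summable[OF \<nu>] in auto)
  qed (use r1 in simp)
  moreover have "fps_nth (b ^ j) n = fps_nth (tail_fps v ^ j) n" for j
    by (rule fps_power_nth_cong) (auto simp: b_def tail_fps_nth)
  ultimately show ?thesis by (simp add: adomian_def)
qed

section \<open>Bounds of the right-hand sides\<close>

text \<open>Sizes of the values \<open>u\<^sup>(\<^sup>0\<^sup>), \<dots>, u\<^sup>(\<^sup>n\<^sup>)\<close> at one point. The term of index 0 has its own bound because it is
  of order one, whereas \<open>\<eta>\<close> is small.\<close>

definition weighted_seq :: "real \<Rightarrow> real \<Rightarrow> real \<Rightarrow> nat \<Rightarrow> (nat \<Rightarrow> real) \<Rightarrow> bool" where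
  "weighted_seq M \<eta> r n v \<longleftrightarrow> \<bar>v 0\<bar> \<le> M \<and> (\<forall>s\<in>{1..n}. \<bar>v s\<bar> \<le> \<eta> * weight r s)"

lemma weighted_seq_mono: "weighted_seq M \<eta> r n v \<Longrightarrow> m \<le> n \<Longrightarrow> weighted_seq M \<eta> r m v"
  by (auto simp: weighted_seq_def)

lemma adomian_cong:
  assumes "\<And>s. s \<le> n \<Longrightarrow> v s = w s"
  shows "adomian N n v = adomian N n w"
proof -
  have "(\<Sum>s\<le>n. v s * \<tau> ^ s) = (\<Sum>s\<le>n. w s * \<tau> ^ s)" for \<tau>
    by (rule sum.cong) (use assms in auto)
  then show ?thesis by (simp add: adomian_def)
qed

text \<open>Bounds on \<open>v\<^sub>0, \<dots>, v\<^sub>n\<close> suffice for \<open>A\<^sub>n\<close>. Truncation turns them into bounds on all coefficients of a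
  power series; this matters in the induction over the rank, where later terms are not yet
  controlled.\<close>

definition truncate_seq :: "nat \<Rightarrow> (nat \<Rightarrow> real) \<Rightarrow> nat \<Rightarrow> real" where
  "truncate_seq n v = (\<lambda>s. if s \<le> n then v s else 0)"

lemma adomian_truncated:
  assumes "entire_series \<nu>"
  shows "adomian (Nfun \<nu>) n v = (\<Sum>j\<le>n. taylor_coeff \<nu> (v 0) j * fps_nth (tail_fps (truncate_seq n v) ^ j) n)"
proof -
  have "adomian (Nfun \<nu>) n v = adomian (Nfun \<nu>) n (truncate_seq n v)"
    by (rule adomian_cong) (simp add: truncate_seq_def)
  then show ?thesis by (simp add: adomian_eq[OF assms] truncate_seq_def)
qed

lemma wbounded_tail_truncated:
  assumes "weighted_seq M \<eta> r n v" "r \<ge> 0" "\<eta> \<ge> 0"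
  shows "wbounded \<eta> r (tail_fps (truncate_seq n v))"
  unfolding wbounded_def using assms by (auto simp: tail_fps_nth truncate_seq_def weighted_seq_def weight_nonneg)

text \<open>The term of the equation for \<open>u\<^sup>(\<^sup>k\<^sup>)\<close> that contains \<open>N'\<close>, and the zero in the last argument of \<open>A\<^sub>k\<close> in
  \<open>F\<^sup>(\<^sup>k\<^sup>)\<close>, come from this splitting of \<open>A\<^sub>k\<close>.\<close>

lemma adomian_split_top:
  assumes \<nu>: "entire_series \<nu>" and n: "n \<ge> 1"
  shows "adomian (Nfun \<nu>) n v = adomian (Nfun \<nu>) n (v(n := 0)) + deriv (Nfun \<nu>) (v 0) * v n"
proof -
  have t: "fps_nth (tail_fps v ^ j) n - fps_nth (tail_fps (v(n := 0)) ^ j) n = (if j = 1 then v n else 0)" for j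
  proof -
    consider "j = 0" | "j = 1" | "j \<ge> 2" by linarith
    then show ?thesis
    proof cases
      case 3
      then have "fps_nth (tail_fps v ^ j) n = fps_nth (tail_fps (v(n := 0)) ^ j) n"
        by (intro fps_power_nth_top_irrelevant) (auto simp: tail_fps_nth)
      with 3 show ?thesis by simp
    qed (use n in \<open>auto simp: tail_fps_nth\<close>)
  qed
  have "adomian (Nfun \<nu>) n v - adomian (Nfun \<nu>) n (v(n := 0))
      = (\<Sum>j\<le>n. taylor_coeff \<nu> (v 0) j * (fps_nth (tail_fps v ^ j) n - fps_nth (tail_fps (v(n := 0)) ^ j) n))"
    using n by (simp add: adomian_eq[OF \<nu>] right_diff_distrib sum_subtractf)
  also have "\<dots> = (\<Sum>j\<le>n. if j = 1 then taylor_coeff \<nu> (v 0) j * v n else 0)"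
    by (rule sum.cong) (auto simp: t)
  also have "\<dots> = taylor_coeff \<nu> (v 0) 1 * v n"
    by (subst sum.delta) (use n in auto)
  finally show ?thesis by (simp add: deriv_Nfun[OF \<nu>])
qed

text \<open>The coefficient of \<open>\<tau>\<^sup>k\<close> in \<open>N(w) v + \<tau> (N(v) - N(w)) v\<close>, where \<open>v\<close> and \<open>w\<close> stand for the power series in
  \<open>\<tau>\<close> with the given coefficients, that is, for the expansions at a point and at the corner of its cell.\<close>

definition fd_coeff :: "(nat \<Rightarrow> real) \<Rightarrow> (nat \<Rightarrow> real) \<Rightarrow> (nat \<Rightarrow> real) \<Rightarrow> nat \<Rightarrow> real" where
  "fd_coeff \<nu> v w k = (\<Sum>s\<le>k. v s * adomian (Nfun \<nu>) (k - s) w)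
     + (if k = 0 then 0 else \<Sum>s\<le>k-1. v s * (adomian (Nfun \<nu>) (k - 1 - s) v - adomian (Nfun \<nu>) (k - 1 - s) w))"

context
  fixes \<nu> :: "nat \<Rightarrow> real" and M \<eta> r C :: real
  assumes \<nu>: "entire_series \<nu>" and C: "C = majorant \<nu> (M + 2)" and M: "M \<ge> 0"
    and r: "r > 0" and \<eta>: "\<eta> \<ge> 0" "16 * \<eta> \<le> 1"
begin

lemma C_nonneg: "C \<ge> 0"
  unfolding C by (rule majorant_nonneg[OF \<nu>]) (use M in simp)

lemma weighted_taylor_sum_le:
  assumes v: "\<bar>v\<bar> \<le> M" and K: "K \<ge> 0" and x: "\<And>j. j \<in> {..n} \<Longrightarrow> \<bar>x j\<bar> \<le> K * weight r n"
  shows "\<bar>\<Sum>j\<le>n. taylor_coeff \<nu> v j * x j\<bar> \<le> C * K * weight r n"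
proof -
  have "\<bar>\<Sum>j\<le>n. taylor_coeff \<nu> v j * x j\<bar> \<le> (\<Sum>j\<le>n. \<bar>taylor_coeff \<nu> v j\<bar> * (K * weight r n))"
    by (rule order_trans[OF sum_abs]) (intro sum_mono, simp add: abs_mult mult_left_mono x)
  also have "\<dots> = (\<Sum>j\<le>n. \<bar>taylor_coeff \<nu> v j\<bar>) * (K * weight r n)" by (simp add: sum_distrib_right)
  also have "\<dots> \<le> C * (K * weight r n)"
    unfolding C by (intro mult_right_mono taylor_coeff_partial_sum_le[OF \<nu> v]) (use K r in \<open>auto simp: weight_nonneg\<close>)
  finally show ?thesis by (simp add: mult.assoc)
qed

lemma adomian_bound:
  assumes v: "weighted_seq M \<eta> r n v"
  shows "\<bar>adomian (Nfun \<nu>) n v\<bar> \<le> C * 1 * weight r n"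
  unfolding adomian_truncated[OF \<nu>]
proof (rule weighted_taylor_sum_le)
  fix j :: nat
  have "wbounded 1 r (tail_fps (truncate_seq n v) ^ j)"
    by (rule wbounded_power_1[OF _ wbounded_tail_truncated[OF v]]) (use r \<eta> in auto)
  then show "\<bar>fps_nth (tail_fps (truncate_seq n v) ^ j) n\<bar> \<le> 1 * weight r n" by (simp add: wbounded_def)
qed (use v in \<open>auto simp: weighted_seq_def\<close>)

lemma adomian_bound_linear:
  assumes v: "weighted_seq M \<eta> r n v" and n: "n \<ge> 1"
  shows "\<bar>adomian (Nfun \<nu>) n v\<bar> \<le> C * \<eta> * weight r n"
  unfolding adomian_truncated[OF \<nu>]
proof (rule weighted_taylor_sum_le)
  fix j :: nat
  have b: "wbounded \<eta> r (tail_fps (truncate_seq n v))"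
    by (rule wbounded_tail_truncated[OF v]) (use r \<eta> in auto)
  show "\<bar>fps_nth (tail_fps (truncate_seq n v) ^ j) n\<bar> \<le> \<eta> * weight r n"
  proof (cases "j = 0")
    case False
    then have "wbounded \<eta> r (tail_fps (truncate_seq n v) ^ j)"
      by (intro wbounded_power_linear[OF _ b]) (use r \<eta> in auto)
    then show ?thesis by (simp add: wbounded_def)
  qed (use n r \<eta> in \<open>auto simp: weight_nonneg\<close>)
qed (use v \<eta> in \<open>auto simp: weighted_seq_def\<close>)

text \<open>Without \<open>v\<^sub>n\<close> the linear part of the composition has no coefficient of index \<open>n\<close>, so only powers \<open>j \<ge> 2\<close>
  contribute.\<close>

lemma adomian_bound_quadratic:
  assumes v: "weighted_seq M \<eta> r (n - 1) v" and n: "n \<ge> 1"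
  shows "\<bar>adomian (Nfun \<nu>) n (v(n := 0))\<bar> \<le> C * (8 * \<eta>\<^sup>2) * weight r n"
  unfolding adomian_truncated[OF \<nu>]
proof (rule weighted_taylor_sum_le)
  have w: "weighted_seq M \<eta> r n (v(n := 0))"
    using v n r \<eta> by (auto simp: weighted_seq_def weight_nonneg)
  fix j :: nat
  let ?b = "tail_fps (truncate_seq n (v(n := 0)))"
  have b: "wbounded \<eta> r ?b" by (rule wbounded_tail_truncated[OF w]) (use r \<eta> in auto)
  consider "j = 0" | "j = 1" | "j \<ge> 2" by linarith
  then show "\<bar>fps_nth (?b ^ j) n\<bar> \<le> 8 * \<eta>\<^sup>2 * weight r n"
  proof cases
    case 3
    then have "wbounded (8 * \<eta>\<^sup>2) r (?b ^ j)"
      by (intro wbounded_power_quadratic[OF _ b]) (use r \<eta> in auto)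
    then show ?thesis by (simp add: wbounded_def)
  qed (use n r \<eta> in \<open>auto simp: weight_nonneg tail_fps_nth truncate_seq_def\<close>)
qed (use v n \<eta> in \<open>auto simp: weighted_seq_def\<close>)

text \<open>The change of the centre \<open>v\<^sub>0\<close> enters through the Lipschitz bound of the Taylor coefficients, the change of the
  other entries through the powers of the inner series.\<close>

lemma adomian_lipschitz:
  assumes v: "weighted_seq M \<eta> r n v" and w: "weighted_seq M \<eta> r n w" and d: "weighted_seq d \<theta> r n (\<lambda>s. v s - w s)"
    and \<theta>: "\<theta> \<ge> 0"
  shows "\<bar>adomian (Nfun \<nu>) n v - adomian (Nfun \<nu>) n w\<bar> \<le> C * (d + 2 * \<theta>) * weight r n"
proof -
  let ?b = "tail_fps (truncate_seq n v)" and ?c = "tail_fps (truncate_seq n w)"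
  have bv: "wbounded \<eta> r ?b" and bw: "wbounded \<eta> r ?c"
    by (rule wbounded_tail_truncated[OF v] wbounded_tail_truncated[OF w]; use r \<eta> in simp)+
  have "?b - ?c = tail_fps (truncate_seq n (\<lambda>s. v s - w s))"
    by (rule fps_ext) (simp add: tail_fps_nth truncate_seq_def)
  then have bd: "wbounded \<theta> r (?b - ?c)"
    using wbounded_tail_truncated[OF d] r \<theta> by simp
  have v0: "\<bar>v 0\<bar> \<le> M" "\<bar>w 0\<bar> \<le> M" "\<bar>v 0 - w 0\<bar> \<le> d" using v w d by (auto simp: weighted_seq_def)
  have "adomian (Nfun \<nu>) n v - adomian (Nfun \<nu>) n w
      = (\<Sum>j\<le>n. (taylor_coeff \<nu> (v 0) j - taylor_coeff \<nu> (w 0) j) * fps_nth (?b ^ j) n)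
        + (\<Sum>j\<le>n. taylor_coeff \<nu> (w 0) j * fps_nth (?b ^ j - ?c ^ j) n)"
    unfolding adomian_truncated[OF \<nu>] by (simp add: sum.distrib[symmetric] sum_subtractf[symmetric] algebra_simps)
  moreover have "\<bar>\<Sum>j\<le>n. taylor_coeff \<nu> (w 0) j * fps_nth (?b ^ j - ?c ^ j) n\<bar> \<le> C * (2 * \<theta>) * weight r n"
    by (rule weighted_taylor_sum_le[OF v0(2)])
       (use \<theta> wbounded_power_diff[OF _ bv bw _ bd] r \<eta> in \<open>auto simp: wbounded_def\<close>)
  moreover have "\<bar>\<Sum>j\<le>n. (taylor_coeff \<nu> (v 0) j - taylor_coeff \<nu> (w 0) j) * fps_nth (?b ^ j) n\<bar> \<le> C * d * weight r n"
  proof -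
    have p: "\<bar>fps_nth (?b ^ j) n\<bar> \<le> weight r n" for j
      using wbounded_power_1[OF _ bv, of j] r \<eta> by (auto simp: wbounded_def)
    have "\<bar>\<Sum>j\<le>n. (taylor_coeff \<nu> (v 0) j - taylor_coeff \<nu> (w 0) j) * fps_nth (?b ^ j) n\<bar>
        \<le> (\<Sum>j\<le>n. \<bar>taylor_coeff \<nu> (v 0) j - taylor_coeff \<nu> (w 0) j\<bar> * weight r n)"
      by (rule order_trans[OF sum_abs]) (intro sum_mono, simp add: abs_mult mult_left_mono p)
    also have "\<dots> = (\<Sum>j\<le>n. \<bar>taylor_coeff \<nu> (v 0) j - taylor_coeff \<nu> (w 0) j\<bar>) * weight r n" by (simp add: sum_distrib_right)
    also have "\<dots> \<le> (C * \<bar>v 0 - w 0\<bar>) * weight r n"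
      unfolding C by (intro mult_right_mono taylor_coeff_diff_partial_sum_le[OF \<nu>] v0) (use r in \<open>auto simp: weight_nonneg\<close>)
    also have "\<dots> \<le> (C * d) * weight r n"
      by (intro mult_right_mono mult_left_mono v0 C_nonneg) (use r in \<open>auto simp: weight_nonneg\<close>)
    finally show ?thesis .
  qed
  ultimately show ?thesis by (simp add: algebra_simps)
qed

text \<open>The heart of the recursion. The first two parts of \<open>F\<^sup>(\<^sup>k\<^sup>)\<close> contain at least two of the small entries and
  are quadratic in \<open>\<eta>\<close>. The last sum is proportional to the variation \<open>d, \<theta>\<close> between \<open>p\<close> and \<open>q\<close>, but has
  total index \<open>k - 1\<close>, whence the factor \<open>1/r\<close>.\<close>

lemma fd_rhs_bound:
  assumes k: "k \<ge> 1" and M1: "M \<ge> 1"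
    and p: "weighted_seq M \<eta> r (k - 1) (\<lambda>s. U s p)" and q: "weighted_seq M \<eta> r (k - 1) (\<lambda>s. U s q)"
    and d: "weighted_seq d \<theta> r (k - 1) (\<lambda>s. U s q - U s p)" and \<theta>: "\<theta> \<ge> 0"
  shows "\<bar>fd_rhs (Nfun \<nu>) U k q p\<bar> \<le> (8 * C * \<eta>\<^sup>2 * (1 + M) + 32 * C * M * (d + 2 * \<theta>) / r) * weight r k"
proof -
  have d0: "d \<ge> 0" using d by (auto simp: weighted_seq_def)
  have "\<bar>\<Sum>s\<in>{1..<k}. adomian (Nfun \<nu>) (k - s) (\<lambda>r. U r q) * U s p\<bar> \<le> 8 * \<eta> * (C * \<eta>) * weight r k"
  proof -
    define a b where "a = (\<lambda>s. if 1 \<le> s \<and> s < k then U s p else 0)"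
      and "b = (\<lambda>s. if 1 \<le> s \<and> s < k then adomian (Nfun \<nu>) s (\<lambda>r. U r q) else 0)"
    have "(\<Sum>s\<in>{1..<k}. adomian (Nfun \<nu>) (k - s) (\<lambda>r. U r q) * U s p) = (\<Sum>s\<in>{1..<k}. a s * b (k - s))"
      by (rule sum.cong) (auto simp: a_def b_def)
    also have "\<dots> = (\<Sum>s\<le>k. a s * b (k - s))"
      by (rule sum.mono_neutral_left) (auto simp: a_def)
    also have "\<bar>\<dots>\<bar> \<le> (\<Sum>s\<le>k. \<bar>a s * b (k - s)\<bar>)" by (rule sum_abs)
    also have "\<dots> \<le> 8 * \<eta> * (C * \<eta>) * weight r k"
    proof (rule convolution_bound)
      show "\<bar>a s\<bar> \<le> \<eta> * weight r s" for s
        using p r \<eta> by (auto simp: a_def weighted_seq_def weight_nonneg)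
      have "\<bar>adomian (Nfun \<nu>) s (\<lambda>r. U r q)\<bar> \<le> C * \<eta> * weight r s" if "1 \<le> s" "s < k" for s
        by (rule adomian_bound_linear[OF weighted_seq_mono[OF q]]) (use that in auto)
      then show "\<bar>b s\<bar> \<le> C * \<eta> * weight r s" for s
        using C_nonneg r \<eta> by (auto simp: b_def weight_nonneg)
    qed (use r \<eta> in auto)
    finally show ?thesis .
  qed
  moreover have "\<bar>adomian (Nfun \<nu>) k ((\<lambda>r. U r q)(k := 0)) * U 0 p\<bar> \<le> (C * (8 * \<eta>\<^sup>2) * weight r k) * M"
    unfolding abs_mult
    by (intro mult_mono adomian_bound_quadratic[OF q k])
       (use p C_nonneg r in \<open>auto simp: weighted_seq_def weight_nonneg\<close>)
  moreover have "\<bar>\<Sum>s<k. (adomian (Nfun \<nu>) (k - 1 - s) (\<lambda>r. U r q) - adomian (Nfun \<nu>) (k - 1 - s) (\<lambda>r. U r p)) * U s p\<bar>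
      \<le> 8 * M * (C * (d + 2 * \<theta>)) * (4 / r * weight r k)"
  proof -
    let ?D = "\<lambda>n. adomian (Nfun \<nu>) n (\<lambda>r. U r q) - adomian (Nfun \<nu>) n (\<lambda>r. U r p)"
    have "{..<k} = {..k-1}" using k by auto
    then have eq: "(\<Sum>s<k. ?D (k - 1 - s) * U s p) = (\<Sum>s\<le>k-1. U s p * ?D (k - 1 - s))"
      by (simp only: mult.commute)
    have "\<bar>\<Sum>s<k. ?D (k - 1 - s) * U s p\<bar> \<le> (\<Sum>s\<le>k-1. \<bar>U s p * ?D (k - 1 - s)\<bar>)"
      unfolding eq by (rule sum_abs)
    also have "\<dots> \<le> 8 * M * (C * (d + 2 * \<theta>)) * weight r (k - 1)"
    proof (rule convolution_bound)
      fix s assume s: "s \<le> k - 1"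
      show "\<bar>U s p\<bar> \<le> M * weight r s"
      proof (cases "s = 0")
        case False
        then have "\<bar>U s p\<bar> \<le> \<eta> * weight r s" using p s by (auto simp: weighted_seq_def)
        also have "\<dots> \<le> M * weight r s" by (intro mult_right_mono) (use \<eta> M1 r in \<open>auto simp: weight_nonneg\<close>)
        finally show ?thesis .
      qed (use p in \<open>auto simp: weighted_seq_def\<close>)
      show "\<bar>?D s\<bar> \<le> C * (d + 2 * \<theta>) * weight r s"
        by (rule adomian_lipschitz) (use weighted_seq_mono[OF p s] weighted_seq_mono[OF q s] weighted_seq_mono[OF d s] \<theta> in auto)
    qed (use r M in auto)
    also have "\<dots> \<le> 8 * M * (C * (d + 2 * \<theta>)) * (4 / r * weight r k)"
      by (intro mult_left_mono weight_pred_le[OF k r]) (use M C_nonneg d0 \<theta> in auto)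
    finally show ?thesis .
  qed
  ultimately have "\<bar>fd_rhs (Nfun \<nu>) U k q p\<bar>
      \<le> 8 * \<eta> * (C * \<eta>) * weight r k + (C * (8 * \<eta>\<^sup>2) * weight r k) * M + 8 * M * (C * (d + 2 * \<theta>)) * (4 / r * weight r k)"
    unfolding fd_rhs_def by linarith
  then show ?thesis by (simp add: algebra_simps add_divide_distrib power2_eq_square)
qed

lemma adomian_sums:
  assumes r1: "r \<le> 1" and v: "\<And>n. weighted_seq M \<eta> r n v"
  shows "summable (\<lambda>n. \<bar>v n\<bar>)" and "(\<lambda>n. adomian (Nfun \<nu>) n v) sums Nfun \<nu> (\<Sum>n. v n)"
proof -
  have bd: "\<bar>v n\<bar> \<le> \<eta> * weight r n" if "n \<ge> 1" for n using v[of n] that by (auto simp: weighted_seq_def)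
  show sv: "summable (\<lambda>n. \<bar>v n\<bar>)"
    by (rule summable_comparison_test'[OF summable_mult[OF weight_summable[OF r r1], of \<eta>], of 1]) (use bd in auto)
  have wb: "wbounded (1/8) r (tail_fps v)"
  proof -
    have "wbounded \<eta> r (tail_fps v)"
      unfolding wbounded_def using bd r \<eta> by (auto simp: tail_fps_nth weight_nonneg)
    then show ?thesis by (rule wbounded_mono) (use r \<eta> in auto)
  qed
  have "(\<lambda>n. (\<Sum>j\<le>n. taylor_coeff \<nu> (v 0) j * fps_nth (tail_fps v ^ j) n) * 1 ^ n) sums
      (\<Sum>j. taylor_coeff \<nu> (v 0) j * (\<Sum>n. fps_nth (tail_fps v) n * 1 ^ n) ^ j)"
    by (rule composition_sums[OF _ wb]) (use r r1 taylor_coeff_summable[OF \<nu>] in \<open>auto simp: tail_fps_nth\<close>)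
  also have "(\<Sum>j. taylor_coeff \<nu> (v 0) j * (\<Sum>n. fps_nth (tail_fps v) n * 1 ^ n) ^ j)
      = Nfun \<nu> (v 0 + (\<Sum>n. fps_nth (tail_fps v) n * 1 ^ n))"
    using taylor_coeff_sums[OF \<nu>] by (simp add: sums_iff)
  also have "v 0 + (\<Sum>n. fps_nth (tail_fps v) n * 1 ^ n) = (\<Sum>n. v n)"
  proof -
    have "summable (\<lambda>n. fps_nth (tail_fps v) n)"
      by (rule summable_rabs_cancel, rule summable_comparison_test'[OF sv]) (auto simp: tail_fps_nth)
    then show ?thesis
      using suminf_split_head[of v] suminf_split_head[of "\<lambda>n. fps_nth (tail_fps v) n"] summable_rabs_cancel[OF sv]
      by (simp add: tail_fps_nth)
  qed
  finally show "(\<lambda>n. adomian (Nfun \<nu>) n v) sums Nfun \<nu> (\<Sum>n. v n)"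
    by (simp add: adomian_eq[OF \<nu>])
qed

text \<open>At \<open>\<tau> = 1\<close> the frozen terms \<open>N(w) v\<close> cancel. The second part bounds the coefficients uniformly,
  so the convergence is uniform in the points at which \<open>v\<close> and \<open>w\<close> are taken.\<close>

lemma fd_coeff_sums:
  assumes r1: "r \<le> 1" and M1: "M \<ge> 1" and v: "\<And>n. weighted_seq M \<eta> r n v" and w: "\<And>n. weighted_seq M \<eta> r n w"
  shows "(\<lambda>k. fd_coeff \<nu> v w k) sums ((\<Sum>n. v n) * Nfun \<nu> (\<Sum>n. v n))"
    and "\<bar>fd_coeff \<nu> v w k\<bar> \<le> (8 * M * C + 64 * M * C / r) * weight r k"
proof -
  have ab: "\<bar>adomian (Nfun \<nu>) n x\<bar> \<le> C * weight r n" if "\<And>n. weighted_seq M \<eta> r n x" for x n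
    using adomian_bound[OF that] by simp
  have sa: "summable (\<lambda>n. \<bar>adomian (Nfun \<nu>) n x\<bar>)" if "\<And>n. weighted_seq M \<eta> r n x" for x
    by (rule summable_comparison_test'[OF summable_mult[OF weight_summable[OF r r1], of C]]) (use ab[OF that] in auto)
  let ?V = "\<Sum>n. v n" and ?W = "\<Sum>n. w n"
  let ?D = "\<lambda>n. adomian (Nfun \<nu>) n v - adomian (Nfun \<nu>) n w"
  have sD: "summable (\<lambda>n. \<bar>?D n\<bar>)"
    by (rule summable_comparison_test'[OF summable_add[OF sa[OF v] sa[OF w]]]) auto
  have D: "?D sums (Nfun \<nu> ?V - Nfun \<nu> ?W)"
    by (intro sums_diff adomian_sums(2)[OF r1] v w)
  have A: "(\<lambda>k. \<Sum>s\<le>k. v s * adomian (Nfun \<nu>) (k - s) w) sums (?V * Nfun \<nu> ?W)"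
    using Cauchy_product_sums[of v "\<lambda>n. adomian (Nfun \<nu>) n w"] adomian_sums(1)[OF r1 v] sa[OF w]
      adomian_sums(2)[OF r1 w] by (simp add: sums_iff)
  have B: "(\<lambda>k. \<Sum>s\<le>k. v s * ?D (k - s)) sums (?V * (Nfun \<nu> ?V - Nfun \<nu> ?W))"
    using Cauchy_product_sums[of v ?D] adomian_sums(1)[OF r1 v] sD D by (simp add: sums_iff)
  have "(\<lambda>k. if k = 0 then 0 else \<Sum>s\<le>k-1. v s * ?D (k - 1 - s)) sums (?V * (Nfun \<nu> ?V - Nfun \<nu> ?W))"
    using sums_Suc[of "\<lambda>k. if k = 0 then 0 else \<Sum>s\<le>k-1. v s * ?D (k - 1 - s)"] B by simp
  from sums_add[OF A this] show "(\<lambda>k. fd_coeff \<nu> v w k) sums ((\<Sum>n. v n) * Nfun \<nu> (\<Sum>n. v n))"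
    unfolding fd_coeff_def by (simp add: algebra_simps)
  have vM: "\<bar>v n\<bar> \<le> M * weight r n" for n
  proof (cases "n = 0")
    case False
    then have "\<bar>v n\<bar> \<le> \<eta> * weight r n" using v[of n] by (auto simp: weighted_seq_def)
    also have "\<dots> \<le> M * weight r n" by (intro mult_right_mono) (use \<eta> M1 r in \<open>auto simp: weight_nonneg\<close>)
    finally show ?thesis .
  qed (use v[of 0] in \<open>auto simp: weighted_seq_def\<close>)
  have 1: "\<bar>\<Sum>s\<le>k. v s * adomian (Nfun \<nu>) (k - s) w\<bar> \<le> 8 * M * C * weight r k"
    by (rule order_trans[OF sum_abs convolution_bound]) (use vM ab[OF w] r M in auto)
  have 2: "\<bar>if k = 0 then 0 else \<Sum>s\<le>k-1. v s * ?D (k - 1 - s)\<bar> \<le> 64 * M * C / r * weight r k"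
  proof (cases "k = 0")
    case False
    have "\<bar>?D n\<bar> \<le> 2 * C * weight r n" for n
      using ab[OF v, of n] ab[OF w, of n] by linarith
    then have "\<bar>\<Sum>s\<le>k-1. v s * ?D (k - 1 - s)\<bar> \<le> 8 * M * (2 * C) * weight r (k - 1)"
      by (intro order_trans[OF sum_abs convolution_bound]) (use vM r M in auto)
    also have "\<dots> \<le> 8 * M * (2 * C) * (4 / r * weight r k)"
      by (intro mult_left_mono weight_pred_le r) (use M C_nonneg False in auto)
    finally show ?thesis using False by (simp add: mult_ac)
  qed (use M C_nonneg r in auto)
  show "\<bar>fd_coeff \<nu> v w k\<bar> \<le> (8 * M * C + 64 * M * C / r) * weight r k"
    unfolding fd_coeff_def using 1 2 by (simp only: distrib_right) linarith
qed

end

section \<open>Mixed derivatives and increments over rectangles\<close>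

text \<open>The derivative in \<open>y\<close> is quantified away, so that linear combinations and subsets need no computation with
  \<^const>\<open>dy\<close>. For a function of class \<open>C\<^sup>1\<^sup>,\<^sup>1\<close> the witness is \<^const>\<open>dy\<close> itself.\<close>

definition has_mixed_deriv_on ::
  "(real \<times> real \<Rightarrow> real) \<Rightarrow> (real \<times> real \<Rightarrow> real) \<Rightarrow> (real \<times> real) set \<Rightarrow> bool" where
  "has_mixed_deriv_on g F S \<longleftrightarrow>
     (\<exists>g'. \<forall>x y. (x, y) \<in> S \<longrightarrow> ((\<lambda>t. g (x, t)) has_real_derivative g' (x, y)) (at y) \<and>
                             ((\<lambda>s. g' (s, y)) has_real_derivative F (x, y)) (at x))"

lemma C11_on_has_mixed_deriv:
  assumes "C11_on S g"
  shows "has_mixed_deriv_on g (dx (dy g)) S"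
  unfolding has_mixed_deriv_on_def
proof (intro exI[of _ "dy g"] allI impI conjI)
  fix x y assume "(x, y) \<in> S"
  then have "(\<lambda>t. g (x, t)) differentiable (at y)" "(\<lambda>s. dy g (s, y)) differentiable (at x)"
    using assms unfolding C11_on_def by auto
  then show "((\<lambda>t. g (x, t)) has_real_derivative dy g (x, y)) (at y)"
    "((\<lambda>s. dy g (s, y)) has_real_derivative dx (dy g) (x, y)) (at x)"
    by (auto simp: dx_def dy_def DERIV_deriv_iff_real_differentiable)
qed

lemma has_mixed_deriv_on_subset:
  "has_mixed_deriv_on g F S \<Longrightarrow> T \<subseteq> S \<Longrightarrow> has_mixed_deriv_on g F T"
  unfolding has_mixed_deriv_on_def by blast

lemma has_mixed_deriv_on_lincomb:
  assumes "has_mixed_deriv_on g F S" "has_mixed_deriv_on h H S"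
  shows "has_mixed_deriv_on (\<lambda>p. a * g p + b * h p) (\<lambda>p. a * F p + b * H p) S"
proof -
  obtain g' h' where
    "\<And>x y. (x, y) \<in> S \<Longrightarrow> ((\<lambda>t. g (x, t)) has_real_derivative g' (x, y)) (at y) \<and>
                       ((\<lambda>s. g' (s, y)) has_real_derivative F (x, y)) (at x)"
    "\<And>x y. (x, y) \<in> S \<Longrightarrow> ((\<lambda>t. h (x, t)) has_real_derivative h' (x, y)) (at y) \<and>
                       ((\<lambda>s. h' (s, y)) has_real_derivative H (x, y)) (at x)"
    using assms unfolding has_mixed_deriv_on_def by blast
  then show ?thesis
    unfolding has_mixed_deriv_on_def
    by (intro exI[of _ "\<lambda>p. a * g' p + b * h' p"] allI impI conjI DERIV_add DERIV_cmult) auto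
qed

lemma has_mixed_deriv_on_diff:
  "has_mixed_deriv_on g F S \<Longrightarrow> has_mixed_deriv_on h H S \<Longrightarrow>
    has_mixed_deriv_on (\<lambda>p. g p - h p) (\<lambda>p. F p - H p) S"
  using has_mixed_deriv_on_lincomb[of g F S h H 1 "-1"] by simp

lemma has_mixed_deriv_on_sum:
  assumes "\<And>k. k \<in> A \<Longrightarrow> has_mixed_deriv_on (g k) (F k) S"
  shows "has_mixed_deriv_on (\<lambda>p. \<Sum>k\<in>A. g k p) (\<lambda>p. \<Sum>k\<in>A. F k p) S"
proof -
  have zero: "has_mixed_deriv_on (\<lambda>p. 0) (\<lambda>p. 0) S"
    unfolding has_mixed_deriv_on_def by (intro exI[of _ "\<lambda>p. 0"]) auto
  show ?thesis
    using assms
  proof (induction A rule: infinite_finite_induct)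
    case (insert k A)
    then show ?case using has_mixed_deriv_on_lincomb[of "g k" "F k" S _ _ 1 1] by simp
  qed (use zero in auto)
qed

definition rect_inc :: "(real \<times> real \<Rightarrow> real) \<Rightarrow> real \<Rightarrow> real \<Rightarrow> real \<Rightarrow> real \<Rightarrow> real" where
  "rect_inc g a b c d = g (b, d) - g (a, d) - g (b, c) + g (a, c)"

lemma continuous_mono_on_interior:
  fixes h :: "real \<Rightarrow> real"
  assumes "a \<le> b" and c: "continuous_on {a..b} h"
    and m: "\<And>s t. a < s \<Longrightarrow> s < t \<Longrightarrow> t < b \<Longrightarrow> h s \<le> h t"
  shows "h a \<le> h b"
proof (cases "a < b")
  case True
  define z where "z = (a + b) / 2"
  have z: "a < z" "z < b" using True by (auto simp: z_def)
  have "eventually (\<lambda>s. h s \<le> h z) (at_right a)"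
    unfolding eventually_at_right_field using z m by (intro exI[of _ z]) auto
  then have "h a \<le> h z"
    by (intro tendsto_upperbound[OF continuous_on_Icc_at_rightD[OF c True]]) auto
  moreover have "eventually (\<lambda>s. h z \<le> h s) (at_left b)"
    unfolding eventually_at_left_field using z m by (intro exI[of _ z]) auto
  then have "h z \<le> h b"
    by (intro tendsto_lowerbound[OF continuous_on_Icc_at_leftD[OF c True]]) auto
  ultimately show ?thesis by simp
qed (use assms in auto)

text \<open>For \<open>x\<close>-values \<open>s < t\<close> in the interior, \<open>y \<mapsto> g(t,y) - g(s,y)\<close> has derivative \<open>g\<^sub>y(t,y) - g\<^sub>y(s,y) \<ge> 0\<close>, because
  \<open>g\<^sub>y\<close> is increasing in \<open>x\<close>. The sides of the rectangle are reached by continuity, where no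
  derivative need exist.\<close>

lemma rect_inc_nonneg:
  assumes ab: "a \<le> b" and cd: "c \<le> d" and cont: "continuous_on ({a..b} \<times> {c..d}) g"
    and mixed: "has_mixed_deriv_on g F ({a<..<b} \<times> {c<..<d})"
    and F: "\<And>x y. a < x \<Longrightarrow> x < b \<Longrightarrow> c < y \<Longrightarrow> y < d \<Longrightarrow> F (x, y) \<ge> 0"
  shows "rect_inc g a b c d \<ge> 0"
proof -
  obtain g' where g':
    "\<And>x y. x \<in> {a<..<b} \<Longrightarrow> y \<in> {c<..<d} \<Longrightarrow> ((\<lambda>t. g (x, t)) has_real_derivative g' (x, y)) (at y)"
    "\<And>x y. x \<in> {a<..<b} \<Longrightarrow> y \<in> {c<..<d} \<Longrightarrow> ((\<lambda>s. g' (s, y)) has_real_derivative F (x, y)) (at x)"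
    using mixed unfolding has_mixed_deriv_on_def by blast
  have cy: "continuous_on {c..d} (\<lambda>t. g (x, t))" if "x \<in> {a..b}" for x
    by (rule continuous_on_compose2[OF cont]) (use that in \<open>auto intro!: continuous_intros\<close>)
  have cx: "continuous_on {a..b} (\<lambda>s. g (s, y))" if "y \<in> {c..d}" for y
    by (rule continuous_on_compose2[OF cont]) (use that in \<open>auto intro!: continuous_intros\<close>)
  have "g (a, d) - g (a, c) \<le> g (b, d) - g (b, c)"
  proof (rule continuous_mono_on_interior[OF ab, of "\<lambda>s. g (s, d) - g (s, c)"])
    show "continuous_on {a..b} (\<lambda>s. g (s, d) - g (s, c))"
      by (intro continuous_on_diff cx) (use cd in auto)
    fix s t assume st: "a < s" "s < t" "t < b"
    have "g (t, c) - g (s, c) \<le> g (t, d) - g (s, d)"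
    proof (rule DERIV_nonneg_imp_increasing_open[OF cd, of "\<lambda>y. g (t, y) - g (s, y)"])
      show "continuous_on {c..d} (\<lambda>y. g (t, y) - g (s, y))"
        by (intro continuous_on_diff cy) (use st in auto)
      fix y assume y: "c < y" "y < d"
      have "g' (s, y) \<le> g' (t, y)"
      proof (rule DERIV_nonneg_imp_nondecreasing[of s t "\<lambda>x. g' (x, y)"])
        fix x assume "s \<le> x" "x \<le> t"
        then show "\<exists>D. ((\<lambda>x. g' (x, y)) has_real_derivative D) (at x) \<and> D \<ge> 0"
          using g'(2)[of x y] F[of x y] st y by (intro exI[of _ "F (x, y)"]) auto
      qed (use st in auto)
      moreover have "((\<lambda>y. g (t, y) - g (s, y)) has_real_derivative g' (t, y) - g' (s, y)) (at y)"
        by (intro DERIV_diff g') (use st y in auto)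
      ultimately show "\<exists>D. ((\<lambda>y. g (t, y) - g (s, y)) has_real_derivative D) (at y) \<and> D \<ge> 0"
        by (intro exI conjI) auto
    qed
    then show "g (s, d) - g (s, c) \<le> g (t, d) - g (t, c)" by simp
  qed
  then show ?thesis by (simp add: rect_inc_def)
qed

lemma node_0 [simp]: "node L n 0 = 0"
  by (simp add: node_def)

lemma node_last [simp]: "n \<ge> 1 \<Longrightarrow> node L n n = L"
  by (simp add: node_def)

lemma node_mono: "L \<ge> 0 \<Longrightarrow> i \<le> j \<Longrightarrow> node L n i \<le> node L n j"
  unfolding node_def by (intro mult_left_mono) auto

lemma node_step: "i \<ge> 1 \<Longrightarrow> node L n i - node L n (i - 1) = L / real n"
  by (simp add: node_def of_nat_diff algebra_simps diff_divide_distrib)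

text \<open>Monotonicity on the parts of a partition gives monotonicity on an interval that need not end at nodes. Clipping the
  nodes to \<open>[c, d]\<close> avoids locating the parts that contain \<open>c\<close> and \<open>d\<close>.\<close>

lemma mesh_chain:
  fixes h :: "real \<Rightarrow> real"
  assumes n: "n \<ge> 1" and L: "L > 0" and cd: "0 \<le> c" "c \<le> d" "d \<le> L"
    and h: "\<And>i s t. i \<in> {1..n} \<Longrightarrow> node L n (i - 1) \<le> s \<Longrightarrow> s \<le> t \<Longrightarrow> t \<le> node L n i \<Longrightarrow>
      c \<le> s \<Longrightarrow> t \<le> d \<Longrightarrow> h s \<le> h t"
  shows "h c \<le> h d"
proof -
  define clip where "clip x = max c (min d x)" for x
  have "h c \<le> h (clip (node L n i))" if "i \<le> n" for i
    using that
  proof (induction i)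
    case 0
    then show ?case using cd by (simp add: clip_def)
  next
    case (Suc i)
    let ?x = "node L n i" and ?y = "node L n (Suc i)"
    have xy: "?x \<le> ?y" using L by (intro node_mono) auto
    have "h (clip ?x) \<le> h (clip ?y)"
    proof (cases "?x < d \<and> c < ?y")
      case True
      then show ?thesis
        by (intro h[of "Suc i"]) (use Suc.prems xy cd in \<open>auto simp: clip_def\<close>)
    next
      case False
      then have "clip ?x = clip ?y" using xy cd by (auto simp: clip_def)
      then show ?thesis by simp
    qed
    with Suc show ?case by simp
  qed
  from this[of n] show ?thesis using n cd by (simp add: clip_def)
qed

section \<open>A mesh-independent estimate for linear Goursat problems\<close>

text \<open>The stability constant of the linear problem: with \<open>\<mu> = 2 a + 1\<close> the function is bounded by
  \<open>\<epsilon> exp (\<mu> (X + Y))\<close>, its mixed derivative by \<open>\<mu>\<close> times that, and the Lipschitz constants gain a factor of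
  at most \<open>X + Y\<close>.\<close>

definition goursat_const :: "real \<Rightarrow> real \<Rightarrow> real \<Rightarrow> real" where
  "goursat_const a X Y = (2 * a + 1) * exp ((2 * a + 1) * (X + Y)) * (1 + X + Y)"

locale mesh =
  fixes X Y :: real and N1 N2 :: nat
  assumes X: "X > 0" and Y: "Y > 0" and N1: "N1 \<ge> 1" and N2: "N2 \<ge> 1"
begin

abbreviation "Cell \<equiv> cell X Y N1 N2"
abbreviation "Corner \<equiv> corner X Y N1 N2"

definition cellwise_mixed :: "(real \<times> real \<Rightarrow> real) \<Rightarrow> (real \<times> real \<Rightarrow> real) \<Rightarrow> bool" where
  "cellwise_mixed g F \<longleftrightarrow> (\<forall>i\<in>{1..N1}. \<forall>j\<in>{1..N2}. has_mixed_deriv_on g F (Cell i j))"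

lemma cell_facts:
  assumes "i \<in> {1..N1}" "j \<in> {1..N2}" "p \<in> Cell i j"
  shows "p \<in> dom X Y" "p \<in> cdom X Y" "Corner i j \<in> cdom X Y"
    "fst (Corner i j) \<le> fst p" "snd (Corner i j) \<le> snd p"
    "fst p - fst (Corner i j) \<le> X / real N1" "snd p - snd (Corner i j) \<le> Y / real N2"
proof -
  have "0 \<le> node X N1 (i - 1)" "node X N1 i \<le> X" "0 \<le> node Y N2 (j - 1)" "node Y N2 j \<le> Y"
    using node_mono[of X 0 "i - 1" N1] node_mono[of X i N1 N1] node_mono[of Y 0 "j - 1" N2]
      node_mono[of Y j N2 N2] X Y N1 N2 assms by auto
  moreover have "node X N1 i - node X N1 (i - 1) = X / real N1" "node Y N2 j - node Y N2 (j - 1) = Y / real N2"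
    using assms node_step[of i X N1] node_step[of j Y N2] by simp_all
  ultimately show "p \<in> dom X Y" "p \<in> cdom X Y" "Corner i j \<in> cdom X Y"
    "fst (Corner i j) \<le> fst p" "snd (Corner i j) \<le> snd p"
    "fst p - fst (Corner i j) \<le> X / real N1" "snd p - snd (Corner i j) \<le> Y / real N2"
    using assms(3) by (auto simp: cell_def dom_def cdom_def corner_def)
qed

text \<open>Increments over rectangles are additive, so \<open>mesh_chain\<close> in each direction in turn reduces the assertion to rectangles within
  one closed cell.\<close>

lemma rect_inc_nonneg_cellwise:
  assumes ab: "0 \<le> a" "a \<le> b" "b \<le> X" and cd: "0 \<le> c" "c \<le> d" "d \<le> Y"
    and cont: "continuous_on (cdom X Y) g" and mixed: "cellwise_mixed g F"
    and F: "\<And>i j p. i \<in> {1..N1} \<Longrightarrow> j \<in> {1..N2} \<Longrightarrow> p \<in> Cell i j \<Longrightarrow>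
      p \<in> {a<..<b} \<times> {c<..<d} \<Longrightarrow> F p \<ge> 0"
  shows "rect_inc g a b c d \<ge> 0"
proof -
  have "g (b, c) - g (a, c) \<le> g (b, d) - g (a, d)"
  proof (rule mesh_chain[OF N2 Y cd, of "\<lambda>y. g (b, y) - g (a, y)"])
    fix j s t assume j: "j \<in> {1..N2}" and st: "node Y N2 (j - 1) \<le> s" "s \<le> t" "t \<le> node Y N2 j" "c \<le> s" "t \<le> d"
    have "g (a, t) - g (a, s) \<le> g (b, t) - g (b, s)"
    proof (rule mesh_chain[OF N1 X ab, of "\<lambda>x. g (x, t) - g (x, s)"])
      fix i x z assume i: "i \<in> {1..N1}" and xz: "node X N1 (i - 1) \<le> x" "x \<le> z" "z \<le> node X N1 i" "a \<le> x" "z \<le> b"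
      have sub: "{x<..<z} \<times> {s<..<t} \<subseteq> Cell i j" using st xz by (auto simp: cell_def)
      have "rect_inc g x z s t \<ge> 0"
      proof (rule rect_inc_nonneg)
        show "continuous_on ({x..z} \<times> {s..t}) g"
          by (rule continuous_on_subset[OF cont]) (use ab cd st xz in \<open>auto simp: cdom_def\<close>)
        show "has_mixed_deriv_on g F ({x<..<z} \<times> {s<..<t})"
          using mixed i j sub unfolding cellwise_mixed_def by (blast intro: has_mixed_deriv_on_subset)
        show "F (x', y') \<ge> 0" if "x < x'" "x' < z" "s < y'" "y' < t" for x' y'
          by (rule F[OF i j]) (use sub that st xz in auto)
      qed (use st xz in auto)
      then show "g (x, t) - g (x, s) \<le> g (z, t) - g (z, s)" by (simp add: rect_inc_def)
    qed
    then show "g (b, s) - g (a, s) \<le> g (b, t) - g (a, t)" by simp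
  qed
  then show ?thesis by (simp add: rect_inc_def)
qed

lemma rect_inc_comparison:
  assumes ab: "0 \<le> a" "a \<le> b" "b \<le> X" and cd: "0 \<le> c" "c \<le> d" "d \<le> Y"
    and g: "continuous_on (cdom X Y) g" "cellwise_mixed g F"
    and e: "continuous_on UNIV e" "has_mixed_deriv_on e E UNIV"
    and F: "\<And>i j p. i \<in> {1..N1} \<Longrightarrow> j \<in> {1..N2} \<Longrightarrow> p \<in> Cell i j \<Longrightarrow>
      p \<in> {a<..<b} \<times> {c<..<d} \<Longrightarrow> \<bar>F p\<bar> \<le> E p"
  shows "\<bar>rect_inc g a b c d\<bar> \<le> rect_inc e a b c d"
proof -
  have "rect_inc (\<lambda>p. 1 * e p + \<sigma> * g p) a b c d \<ge> 0" if \<sigma>: "\<sigma> \<in> {1, -1}" for \<sigma> :: real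
  proof (rule rect_inc_nonneg_cellwise[OF ab cd])
    show "continuous_on (cdom X Y) (\<lambda>p. 1 * e p + \<sigma> * g p)"
      by (intro continuous_intros g continuous_on_subset[OF e(1)]) auto
    show "cellwise_mixed (\<lambda>p. 1 * e p + \<sigma> * g p) (\<lambda>p. 1 * E p + \<sigma> * F p)"
      using g(2) has_mixed_deriv_on_subset[OF e(2)]
      unfolding cellwise_mixed_def by (blast intro: has_mixed_deriv_on_lincomb)
    show "0 \<le> 1 * E p + \<sigma> * F p"
      if "i \<in> {1..N1}" "j \<in> {1..N2}" "p \<in> Cell i j" "p \<in> {a<..<b} \<times> {c<..<d}" for i j p
      using F[OF that] \<sigma> by auto
  qed
  from this[of 1] this[of "-1"] show ?thesis by (simp add: rect_inc_def abs_le_iff algebra_simps)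
qed

lemma exponential_mixed:
  "has_mixed_deriv_on (\<lambda>p. A * exp (\<mu> * (fst p + snd p))) (\<lambda>p. A * \<mu>\<^sup>2 * exp (\<mu> * (fst p + snd p))) UNIV"
  unfolding has_mixed_deriv_on_def
  by (rule exI[of _ "\<lambda>p. A * \<mu> * exp (\<mu> * (fst p + snd p))"])
     (auto intro!: derivative_eq_intros simp: power2_eq_square)

lemma product_mixed: "has_mixed_deriv_on (\<lambda>p. B * (fst p * snd p)) (\<lambda>p. B) UNIV"
  unfolding has_mixed_deriv_on_def
  by (rule exI[of _ "\<lambda>p. B * fst p"]) (auto intro!: derivative_eq_intros)

lemma rect_inc_le_area:
  assumes ab: "0 \<le> a" "a \<le> b" "b \<le> X" and cd: "0 \<le> c" "c \<le> d" "d \<le> Y"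
    and g: "continuous_on (cdom X Y) g" "cellwise_mixed g F"
    and F: "\<And>i j p. i \<in> {1..N1} \<Longrightarrow> j \<in> {1..N2} \<Longrightarrow> p \<in> Cell i j \<Longrightarrow> \<bar>F p\<bar> \<le> B"
  shows "\<bar>rect_inc g a b c d\<bar> \<le> B * (b - a) * (d - c)"
proof -
  have "\<bar>rect_inc g a b c d\<bar> \<le> rect_inc (\<lambda>p. B * (fst p * snd p)) a b c d"
    by (rule rect_inc_comparison[OF ab cd g _ product_mixed]) (auto intro!: continuous_intros F)
  then show ?thesis by (simp add: rect_inc_def algebra_simps)
qed

text \<open>Suppose the bound fails, and let \<open>(x, y)\<close> minimise \<open>x + y\<close> among the points where it fails or is attained.
  It then holds strictly at all points of \<open>[0,x] \<times> [0,y]\<close> with a smaller coordinate sum, so the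
  assumption bounds \<open>g\<^sub>x\<^sub>y\<close> there, and comparison with \<open>A/\<mu>\<^sup>2 exp (\<mu> (x + y))\<close> contradicts the failure at
  \<open>(x, y)\<close>. The hypothesis on \<open>F\<close> may use the bound itself, which makes the lemma a continuation principle for nonlinear
  problems as well.\<close>

lemma exponential_barrier:
  assumes \<mu>: "\<mu> > 0" and A: "A \<ge> 0" and AG: "A < G * \<mu>\<^sup>2"
    and g: "continuous_on (cdom X Y) g" "cellwise_mixed g F"
    and g0: "\<And>x. x \<in> {0..X} \<Longrightarrow> g (x, 0) = 0" "\<And>y. y \<in> {0..Y} \<Longrightarrow> g (0, y) = 0"
    and F: "\<And>i j p. i \<in> {1..N1} \<Longrightarrow> j \<in> {1..N2} \<Longrightarrow> p \<in> Cell i j \<Longrightarrow>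
      (\<And>x y. 0 \<le> x \<Longrightarrow> x \<le> fst p \<Longrightarrow> 0 \<le> y \<Longrightarrow> y \<le> snd p \<Longrightarrow> \<bar>g (x, y)\<bar> \<le> G * exp (\<mu> * (x + y))) \<Longrightarrow>
      \<bar>F p\<bar> \<le> A * exp (\<mu> * (fst p + snd p))"
    and p: "p \<in> cdom X Y"
  shows "\<bar>g p\<bar> \<le> G * exp (\<mu> * (fst p + snd p))"
proof (rule ccontr)
  assume viol: "\<not> ?thesis"
  define Z where "Z = {q \<in> cdom X Y. G * exp (\<mu> * (fst q + snd q)) \<le> \<bar>g q\<bar>}"
  have comp: "compact (cdom X Y)" unfolding cdom_def by (intro compact_Times compact_Icc)
  have "closed Z"
    unfolding Z_def
    by (intro continuous_on_closed_Collect_le continuous_intros g compact_imp_closed[OF comp])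
  then have "compact Z"
    using compact_Int_closed[OF comp] by (metis (no_types, lifting) Int_absorb1 Z_def mem_Collect_eq subsetI)
  moreover have "p \<in> Z" using viol p unfolding Z_def by simp
  then have "Z \<noteq> {}" by blast
  moreover have "continuous_on Z (\<lambda>q. fst q + snd q)" by (intro continuous_intros)
  ultimately obtain q where q: "q \<in> Z" "\<And>q'. q' \<in> Z \<Longrightarrow> fst q + snd q \<le> fst q' + snd q'"
    using continuous_attains_inf[of Z "\<lambda>q. fst q + snd q"] by blast
  obtain x y where xy: "q = (x, y)" by (cases q)
  have bnd: "0 \<le> x" "x \<le> X" "0 \<le> y" "y \<le> Y" using q(1) xy by (auto simp: Z_def cdom_def)
  have "\<bar>rect_inc g 0 x 0 y\<bar> \<le> rect_inc (\<lambda>p. A / \<mu>\<^sup>2 * exp (\<mu> * (fst p + snd p))) 0 x 0 y"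
  proof (rule rect_inc_comparison[OF _ _ _ _ _ _ g _ exponential_mixed])
    fix i j p assume ij: "i \<in> {1..N1}" "j \<in> {1..N2}" "p \<in> Cell i j" and p: "p \<in> {0<..<x} \<times> {0<..<y}"
    have "\<bar>F p\<bar> \<le> A * exp (\<mu> * (fst p + snd p))"
    proof (rule F[OF ij])
      fix x' y' assume x'y': "0 \<le> x'" "x' \<le> fst p" "0 \<le> y'" "y' \<le> snd p"
      then have "(x', y') \<notin> Z" using q(2)[of "(x', y')"] p xy by auto
      moreover have "(x', y') \<in> cdom X Y" using x'y' p bnd by (auto simp: cdom_def)
      ultimately show "\<bar>g (x', y')\<bar> \<le> G * exp (\<mu> * (x' + y'))" by (auto simp: Z_def)
    qed
    then show "\<bar>F p\<bar> \<le> A / \<mu>\<^sup>2 * \<mu>\<^sup>2 * exp (\<mu> * (fst p + snd p))" using \<mu> by simp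
  qed (use bnd \<mu> in \<open>auto intro!: continuous_intros\<close>)
  also have "\<dots> = A / \<mu>\<^sup>2 * (exp (\<mu> * (x + y)) - exp (\<mu> * y) - exp (\<mu> * x) + 1)"
    by (simp add: rect_inc_def algebra_simps)
  also have "\<dots> \<le> A / \<mu>\<^sup>2 * exp (\<mu> * (x + y))"
  proof (rule mult_left_mono)
    have "1 \<le> exp (\<mu> * x)" "0 \<le> exp (\<mu> * y)" using \<mu> bnd by auto
    then show "exp (\<mu> * (x + y)) - exp (\<mu> * y) - exp (\<mu> * x) + 1 \<le> exp (\<mu> * (x + y))" by linarith
  qed (use A in auto)
  also have "\<dots> < G * exp (\<mu> * (x + y))"
    using AG \<mu> by (simp add: divide_simps mult.commute)
  finally have "\<bar>rect_inc g 0 x 0 y\<bar> < G * exp (\<mu> * (x + y))" .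
  moreover have "rect_inc g 0 x 0 y = g (x, y)"
    using bnd g0 X Y by (simp add: rect_inc_def)
  ultimately show False using q(1) xy by (auto simp: Z_def)
qed

definition coord_lipschitz :: "(real \<times> real \<Rightarrow> real) \<Rightarrow> real \<Rightarrow> bool" where
  "coord_lipschitz g L \<longleftrightarrow>
     (\<forall>x\<in>{0..X}. \<forall>x'\<in>{0..X}. \<forall>y\<in>{0..Y}. \<bar>g (x, y) - g (x', y)\<bar> \<le> L * \<bar>x - x'\<bar>) \<and>
     (\<forall>x\<in>{0..X}. \<forall>y\<in>{0..Y}. \<forall>y'\<in>{0..Y}. \<bar>g (x, y) - g (x, y')\<bar> \<le> L * \<bar>y - y'\<bar>)"

text \<open>The difference of \<open>g(b, \<cdot>) - g(a, \<cdot>)\<close> between height \<open>y\<close> and height 0 is an increment over a rectangle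
  of area at most \<open>(b - a) Y\<close>.\<close>

lemma lipschitz_of_boundary:
  assumes g: "continuous_on (cdom X Y) g" "cellwise_mixed g F"
    and g0: "\<And>x x'. x \<in> {0..X} \<Longrightarrow> x' \<in> {0..X} \<Longrightarrow> \<bar>g (x, 0) - g (x', 0)\<bar> \<le> \<Lambda> * \<bar>x - x'\<bar>"
      "\<And>y y'. y \<in> {0..Y} \<Longrightarrow> y' \<in> {0..Y} \<Longrightarrow> \<bar>g (0, y) - g (0, y')\<bar> \<le> \<Lambda> * \<bar>y - y'\<bar>"
    and F: "\<And>i j p. i \<in> {1..N1} \<Longrightarrow> j \<in> {1..N2} \<Longrightarrow> p \<in> Cell i j \<Longrightarrow> \<bar>F p\<bar> \<le> B"
    and B: "B \<ge> 0"
  shows "coord_lipschitz g (B * (X + Y) + \<Lambda>)"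
proof -
  have xs: "\<bar>g (b, y) - g (a, y)\<bar> \<le> (B * (X + Y) + \<Lambda>) * \<bar>b - a\<bar>" if "0 \<le> a" "a \<le> b" "b \<le> X" "y \<in> {0..Y}" for a b y
  proof -
    have "\<bar>rect_inc g a b 0 y\<bar> \<le> B * (b - a) * (y - 0)"
      by (rule rect_inc_le_area[OF _ _ _ _ _ _ g F]) (use that in auto)
    also have "\<dots> \<le> B * (b - a) * (X + Y)" by (intro mult_left_mono) (use that B X in auto)
    finally have "\<bar>rect_inc g a b 0 y\<bar> \<le> B * (X + Y) * \<bar>b - a\<bar>" using that by (simp add: mult_ac)
    moreover have "\<bar>g (b, 0) - g (a, 0)\<bar> \<le> \<Lambda> * \<bar>b - a\<bar>" by (rule g0) (use that in auto)
    ultimately show ?thesis unfolding rect_inc_def distrib_right by linarith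
  qed
  have xs': "\<bar>g (x, y) - g (x', y)\<bar> \<le> (B * (X + Y) + \<Lambda>) * \<bar>x - x'\<bar>"
    if "x \<in> {0..X}" "x' \<in> {0..X}" "y \<in> {0..Y}" for x x' y
    using xs[of x' x y] xs[of x x' y] that by (cases "x \<le> x'") (auto simp: abs_minus_commute)
  have ys: "\<bar>g (x, d) - g (x, c)\<bar> \<le> (B * (X + Y) + \<Lambda>) * \<bar>d - c\<bar>" if "0 \<le> c" "c \<le> d" "d \<le> Y" "x \<in> {0..X}" for c d x
  proof -
    have "\<bar>rect_inc g 0 x c d\<bar> \<le> B * (x - 0) * (d - c)"
      by (rule rect_inc_le_area[OF _ _ _ _ _ _ g F]) (use that in auto)
    also have "\<dots> \<le> B * (X + Y) * (d - c)" by (intro mult_right_mono mult_left_mono) (use that B Y in auto)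
    finally have "\<bar>rect_inc g 0 x c d\<bar> \<le> B * (X + Y) * \<bar>d - c\<bar>" using that by simp
    moreover have "\<bar>g (0, d) - g (0, c)\<bar> \<le> \<Lambda> * \<bar>d - c\<bar>" by (rule g0) (use that in auto)
    ultimately show ?thesis unfolding rect_inc_def distrib_right by linarith
  qed
  have ys': "\<bar>g (x, y) - g (x, y')\<bar> \<le> (B * (X + Y) + \<Lambda>) * \<bar>y - y'\<bar>"
    if "x \<in> {0..X}" "y \<in> {0..Y}" "y' \<in> {0..Y}" for x y y'
    using ys[of y' y x] ys[of y y' x] that by (cases "y \<le> y'") (auto simp: abs_minus_commute)
  show ?thesis unfolding coord_lipschitz_def using xs' ys' by blast
qed

text \<open>A derivative-free substitute for the norm of \<^const>\<open>norm1\<close>: it passes to limits of uniformly convergent series without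
  any differentiation, and it makes sense across the edges of the cells.\<close>

definition controlled :: "(real \<times> real \<Rightarrow> real) \<Rightarrow> real \<Rightarrow> bool" where
  "controlled g K \<longleftrightarrow> (\<forall>p\<in>cdom X Y. \<bar>g p\<bar> \<le> K) \<and> coord_lipschitz g K"

lemma coord_lipschitz_mono: "coord_lipschitz g L \<Longrightarrow> L \<le> L' \<Longrightarrow> coord_lipschitz g L'"
  unfolding coord_lipschitz_def by (meson abs_ge_zero mult_right_mono order_trans)

lemma controlled_mono: "controlled g K \<Longrightarrow> K \<le> K' \<Longrightarrow> controlled g K'"
  unfolding controlled_def by (meson coord_lipschitz_mono order_trans)

definition mesh_size :: real where
  "mesh_size = sqrt ((X / real N1)\<^sup>2 + (Y / real N2)\<^sup>2)"

lemma mesh_size_pos: "mesh_size > 0"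
  using X Y N1 N2 unfolding mesh_size_def by (intro real_sqrt_gt_zero add_pos_pos zero_less_power divide_pos_pos) auto

lemma corner_variation:
  assumes g: "coord_lipschitz g L" and L: "L \<ge> 0"
    and ij: "i \<in> {1..N1}" "j \<in> {1..N2}" "p \<in> Cell i j"
  shows "\<bar>g p - g (Corner i j)\<bar> \<le> 2 * L * mesh_size"
proof -
  note cf = cell_facts[OF ij]
  obtain x y x' y' where eq: "p = (x, y)" "Corner i j = (x', y')" by (metis surj_pair)
  have m: "x \<in> {0..X}" "x' \<in> {0..X}" "y \<in> {0..Y}" "y' \<in> {0..Y}" using cf eq by (auto simp: cdom_def)
  have "X / real N1 \<le> mesh_size" "Y / real N2 \<le> mesh_size"
    unfolding mesh_size_def by (auto intro: real_sqrt_sum_squares_ge1 real_sqrt_sum_squares_ge2)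
  then have "\<bar>x - x'\<bar> \<le> mesh_size" "\<bar>y - y'\<bar> \<le> mesh_size" using cf eq by auto
  then have "L * \<bar>x - x'\<bar> \<le> L * mesh_size" "L * \<bar>y - y'\<bar> \<le> L * mesh_size"
    using L by (auto intro: mult_left_mono)
  moreover have "\<bar>g (x, y) - g (x', y)\<bar> \<le> L * \<bar>x - x'\<bar>" "\<bar>g (x', y) - g (x', y')\<bar> \<le> L * \<bar>y - y'\<bar>"
    using g m unfolding coord_lipschitz_def by blast+
  ultimately show ?thesis unfolding eq by linarith
qed

text \<open>The inequality for \<open>F\<close> is required only where \<open>g\<close> is known to be at most \<open>\<delta>\<close>, since for \<open>u\<^sup>(\<^sup>0\<^sup>) - u\<close>
  the Lipschitz bound of the nonlinearity is available only near the range of \<open>u\<close>. The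
  barrier stays below \<open>\<delta>\<close> when \<open>\<epsilon>\<close> is small.\<close>

lemma conditional_goursat_estimate:
  assumes a: "a \<ge> 0"
    and g: "continuous_on (cdom X Y) g" "cellwise_mixed g F"
    and g0: "\<And>x. x \<in> {0..X} \<Longrightarrow> g (x, 0) = 0" "\<And>y. y \<in> {0..Y} \<Longrightarrow> g (0, y) = 0"
    and F: "\<And>i j p. i \<in> {1..N1} \<Longrightarrow> j \<in> {1..N2} \<Longrightarrow> p \<in> Cell i j \<Longrightarrow>
      \<bar>g p\<bar> \<le> \<delta> \<Longrightarrow> \<bar>g (Corner i j)\<bar> \<le> \<delta> \<Longrightarrow> \<bar>F p\<bar> \<le> a * (\<bar>g p\<bar> + \<bar>g (Corner i j)\<bar>) + \<epsilon>"
    and \<epsilon>: "\<epsilon> \<ge> 0" and \<delta>: "goursat_const a X Y * \<epsilon> < \<delta>"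
  shows "controlled g (goursat_const a X Y * \<epsilon>)"
proof -
  define \<mu> where "\<mu> = 2 * a + 1"
  have \<mu>: "\<mu> \<ge> 1" using a by (simp add: \<mu>_def)
  define E where "E = exp (\<mu> * (X + Y))"
  have E: "E \<ge> 1" using \<mu> X Y by (simp add: E_def)
  define B where "B = (2 * a + 1) * E * \<epsilon>"
  have B0: "B \<ge> 0" using a E \<epsilon> by (simp add: B_def)
  have K: "goursat_const a X Y * \<epsilon> = B * (1 + X + Y)"
    by (simp add: goursat_const_def B_def E_def \<mu>_def)
  have "\<epsilon> * E \<le> B" using a E \<epsilon> by (simp add: B_def algebra_simps)
  also have "B \<le> B * (1 + X + Y)" using mult_left_mono[of 1 "1 + X + Y" B] B0 X Y by simp
  finally have K1: "\<epsilon> * E \<le> B * (1 + X + Y)" .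
  have \<delta>': "\<epsilon> * E < \<delta>" using K1 \<delta> K by linarith
  have sup': "\<bar>g p\<bar> \<le> \<epsilon>' * exp (\<mu> * (fst p + snd p))" if \<epsilon>': "\<epsilon>' > \<epsilon>" "\<epsilon>' * E \<le> \<delta>" and p: "p \<in> cdom X Y" for \<epsilon>' p
  proof (rule exponential_barrier[OF _ _ _ g g0 _ p, of \<mu> "2 * a * \<epsilon>' + \<epsilon>"])
    show "2 * a * \<epsilon>' + \<epsilon> < \<epsilon>' * \<mu>\<^sup>2"
    proof -
      have "2 * a * \<epsilon>' + \<epsilon> < \<epsilon>' * \<mu>" using \<epsilon>' by (simp add: \<mu>_def algebra_simps)
      also have "\<dots> \<le> \<epsilon>' * \<mu>\<^sup>2"
        by (intro mult_left_mono self_le_power) (use \<mu> \<epsilon> \<epsilon>' in auto)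
      finally show ?thesis .
    qed
    fix i j p assume ij: "i \<in> {1..N1}" "j \<in> {1..N2}" "p \<in> Cell i j"
      and hyp: "\<And>x y. 0 \<le> x \<Longrightarrow> x \<le> fst p \<Longrightarrow> 0 \<le> y \<Longrightarrow> y \<le> snd p \<Longrightarrow> \<bar>g (x, y)\<bar> \<le> \<epsilon>' * exp (\<mu> * (x + y))"
    note cf = cell_facts[OF ij]
    obtain x y x' y' where eq: "p = (x, y)" "Corner i j = (x', y')" by (metis surj_pair)
    have o: "0 \<le> x'" "x' \<le> x" "0 \<le> y'" "y' \<le> y" "0 \<le> x" "0 \<le> y"
      using cf eq by (auto simp: cdom_def)
    have gp: "\<bar>g p\<bar> \<le> \<epsilon>' * exp (\<mu> * (x + y))" using hyp[of x y] o eq by auto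
    have "\<bar>g (Corner i j)\<bar> \<le> \<epsilon>' * exp (\<mu> * (x' + y'))" using hyp[of x' y'] o eq by auto
    also have "\<dots> \<le> \<epsilon>' * exp (\<mu> * (x + y))"
      by (intro mult_left_mono) (use \<mu> o \<epsilon> \<epsilon>' in auto)
    finally have gc: "\<bar>g (Corner i j)\<bar> \<le> \<epsilon>' * exp (\<mu> * (x + y))" .
    have "\<epsilon>' * exp (\<mu> * (x + y)) \<le> \<epsilon>' * E"
      unfolding E_def by (intro mult_left_mono) (use \<mu> \<epsilon> \<epsilon>' cf(2) eq in \<open>auto simp: cdom_def intro!: add_mono\<close>)
    then have "\<bar>F p\<bar> \<le> a * (\<bar>g p\<bar> + \<bar>g (Corner i j)\<bar>) + \<epsilon>"
      by (intro F[OF ij]) (use gp gc \<epsilon>' in linarith)+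
    also have "\<dots> \<le> a * (\<epsilon>' * exp (\<mu> * (x + y)) + \<epsilon>' * exp (\<mu> * (x + y))) + \<epsilon> * exp (\<mu> * (x + y))"
    proof (intro add_mono mult_left_mono gp gc a)
      have "1 \<le> exp (\<mu> * (x + y))" using \<mu> o by simp
      then show "\<epsilon> \<le> \<epsilon> * exp (\<mu> * (x + y))" using \<epsilon> mult_left_mono[of 1 _ \<epsilon>] by simp
    qed
    finally show "\<bar>F p\<bar> \<le> (2 * a * \<epsilon>' + \<epsilon>) * exp (\<mu> * (fst p + snd p))"
      by (simp add: eq algebra_simps)
  qed (use \<mu> a \<epsilon> \<epsilon>' in auto)
  have sup: "\<bar>g p\<bar> \<le> \<epsilon> * E" if p: "p \<in> cdom X Y" for p
  proof (rule field_le_epsilon)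
    fix e :: real assume e: "e > 0"
    define e' where "e' = min e (\<delta> - \<epsilon> * E)"
    have e': "e' > 0" "e' \<le> e" "\<epsilon> * E + e' \<le> \<delta>" using e \<delta>' by (auto simp: e'_def)
    have "\<bar>g p\<bar> \<le> (\<epsilon> + e' / E) * exp (\<mu> * (fst p + snd p))"
      by (rule sup'[OF _ _ p]) (use e' E in \<open>auto simp: algebra_simps\<close>)
    also have "\<dots> \<le> (\<epsilon> + e' / E) * E"
      unfolding E_def by (intro mult_left_mono) (use \<mu> p \<epsilon> e' in \<open>auto simp: cdom_def intro!: add_mono\<close>)
    also have "\<dots> = \<epsilon> * E + e'" using E by (simp add: algebra_simps)
    finally show "\<bar>g p\<bar> \<le> \<epsilon> * E + e" using e' by linarith
  qed
  have FB: "\<bar>F p\<bar> \<le> B" if ij: "i \<in> {1..N1}" "j \<in> {1..N2}" "p \<in> Cell i j" for i j p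
  proof -
    have "\<bar>F p\<bar> \<le> a * (\<bar>g p\<bar> + \<bar>g (Corner i j)\<bar>) + \<epsilon>"
      using sup[of p] sup[of "Corner i j"] cell_facts[OF ij] \<delta>' by (intro F[OF ij]) auto
    also have "\<dots> \<le> a * (\<epsilon> * E + \<epsilon> * E) + \<epsilon> * E"
      using E \<epsilon> mult_left_mono[of 1 E \<epsilon>]
      by (intro add_mono mult_left_mono sup a cell_facts[OF ij]) auto
    finally show ?thesis by (simp add: B_def algebra_simps)
  qed
  have K2: "B * (X + Y) + 0 \<le> B * (1 + X + Y)"
    using B0 by (simp add: algebra_simps)
  have lip: "coord_lipschitz g (B * (X + Y) + 0)"
    by (rule lipschitz_of_boundary[OF g _ _ FB B0]) (use g0 in auto)
  have "\<bar>g p\<bar> \<le> B * (1 + X + Y)" if "p \<in> cdom X Y" for p using sup[OF that] K1 by linarith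
  then show ?thesis
    unfolding controlled_def K using coord_lipschitz_mono[OF lip K2] by blast
qed

lemma linear_goursat_estimate:
  assumes a: "a \<ge> 0"
    and g: "continuous_on (cdom X Y) g" "cellwise_mixed g F"
    and g0: "\<And>x. x \<in> {0..X} \<Longrightarrow> g (x, 0) = 0" "\<And>y. y \<in> {0..Y} \<Longrightarrow> g (0, y) = 0"
    and F: "\<And>i j p. i \<in> {1..N1} \<Longrightarrow> j \<in> {1..N2} \<Longrightarrow> p \<in> Cell i j \<Longrightarrow>
      \<bar>F p\<bar> \<le> a * (\<bar>g p\<bar> + \<bar>g (Corner i j)\<bar>) + \<epsilon>"
    and \<epsilon>: "\<epsilon> \<ge> 0"
  shows "controlled g (goursat_const a X Y * \<epsilon>)"
  by (rule conditional_goursat_estimate[OF a g g0 F \<epsilon> less_add_one])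

text \<open>The factor 2 covers \<open>(K\<^sup>2 + K\<^sup>2)\<^sup>1\<^sup>/\<^sup>2\<close>. Differentiability is needed because \<^const>\<open>deriv\<close> has arbitrary
  values elsewhere.\<close>

lemma norm1_le:
  assumes g: "controlled g K"
    and diff: "\<And>i j x y. i \<in> {1..N1} \<Longrightarrow> j \<in> {1..N2} \<Longrightarrow> (x, y) \<in> Cell i j \<Longrightarrow>
      (\<lambda>s. g (s, y)) differentiable (at x) \<and> (\<lambda>t. g (x, t)) differentiable (at y)"
  shows "norm1 X Y N1 N2 g \<le> ereal (2 * K)"
proof -
  have deriv_le: "\<bar>deriv h x\<bar> \<le> K"
    if h: "h differentiable (at x)" and l: "\<And>s. s \<in> {a<..<b} \<Longrightarrow> \<bar>h s - h x\<bar> \<le> K * \<bar>s - x\<bar>"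
      and x: "x \<in> {a<..<b}" for h :: "real \<Rightarrow> real" and x a b
  proof -
    have "((\<lambda>s. (h s - h x) / (s - x)) \<longlongrightarrow> deriv h x) (at x)"
      using h unfolding DERIV_deriv_iff_real_differentiable[symmetric] has_field_derivative_iff .
    then have "((\<lambda>s. \<bar>(h s - h x) / (s - x)\<bar>) \<longlongrightarrow> \<bar>deriv h x\<bar>) (at x)"
      by (rule tendsto_rabs)
    moreover have "eventually (\<lambda>s. \<bar>(h s - h x) / (s - x)\<bar> \<le> K) (at x)"
    proof -
      have "eventually (\<lambda>s. s \<in> {a<..<b}) (at x)"
        by (rule eventually_at_in_open'[OF _ x]) auto
      moreover have "eventually (\<lambda>s. s \<noteq> x) (at x)" by (simp add: eventually_at_filter)
      ultimately show ?thesis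
        by eventually_elim (use l in \<open>auto simp: divide_simps\<close>)
    qed
    ultimately show ?thesis by (rule tendsto_upperbound) simp
  qed
  have "(0, 0) \<in> cdom X Y" using X Y by (simp add: cdom_def)
  then have K: "K \<ge> 0" using g unfolding controlled_def by fastforce
  have sup: "sup_norm (cdom X Y) g \<le> ereal K"
    unfolding sup_norm_def by (rule SUP_least) (use g in \<open>auto simp: controlled_def\<close>)
  have cellbd: "ereal_sqrt ((sup_norm (Cell i j) (dx g))\<^sup>2 + (sup_norm (Cell i j) (dy g))\<^sup>2) \<le> ereal (2 * K)"
    if ij: "i \<in> {1..N1}" "j \<in> {1..N2}" for i j
  proof -
    have lt: "node X N1 (i - 1) < node X N1 i" "node Y N2 (j - 1) < node Y N2 j"
      using node_step[of i X N1] node_step[of j Y N2] ij X Y N1 N2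
      by (smt (verit) atLeastAtMost_iff divide_pos_pos of_nat_0_less_iff zero_less_one order_less_le_trans)+
    then obtain z where z: "z \<in> Cell i j" unfolding cell_def by (meson SigmaI dense greaterThanLessThan_iff)
    have D: "\<bar>dx g p\<bar> \<le> K" "\<bar>dy g p\<bar> \<le> K" if p: "p \<in> Cell i j" for p
    proof -
      obtain x y where xy: "p = (x, y)" by (cases p)
      have sub: "s \<in> {0..X}" if "s \<in> {node X N1 (i - 1)<..<node X N1 i}" for s
        using cell_facts(2)[OF ij, of "(s, y)"] p xy that by (auto simp: cell_def cdom_def)
      have sub': "t \<in> {0..Y}" if "t \<in> {node Y N2 (j - 1)<..<node Y N2 j}" for t
        using cell_facts(2)[OF ij, of "(x, t)"] p xy that by (auto simp: cell_def cdom_def)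
      have xr: "x \<in> {node X N1 (i - 1)<..<node X N1 i}" and yr: "y \<in> {node Y N2 (j - 1)<..<node Y N2 j}"
        using p xy by (auto simp: cell_def)
      have "\<bar>deriv (\<lambda>s. g (s, y)) x\<bar> \<le> K"
        by (rule deriv_le[OF _ _ xr])
           (use diff[OF ij] p xy g sub[OF xr] sub'[OF yr] sub in \<open>auto simp: controlled_def coord_lipschitz_def\<close>)
      moreover have "\<bar>deriv (\<lambda>t. g (x, t)) y\<bar> \<le> K"
        by (rule deriv_le[OF _ _ yr])
           (use diff[OF ij] p xy g sub[OF xr] sub'[OF yr] sub' in \<open>auto simp: controlled_def coord_lipschitz_def\<close>)
      ultimately show "\<bar>dx g p\<bar> \<le> K" "\<bar>dy g p\<bar> \<le> K" by (simp_all add: dx_def dy_def xy)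
    qed
    have S: "\<exists>r. sup_norm (Cell i j) w = ereal r \<and> 0 \<le> r \<and> r \<le> K"
      if w: "\<And>p. p \<in> Cell i j \<Longrightarrow> \<bar>w p\<bar> \<le> K" for w
    proof -
      have le: "sup_norm (Cell i j) w \<le> ereal K"
        unfolding sup_norm_def by (rule SUP_least) (use w in auto)
      have "ereal 0 \<le> ereal \<bar>w z\<bar>" by simp
      also have "\<dots> \<le> sup_norm (Cell i j) w" unfolding sup_norm_def by (rule SUP_upper[OF z])
      finally show ?thesis using le by (cases "sup_norm (Cell i j) w") auto
    qed
    obtain r where r: "sup_norm (Cell i j) (dx g) = ereal r" "0 \<le> r" "r \<le> K" using S[of "dx g"] D by blast
    obtain s where s: "sup_norm (Cell i j) (dy g) = ereal s" "0 \<le> s" "s \<le> K" using S[of "dy g"] D by blast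
    have "sqrt (r\<^sup>2 + s\<^sup>2) \<le> r + s" by (rule sqrt_sum_squares_le_sum) (use r s in auto)
    then show ?thesis using r s by (simp add: ereal_sqrt_def)
  qed
  have "Max ((\<lambda>(i, j). ereal_sqrt ((sup_norm (Cell i j) (dx g))\<^sup>2 + (sup_norm (Cell i j) (dy g))\<^sup>2))
      ` ({1..N1} \<times> {1..N2})) \<le> ereal (2 * K)"
    by (intro Max.boundedI) (use cellbd N1 N2 in auto)
  moreover have "sup_norm (cdom X Y) g \<le> ereal (2 * K)"
    by (rule order_trans[OF sup]) (use K in simp)
  ultimately show ?thesis unfolding norm1_def by simp
qed

end

section \<open>The FD-method on a fixed mesh\<close>

definition weight_tail :: "real \<Rightarrow> nat \<Rightarrow> real" where
  "weight_tail r m = (\<Sum>k. weight r (k + Suc m))"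

lemma weight_tail_nonneg: "r > 0 \<Longrightarrow> r \<le> 1 \<Longrightarrow> weight_tail r m \<ge> 0"
  unfolding weight_tail_def by (intro suminf_nonneg summable_ignore_initial_segment weight_summable) (auto simp: weight_nonneg)

lemma weight_tail_tendsto_0: "r > 0 \<Longrightarrow> r \<le> 1 \<Longrightarrow> weight_tail r \<longlonglongrightarrow> 0"
  unfolding weight_tail_def by (rule LIMSEQ_Suc[OF suminf_exist_split2[OF weight_summable]])

lemma weight_tail_geometric:
  assumes "0 < r" "r < 1"
  shows "weight_tail r m \<le> r ^ (m + 1) / ((real m + 1)\<^sup>2 * (1 - r))"
proof -
  have g: "(\<lambda>k. r ^ (m + 1) / (real m + 1)\<^sup>2 * r ^ k) sums (r ^ (m + 1) / (real m + 1)\<^sup>2 * (1 / (1 - r)))"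
    by (intro sums_mult geometric_sums) (use assms in auto)
  have "weight r (k + Suc m) \<le> r ^ (m + 1) / (real m + 1)\<^sup>2 * r ^ k" for k
  proof -
    have "weight r (k + Suc m) \<le> r ^ (k + Suc m) / (real m + 1)\<^sup>2"
      unfolding weight_def using assms by (intro divide_left_mono power_mono) auto
    then show ?thesis by (simp add: power_add mult_ac)
  qed
  then have "weight_tail r m \<le> (\<Sum>k. r ^ (m + 1) / (real m + 1)\<^sup>2 * r ^ k)"
    unfolding weight_tail_def using g assms
    by (intro suminf_le summable_ignore_initial_segment weight_summable) (auto simp: sums_iff)
  then show ?thesis using g by (simp add: sums_iff)
qed

lemma sums_remainder_le_weight_tail:
  assumes a: "a sums s" and b: "\<And>k. k > m \<Longrightarrow> \<bar>a k\<bar> \<le> B * weight r k" and r: "r > 0" "r \<le> 1"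
  shows "\<bar>s - (\<Sum>k\<le>m. a k)\<bar> \<le> B * weight_tail r m"
proof -
  have t: "summable (\<lambda>k. B * weight r (k + Suc m))"
    by (intro summable_mult summable_ignore_initial_segment weight_summable r)
  have sa: "summable (\<lambda>k. \<bar>a (k + Suc m)\<bar>)"
    by (rule summable_comparison_test'[OF t]) (use b in auto)
  have "s - (\<Sum>k\<le>m. a k) = (\<Sum>k. a (k + Suc m))"
    using suminf_minus_initial_segment[of a "Suc m"] a by (simp add: sums_iff lessThan_Suc_atMost)
  also have "\<bar>\<dots>\<bar> \<le> (\<Sum>k. \<bar>a (k + Suc m)\<bar>)" by (rule summable_rabs[OF sa])
  also have "\<dots> \<le> (\<Sum>k. B * weight r (k + Suc m))" by (rule suminf_le[OF _ sa t]) (use b in auto)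
  also have "\<dots> = B * weight_tail r m"
    unfolding weight_tail_def by (intro suminf_mult summable_ignore_initial_segment weight_summable r)
  finally show ?thesis .
qed

lemma abs_mult_le: "\<bar>a\<bar> \<le> A \<Longrightarrow> \<bar>b\<bar> \<le> B \<Longrightarrow> \<bar>a * b\<bar> \<le> A * B" for a b A B :: real
  unfolding abs_mult by (intro mult_mono) auto

text \<open>One run of the method, with the constants of the proof as parameters. Apart from \<open>mesh_size < R\<close>, the
  conditions on them involve only the input data and the solution \<open>u\<close> that the data determine, so the same
  constants serve all meshes. \<open>M\<close>
  leaves room for a deviation of \<open>u\<^sup>(\<^sup>0\<^sup>)\<close> from \<open>u\<close> by 1, \<open>C\<close> bounds \<open>N\<close>, \<open>N'\<close> and the Lipschitz constant of \<open>N\<close> on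
  \<open>[-M, M]\<close>, \<open>L\<close> is a Lipschitz constant of \<open>u\<close> and of \<open>u\<^sup>(\<^sup>0\<^sup>)\<close>, and \<open>K\<close> is the stability constant of the
  linearised problems.\<close>

locale fd_run = mesh X Y N1 N2 for X Y :: real and N1 N2 :: nat +
  fixes \<nu> :: "nat \<Rightarrow> real" and f :: "real \<times> real \<Rightarrow> real" and \<psi> \<phi> :: "real \<Rightarrow> real"
    and u :: "real \<times> real \<Rightarrow> real" and U :: "nat \<Rightarrow> real \<times> real \<Rightarrow> real"
    and M \<Phi> \<Lambda> C L K \<eta> R :: real
  assumes \<nu>: "entire_series \<nu>"
    and u: "goursat_solution X Y \<nu> f \<psi> \<phi> u" and U: "fd_method X Y \<nu> f \<psi> \<phi> N1 N2 U"
    and M: "M \<ge> 1" and uM: "\<And>p. p \<in> cdom X Y \<Longrightarrow> \<bar>u p\<bar> \<le> M - 1"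
    and f: "\<And>p. p \<in> cdom X Y \<Longrightarrow> \<bar>f p\<bar> \<le> \<Phi>"
    and \<psi>: "\<And>x x'. x \<in> {0..X} \<Longrightarrow> x' \<in> {0..X} \<Longrightarrow> \<bar>\<psi> x - \<psi> x'\<bar> \<le> \<Lambda> * \<bar>x - x'\<bar>"
    and \<phi>: "\<And>y y'. y \<in> {0..Y} \<Longrightarrow> y' \<in> {0..Y} \<Longrightarrow> \<bar>\<phi> y - \<phi> y'\<bar> \<le> \<Lambda> * \<bar>y - y'\<bar>"
    and \<Lambda>: "\<Lambda> \<ge> 0"
    and C_eq: "C = majorant \<nu> (M + 2)"
    and L_eq: "L = (\<Phi> + C * M) * (X + Y) + \<Lambda>"
    and K_eq: "K = goursat_const (C * (1 + M)) X Y"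
    and \<eta>: "\<eta> > 0" "16 * \<eta> \<le> 1" "16 * K * C * (1 + M) * \<eta> \<le> 1"
    and R: "R > 0" "128 * K * C * M * (L + 1) * R \<le> \<eta>"
    and h: "mesh_size < R"
begin

abbreviation "r \<equiv> mesh_size / R"

lemma r: "r > 0" "r < 1" "r \<le> 1"
  using mesh_size_pos R(1) h by auto

lemma C0: "C \<ge> 0"
  unfolding C_eq by (rule majorant_nonneg[OF \<nu>]) (use M in simp)

lemma \<Phi>0: "\<Phi> \<ge> 0"
  using f[of "(0, 0)"] X Y by (force simp: cdom_def)

lemma L0: "L \<ge> 0"
  unfolding L_eq using \<Phi>0 C0 M X Y \<Lambda> by simp

lemma goursat_const_nonneg: "a \<ge> 0 \<Longrightarrow> goursat_const a X Y \<ge> 0"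
  unfolding goursat_const_def using X Y by simp

lemma K0: "K \<ge> 0"
  unfolding K_eq using goursat_const_nonneg C0 M by simp

lemma N_bound: "\<bar>v\<bar> \<le> M \<Longrightarrow> \<bar>Nfun \<nu> v\<bar> \<le> C"
  unfolding C_eq by (rule Nfun_bound[OF \<nu>])

lemma N_lipschitz: "\<bar>v\<bar> \<le> M \<Longrightarrow> \<bar>w\<bar> \<le> M \<Longrightarrow> \<bar>Nfun \<nu> v - Nfun \<nu> w\<bar> \<le> C * \<bar>v - w\<bar>"
  unfolding C_eq by (rule Nfun_lipschitz[OF \<nu>])

lemma N_deriv_bound: "\<bar>v\<bar> \<le> M \<Longrightarrow> \<bar>deriv (Nfun \<nu>) v\<bar> \<le> C"
  unfolding C_eq deriv_Nfun[OF \<nu>] using taylor_coeff_partial_sum_le[OF \<nu>, of v M "{1}"] by simp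

lemma u_facts:
  "C11_on (dom X Y) u" "continuous_on (cdom X Y) u"
  "\<And>p. p \<in> dom X Y \<Longrightarrow> dx (dy u) p = f p - Nfun \<nu> (u p) * u p"
  "\<And>x. x \<in> {0..X} \<Longrightarrow> u (x, 0) = \<psi> x" "\<And>y. y \<in> {0..Y} \<Longrightarrow> u (0, y) = \<phi> y"
  using u unfolding goursat_solution_def by (auto simp: algebra_simps)

lemma U_facts:
  "continuous_on (cdom X Y) (U k)"
  "\<And>i j. i \<in> {1..N1} \<Longrightarrow> j \<in> {1..N2} \<Longrightarrow> C11_on (Cell i j) (U k)"
  "\<And>i j p. i \<in> {1..N1} \<Longrightarrow> j \<in> {1..N2} \<Longrightarrow> p \<in> Cell i j \<Longrightarrow>
     dx (dy (U 0)) p = f p - Nfun \<nu> (U 0 (Corner i j)) * U 0 p"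
  "\<And>x. x \<in> {0..X} \<Longrightarrow> U 0 (x, 0) = \<psi> x" "\<And>y. y \<in> {0..Y} \<Longrightarrow> U 0 (0, y) = \<phi> y"
  "\<And>i j p. k \<ge> 1 \<Longrightarrow> i \<in> {1..N1} \<Longrightarrow> j \<in> {1..N2} \<Longrightarrow> p \<in> Cell i j \<Longrightarrow>
     dx (dy (U k)) p = fd_rhs (Nfun \<nu>) U k (Corner i j) p - Nfun \<nu> (U 0 (Corner i j)) * U k p
       - deriv (Nfun \<nu>) (U 0 (Corner i j)) * U 0 p * U k (Corner i j)"
  "\<And>x. k \<ge> 1 \<Longrightarrow> x \<in> {0..X} \<Longrightarrow> U k (x, 0) = 0" "\<And>y. k \<ge> 1 \<Longrightarrow> y \<in> {0..Y} \<Longrightarrow> U k (0, y) = 0"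
proof -
  note u = U[unfolded fd_method_def]
  show "continuous_on (cdom X Y) (U k)" using u by blast
  show "C11_on (Cell i j) (U k)" if "i \<in> {1..N1}" "j \<in> {1..N2}" for i j using u that by blast
  show "dx (dy (U 0)) p = f p - Nfun \<nu> (U 0 (Corner i j)) * U 0 p"
    if "i \<in> {1..N1}" "j \<in> {1..N2}" "p \<in> Cell i j" for i j p
  proof -
    have "dx (dy (U 0)) p + Nfun \<nu> (U 0 (Corner i j)) * U 0 p = f p" using u that by blast
    then show ?thesis by linarith
  qed
  show "U 0 (x, 0) = \<psi> x" if "x \<in> {0..X}" for x using u that by blast
  show "U 0 (0, y) = \<phi> y" if "y \<in> {0..Y}" for y using u that by blast
  show "dx (dy (U k)) p = fd_rhs (Nfun \<nu>) U k (Corner i j) p - Nfun \<nu> (U 0 (Corner i j)) * U k p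
       - deriv (Nfun \<nu>) (U 0 (Corner i j)) * U 0 p * U k (Corner i j)"
    if "k \<ge> 1" "i \<in> {1..N1}" "j \<in> {1..N2}" "p \<in> Cell i j" for i j p
  proof -
    have "dx (dy (U k)) p + Nfun \<nu> (U 0 (Corner i j)) * U k p
        + deriv (Nfun \<nu>) (U 0 (Corner i j)) * U 0 p * U k (Corner i j)
      = fd_rhs (Nfun \<nu>) U k (Corner i j) p"
      using u that by blast
    then show ?thesis by linarith
  qed
  show "U k (x, 0) = 0" if "k \<ge> 1" "x \<in> {0..X}" for x using u that by blast
  show "U k (0, y) = 0" if "k \<ge> 1" "y \<in> {0..Y}" for y using u that by blast
qed

lemma cell_subset_dom: "i \<in> {1..N1} \<Longrightarrow> j \<in> {1..N2} \<Longrightarrow> Cell i j \<subseteq> dom X Y"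
  using cell_facts(1) by blast

lemma u_mixed: "cellwise_mixed u (dx (dy u))"
  unfolding cellwise_mixed_def
  using has_mixed_deriv_on_subset[OF C11_on_has_mixed_deriv[OF u_facts(1)] cell_subset_dom] by blast

lemma U_mixed: "cellwise_mixed (U k) (dx (dy (U k)))"
  unfolding cellwise_mixed_def using C11_on_has_mixed_deriv[OF U_facts(2)] by blast

lemma u_lipschitz: "coord_lipschitz u L"
  unfolding L_eq
proof (rule lipschitz_of_boundary[OF u_facts(2) u_mixed])
  fix i j p assume "i \<in> {1..N1}" "j \<in> {1..N2}" "p \<in> Cell i j"
  note cf = cell_facts[OF this]
  have "\<bar>Nfun \<nu> (u p) * u p\<bar> \<le> C * M"
    using uM[OF cf(2)] by (intro abs_mult_le N_bound) auto
  then show "\<bar>dx (dy u) p\<bar> \<le> \<Phi> + C * M"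
    using f[OF cf(2)] u_facts(3)[OF cf(1)] by linarith
qed (use u_facts \<psi> \<phi> X Y \<Phi>0 C0 M in auto)

text \<open>The difference solves a Goursat problem whose inhomogeneity is the variation of \<open>N(u)\<close> over a cell, hence
  of order \<open>h\<close>. As long as the difference is at most 1, both functions have values in \<open>[-M, M]\<close>,
  where \<open>C\<close> is a Lipschitz constant.\<close>

lemma U0_close: "p \<in> cdom X Y \<Longrightarrow> \<bar>U 0 p - u p\<bar> \<le> 1"
proof -
  define g where "g = (\<lambda>p. U 0 p - u p)"
  define \<epsilon> where "\<epsilon> = 2 * C * M * L * mesh_size"
  have \<epsilon>0: "\<epsilon> \<ge> 0" unfolding \<epsilon>_def using C0 M L0 mesh_size_pos by simp
  have small: "K * \<epsilon> < 1"
  proof -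
    have "K * \<epsilon> = 2 * (K * C * M) * (L * mesh_size)" by (simp add: \<epsilon>_def)
    also have "\<dots> \<le> 128 * (K * C * M) * ((L + 1) * R)"
      using K0 C0 M L0 h mesh_size_pos by (intro mult_mono) auto
    also have "\<dots> < 1" using R(2) \<eta> by (simp add: mult.assoc)
    finally show ?thesis .
  qed
  have "controlled g (goursat_const (C * (1 + M)) X Y * \<epsilon>)"
  proof (rule conditional_goursat_estimate[where \<delta> = 1])
    show "continuous_on (cdom X Y) g"
      unfolding g_def by (intro continuous_on_diff U_facts u_facts)
    show "cellwise_mixed g (\<lambda>p. dx (dy (U 0)) p - dx (dy u) p)"
      using U_mixed[of 0] u_mixed unfolding g_def cellwise_mixed_def by (blast intro: has_mixed_deriv_on_diff)
    fix i j p assume ij: "i \<in> {1..N1}" "j \<in> {1..N2}" "p \<in> Cell i j"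
      and gp: "\<bar>g p\<bar> \<le> 1" and gq: "\<bar>g (Corner i j)\<bar> \<le> 1"
    note cf = cell_facts[OF ij]
    let ?q = "Corner i j"
    have b: "\<bar>u p\<bar> \<le> M" "\<bar>u ?q\<bar> \<le> M" "\<bar>U 0 ?q\<bar> \<le> M"
      using uM[OF cf(2)] uM[OF cf(3)] gq by (auto simp: g_def)
    have "dx (dy (U 0)) p - dx (dy u) p
        = (Nfun \<nu> (u p) - Nfun \<nu> (u ?q)) * u p + (Nfun \<nu> (u ?q) - Nfun \<nu> (U 0 ?q)) * u p
          - Nfun \<nu> (U 0 ?q) * g p"
      unfolding U_facts(3)[OF ij] u_facts(3)[OF cf(1)] g_def by (simp add: algebra_simps)
    moreover have "\<bar>(Nfun \<nu> (u p) - Nfun \<nu> (u ?q)) * u p\<bar> \<le> (C * (2 * L * mesh_size)) * M"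
      using order_trans[OF N_lipschitz[OF b(1,2)] mult_left_mono[OF corner_variation[OF u_lipschitz L0 ij] C0]] b
      by (intro abs_mult_le) auto
    moreover have "\<bar>(Nfun \<nu> (u ?q) - Nfun \<nu> (U 0 ?q)) * u p\<bar> \<le> (C * \<bar>g ?q\<bar>) * M"
      using N_lipschitz[OF b(2,3)] b by (intro abs_mult_le) (auto simp: g_def abs_minus_commute)
    moreover have "\<bar>Nfun \<nu> (U 0 ?q) * g p\<bar> \<le> C * \<bar>g p\<bar>"
      using N_bound[OF b(3)] by (intro abs_mult_le) auto
    moreover have "C * \<bar>g ?q\<bar> * M + C * \<bar>g p\<bar> \<le> C * (1 + M) * (\<bar>g p\<bar> + \<bar>g ?q\<bar>)"
      using C0 M by (simp add: algebra_simps)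
    moreover have "(C * (2 * L * mesh_size)) * M = \<epsilon>" by (simp add: \<epsilon>_def)
    ultimately show "\<bar>dx (dy (U 0)) p - dx (dy u) p\<bar> \<le> C * (1 + M) * (\<bar>g p\<bar> + \<bar>g ?q\<bar>) + \<epsilon>"
      by linarith
  qed (use C0 M \<epsilon>0 small u_facts U_facts in \<open>auto simp: g_def K_eq\<close>)
  then show "\<bar>U 0 p - u p\<bar> \<le> 1" if "p \<in> cdom X Y"
    using that small unfolding controlled_def K_eq[symmetric] g_def by fastforce
qed

lemma U0_bound: "p \<in> cdom X Y \<Longrightarrow> \<bar>U 0 p\<bar> \<le> M"
  using U0_close[of p] uM[of p] by linarith

lemma U0_lipschitz: "coord_lipschitz (U 0) L"
  unfolding L_eq
proof (rule lipschitz_of_boundary[OF U_facts(1) U_mixed])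
  fix i j p assume ij: "i \<in> {1..N1}" "j \<in> {1..N2}" "p \<in> Cell i j"
  note cf = cell_facts[OF ij]
  have "\<bar>Nfun \<nu> (U 0 (Corner i j)) * U 0 p\<bar> \<le> C * M"
    by (intro abs_mult_le N_bound U0_bound cf)
  then show "\<bar>dx (dy (U 0)) p\<bar> \<le> \<Phi> + C * M"
    using f[OF cf(2)] U_facts(3)[OF ij] by linarith
qed (use U_facts \<psi> \<phi> X Y \<Phi>0 C0 M in auto)

text \<open>The two smallness conditions each account for one half: \<open>16 K C (1 + M) \<eta> \<le> 1\<close> for the part of
  \<open>F\<^sup>(\<^sup>k\<^sup>)\<close> that is quadratic in \<open>\<eta>\<close>, and \<open>128 K C M (L + 1) R \<le> \<eta>\<close> for the part that is due to the variation over a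
  cell.\<close>

lemma U_controlled: "k \<ge> 1 \<Longrightarrow> controlled (U k) (\<eta> * weight r k)"
proof (induction k rule: less_induct)
  case (less k)
  have IH: "controlled (U s) (\<eta> * weight r s)" if "1 \<le> s" "s \<le> k - 1" for s
    using less.IH[of s] that less.prems by simp
  have ws: "weighted_seq M \<eta> r (k - 1) (\<lambda>s. U s p)" if "p \<in> cdom X Y" for p
    using IH U0_bound that unfolding weighted_seq_def controlled_def by auto
  \<comment> \<open>Variation of \<open>u\<^sup>(\<^sup>0\<^sup>)\<close>, and of \<open>u\<^sup>(\<^sup>s\<^sup>)\<close> relative to its weight, between a point and its corner.\<close>
  define d \<theta> where "d = 2 * L * mesh_size" and "\<theta> = 2 * \<eta> * mesh_size"
  have \<theta>0: "\<theta> \<ge> 0" using \<eta> mesh_size_pos by (simp add: \<theta>_def)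
  define \<epsilon> where "\<epsilon> = (8 * C * \<eta>\<^sup>2 * (1 + M) + 32 * C * M * (d + 2 * \<theta>) / r) * weight r k"
  have wtk: "weight r k \<ge> 0" using r by (intro weight_nonneg) auto
  have \<epsilon>0: "\<epsilon> \<ge> 0"
    unfolding \<epsilon>_def d_def using C0 M L0 \<theta>0 r wtk mesh_size_pos by (intro mult_nonneg_nonneg add_nonneg_nonneg divide_nonneg_pos) auto
  have "controlled (U k) (goursat_const (C * (1 + M)) X Y * \<epsilon>)"
  proof (rule linear_goursat_estimate[OF _ U_facts(1) U_mixed])
    fix i j p assume ij: "i \<in> {1..N1}" "j \<in> {1..N2}" "p \<in> Cell i j"
    note cf = cell_facts[OF ij]
    let ?q = "Corner i j"
    have "weighted_seq d \<theta> r (k - 1) (\<lambda>s. U s ?q - U s p)"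
      unfolding weighted_seq_def
    proof (intro conjI ballI)
      show "\<bar>U 0 ?q - U 0 p\<bar> \<le> d"
        using corner_variation[OF U0_lipschitz L0 ij] by (simp add: d_def abs_minus_commute)
      fix s assume s: "s \<in> {1..k - 1}"
      then have "coord_lipschitz (U s) (\<eta> * weight r s)" using IH[of s] by (simp add: controlled_def)
      from corner_variation[OF this _ ij] show "\<bar>U s ?q - U s p\<bar> \<le> \<theta> * weight r s"
        using \<eta> r by (simp add: weight_nonneg \<theta>_def abs_minus_commute mult_ac)
    qed
    then have "\<bar>fd_rhs (Nfun \<nu>) U k ?q p\<bar> \<le> \<epsilon>"
      unfolding \<epsilon>_def
      by (intro fd_rhs_bound[OF \<nu> C_eq]) (use ws cf \<theta>0 less.prems M r \<eta> in auto)
    moreover have "\<bar>Nfun \<nu> (U 0 ?q) * U k p\<bar> \<le> C * \<bar>U k p\<bar>"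
      by (intro abs_mult_le N_bound U0_bound cf) auto
    moreover have "\<bar>deriv (Nfun \<nu>) (U 0 ?q) * U 0 p * U k ?q\<bar> \<le> C * M * \<bar>U k ?q\<bar>"
      by (intro abs_mult_le N_deriv_bound U0_bound cf) auto
    moreover have "C * \<bar>U k p\<bar> + C * M * \<bar>U k ?q\<bar> \<le> C * (1 + M) * (\<bar>U k p\<bar> + \<bar>U k ?q\<bar>)"
      using C0 M by (simp add: algebra_simps)
    ultimately show "\<bar>dx (dy (U k)) p\<bar> \<le> C * (1 + M) * (\<bar>U k p\<bar> + \<bar>U k ?q\<bar>) + \<epsilon>"
      unfolding U_facts(6)[OF less.prems ij] by linarith
  qed (use C0 M \<epsilon>0 U_facts(7,8) less.prems in auto)
  moreover have "goursat_const (C * (1 + M)) X Y * \<epsilon> \<le> \<eta> * weight r k"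
  proof -
    have "K * (8 * C * \<eta>\<^sup>2 * (1 + M)) = (16 * K * C * (1 + M) * \<eta>) * (\<eta> / 2)"
      by (simp add: power2_eq_square)
    also have "\<dots> \<le> 1 * (\<eta> / 2)" by (intro mult_right_mono) (use \<eta> in auto)
    finally have 1: "K * (8 * C * \<eta>\<^sup>2 * (1 + M)) \<le> \<eta> / 2" by simp
    have "(d + 2 * \<theta>) / r = (2 * L + 4 * \<eta>) * R"
      using mesh_size_pos R(1) by (simp add: d_def \<theta>_def field_simps)
    moreover have "K * (32 * C * M * (d + 2 * \<theta>) / r) = (32 * K * C * M) * ((d + 2 * \<theta>) / r)"
      by simp
    ultimately have "K * (32 * C * M * (d + 2 * \<theta>) / r) = (32 * K * C * M) * ((2 * L + 4 * \<eta>) * R)"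
      by (simp only:)
    also have "\<dots> \<le> (32 * K * C * M) * ((2 * (L + 1)) * R)"
      using K0 C0 M \<eta> R by (intro mult_left_mono mult_right_mono) auto
    also have "\<dots> \<le> \<eta> / 2" using R(2) by (simp add: mult_ac)
    finally have "K * (8 * C * \<eta>\<^sup>2 * (1 + M) + 32 * C * M * (d + 2 * \<theta>) / r) \<le> \<eta>"
      unfolding distrib_left[of K] using 1 by linarith
    from mult_right_mono[OF this wtk] show ?thesis by (simp add: \<epsilon>_def K_eq mult.assoc)
  qed
  ultimately show ?case by (rule controlled_mono)
qed

lemma U_weighted_seq: "p \<in> cdom X Y \<Longrightarrow> weighted_seq M \<eta> r n (\<lambda>k. U k p)"
  using U_controlled U0_bound unfolding weighted_seq_def controlled_def by auto

text \<open>The equations of the method, with the terms that contain \<open>u\<^sup>(\<^sup>k\<^sup>)\<close> moved back into the Adomian sums.\<close>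

lemma U_mixed_coeff:
  assumes ij: "i \<in> {1..N1}" "j \<in> {1..N2}" "p \<in> Cell i j"
  shows "dx (dy (U k)) p = (if k = 0 then f p else 0) - fd_coeff \<nu> (\<lambda>s. U s p) (\<lambda>s. U s (Corner i j)) k"
proof (cases "k = 0")
  case True
  then show ?thesis using U_facts(3)[OF ij] by (simp add: fd_coeff_def adomian_def mult.commute)
next
  case False
  let ?q = "Corner i j"
  let ?A = "\<lambda>n. adomian (Nfun \<nu>) n (\<lambda>s. U s ?q)" and ?B = "\<lambda>n. adomian (Nfun \<nu>) n (\<lambda>s. U s p)"
  have k: "k \<ge> 1" using False by simp
  have "{..k} = insert 0 (insert k {1..<k})" using k by auto
  then have 1: "(\<Sum>s\<le>k. U s p * ?A (k - s)) = U 0 p * ?A k + U k p * ?A 0 + (\<Sum>s\<in>{1..<k}. U s p * ?A (k - s))"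
    using k by simp
  have "{..k-1} = {..<k}" using k by auto
  then have 2: "(\<Sum>s\<le>k-1. U s p * (?B (k - 1 - s) - ?A (k - 1 - s))) = - (\<Sum>s<k. (?A (k - 1 - s) - ?B (k - 1 - s)) * U s p)"
    by (simp add: sum_negf[symmetric] algebra_simps)
  have 3: "?A k = adomian (Nfun \<nu>) k ((\<lambda>s. U s ?q)(k := 0)) + deriv (Nfun \<nu>) (U 0 ?q) * U k ?q"
    by (rule adomian_split_top[OF \<nu> k])
  have 4: "?A 0 = Nfun \<nu> (U 0 ?q)" by (simp add: adomian_def)
  show ?thesis
    unfolding U_facts(6)[OF k ij] fd_rhs_def fd_coeff_def 1 2 3 4 using False
    by (simp add: algebra_simps)
qed

text \<open>The sum \<open>V\<close> is only known to be continuous, so it is not compared with \<open>u\<close> as a solution. Instead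
  the partial sums are: their mixed derivatives differ from \<open>f - N(V) V\<close> by the tail of a uniformly
  convergent series, and \<open>V\<close> differs from them by a uniform tail. The linear estimate then bounds
  the distance of the partial sum from \<open>u\<close> by a constant times \<^term>\<open>weight_tail r m\<close>.\<close>

lemma partial_sums_tendsto:
  assumes p: "p \<in> cdom X Y"
  shows "(\<lambda>m. \<Sum>k\<le>m. U k p) \<longlonglongrightarrow> u p"
proof -
  define V where "V p = (\<Sum>k. U k p)" for p
  have \<eta>': "\<eta> \<ge> 0" "16 * \<eta> \<le> 1" and M0: "M \<ge> 0" using \<eta> M by auto
  have V: "(\<lambda>k. U k p) sums V p" if "p \<in> cdom X Y" for p
    unfolding V_def by (rule summable_sums, rule summable_rabs_cancel,
        rule adomian_sums(1)[OF \<nu> C_eq M0 r(1) \<eta>' r(3) U_weighted_seq[OF that]])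
  have Vtail: "\<bar>V p - (\<Sum>k\<le>m. U k p)\<bar> \<le> \<eta> * weight_tail r m" if "p \<in> cdom X Y" for p m
    by (rule sums_remainder_le_weight_tail[OF V[OF that] _ r(1,3)])
       (use U_controlled that in \<open>auto simp: controlled_def\<close>)
  define M1 where "M1 = M + \<eta> * weight_tail r 0"
  have M1: "M1 \<ge> M" using \<eta>' weight_tail_nonneg[OF r(1,3)] by (simp add: M1_def)
  have VM1: "\<bar>V p\<bar> \<le> M1" if "p \<in> cdom X Y" for p
    using Vtail[OF that, of 0] U0_bound[OF that] by (simp add: M1_def)
  define C1 D a where "C1 = majorant \<nu> (M1 + 2)" and "D = 8 * M * C + 64 * M * C / r" and "a = C1 * (1 + M1)"
  have C1: "C1 \<ge> 0" unfolding C1_def by (rule majorant_nonneg[OF \<nu>]) (use M1 M in simp)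
  have a: "a \<ge> 0" unfolding a_def using C1 M M1 by simp
  have D: "D \<ge> 0" unfolding D_def using M C0 r(1)
    by (intro add_nonneg_nonneg mult_nonneg_nonneg divide_nonneg_pos) auto
  have est: "\<bar>(\<Sum>k\<le>m. U k p) - u p\<bar> \<le> goursat_const a X Y * ((a * \<eta> + D) * weight_tail r m)" for m
  proof -
    define g where "g = (\<lambda>p. (\<Sum>k\<le>m. U k p) - u p)"
    have "controlled g (goursat_const a X Y * ((a * \<eta> + D) * weight_tail r m))"
    proof (rule linear_goursat_estimate[OF a])
      show "continuous_on (cdom X Y) g"
        unfolding g_def by (intro continuous_on_diff continuous_on_sum U_facts u_facts)
      show "cellwise_mixed g (\<lambda>p. (\<Sum>k\<le>m. dx (dy (U k)) p) - dx (dy u) p)"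
        using U_mixed u_mixed unfolding g_def cellwise_mixed_def
        by (intro ballI has_mixed_deriv_on_diff has_mixed_deriv_on_sum) auto
      have nz: "(\<Sum>k\<le>m. U k q) = U 0 q" if "\<And>k. k \<ge> 1 \<Longrightarrow> U k q = 0" for q
        using sum.mono_neutral_right[of "{..m}" "{0}" "\<lambda>k. U k q"] that by auto
      show "g (x, 0) = 0" if "x \<in> {0..X}" for x
        using nz[of "(x, 0)"] U_facts(7)[OF _ that] U_facts(4)[OF that] u_facts(4)[OF that] by (simp add: g_def)
      show "g (0, y) = 0" if "y \<in> {0..Y}" for y
        using nz[of "(0, y)"] U_facts(8)[OF _ that] U_facts(5)[OF that] u_facts(5)[OF that] by (simp add: g_def)
      fix i j p assume ij: "i \<in> {1..N1}" "j \<in> {1..N2}" "p \<in> Cell i j"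
      note cf = cell_facts[OF ij]
      let ?c = "fd_coeff \<nu> (\<lambda>s. U s p) (\<lambda>s. U s (Corner i j))"
      have S: "?c sums (V p * Nfun \<nu> (V p))"
        unfolding V_def by (rule fd_coeff_sums(1)[OF \<nu> C_eq M0 r(1) \<eta>' r(3) M U_weighted_seq[OF cf(2)] U_weighted_seq[OF cf(3)]])
      have tail: "\<bar>V p * Nfun \<nu> (V p) - (\<Sum>k\<le>m. ?c k)\<bar> \<le> D * weight_tail r m"
        unfolding D_def
        by (rule sums_remainder_le_weight_tail[OF S _ r(1,3)],
            rule fd_coeff_sums(2)[OF \<nu> C_eq M0 r(1) \<eta>' r(3) M U_weighted_seq[OF cf(2)] U_weighted_seq[OF cf(3)]])
      have "(\<Sum>k\<le>m. dx (dy (U k)) p) = f p - (\<Sum>k\<le>m. ?c k)"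
        unfolding U_mixed_coeff[OF ij] sum_subtractf by simp
      then have "(\<Sum>k\<le>m. dx (dy (U k)) p) - dx (dy u) p
          = (V p * Nfun \<nu> (V p) - (\<Sum>k\<le>m. ?c k)) + (Nfun \<nu> (u p) * u p - V p * Nfun \<nu> (V p))"
        unfolding u_facts(3)[OF cf(1)] by simp
      moreover have "\<bar>Nfun \<nu> (u p) * u p - V p * Nfun \<nu> (V p)\<bar> \<le> a * \<bar>u p - V p\<bar>"
      proof -
        have b: "\<bar>u p\<bar> \<le> M1" "\<bar>V p\<bar> \<le> M1" using VM1[OF cf(2)] uM[OF cf(2)] M1 by auto
        have "Nfun \<nu> (u p) * u p - V p * Nfun \<nu> (V p)
            = Nfun \<nu> (u p) * (u p - V p) + (Nfun \<nu> (u p) - Nfun \<nu> (V p)) * V p" by (simp add: algebra_simps)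
        moreover have "\<bar>Nfun \<nu> (u p) * (u p - V p)\<bar> \<le> C1 * \<bar>u p - V p\<bar>"
          unfolding C1_def by (intro abs_mult_le Nfun_bound[OF \<nu>] b) simp
        moreover have "\<bar>(Nfun \<nu> (u p) - Nfun \<nu> (V p)) * V p\<bar> \<le> (C1 * \<bar>u p - V p\<bar>) * M1"
          unfolding C1_def by (intro abs_mult_le Nfun_lipschitz[OF \<nu>] b)
        moreover have "a * \<bar>u p - V p\<bar> = C1 * \<bar>u p - V p\<bar> + (C1 * \<bar>u p - V p\<bar>) * M1"
          by (simp add: a_def algebra_simps)
        ultimately show ?thesis by linarith
      qed
      moreover have "a * \<bar>u p - V p\<bar> \<le> a * (\<bar>g p\<bar> + \<bar>g (Corner i j)\<bar>) + a * \<eta> * weight_tail r m"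
      proof -
        have "\<bar>u p - V p\<bar> \<le> \<bar>g p\<bar> + \<bar>g (Corner i j)\<bar> + \<eta> * weight_tail r m"
          using Vtail[OF cf(2), of m] by (simp add: g_def)
        from mult_left_mono[OF this a] show ?thesis by (simp add: distrib_left mult.assoc)
      qed
      ultimately show "\<bar>(\<Sum>k\<le>m. dx (dy (U k)) p) - dx (dy u) p\<bar>
          \<le> a * (\<bar>g p\<bar> + \<bar>g (Corner i j)\<bar>) + (a * \<eta> + D) * weight_tail r m"
        using tail distrib_right[of "a * \<eta>" D "weight_tail r m"] by linarith
    qed (use a \<eta>' D weight_tail_nonneg[OF r(1,3)] in auto)
    then show ?thesis using p by (simp add: controlled_def g_def)
  qed
  have lim: "(\<lambda>m. goursat_const a X Y * ((a * \<eta> + D) * weight_tail r m)) \<longlonglongrightarrow> 0"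
    by (intro tendsto_mult_right_zero weight_tail_tendsto_0 r)
  have "\<forall>m. norm ((\<Sum>k\<le>m. U k p) - u p) \<le> goursat_const a X Y * ((a * \<eta> + D) * weight_tail r m)"
    using est by simp
  then have "(\<lambda>m. (\<Sum>k\<le>m. U k p) - u p) \<longlonglongrightarrow> 0"
    by (rule Lim_null_comparison[OF always_eventually lim])
  then show ?thesis by (rule LIM_zero_cancel)
qed

lemma U_sums: "p \<in> cdom X Y \<Longrightarrow> (\<lambda>k. U k p) sums u p"
  using partial_sums_tendsto[of p] by (simp add: sums_def_le)

text \<open>The error is \<open>\<Sum>\<^sub>k\<^sub>>\<^sub>m u\<^sup>(\<^sup>k\<^sup>)\<close>, and both parts of \<^const>\<open>controlled\<close> pass to this sum termwise.\<close>

lemma error_controlled: "controlled (\<lambda>p. u p - (\<Sum>k\<le>m. U k p)) (\<eta> * weight_tail r m)"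
proof -
  have b: "controlled (U k) (\<eta> * weight r k)" if "k > m" for k
    using U_controlled[of k] that by simp
  have lip: "\<bar>(u p - (\<Sum>k\<le>m. U k p)) - (u q - (\<Sum>k\<le>m. U k q))\<bar> \<le> \<eta> * weight_tail r m * \<delta>"
    if pq: "p \<in> cdom X Y" "q \<in> cdom X Y" and d: "\<And>k. k > m \<Longrightarrow> \<bar>U k p - U k q\<bar> \<le> \<eta> * weight r k * \<delta>" for p q \<delta>
  proof -
    have "\<bar>(u p - u q) - (\<Sum>k\<le>m. U k p - U k q)\<bar> \<le> (\<eta> * \<delta>) * weight_tail r m"
      by (rule sums_remainder_le_weight_tail[OF sums_diff[OF U_sums[OF pq(1)] U_sums[OF pq(2)]] _ r(1,3)])
         (use d in \<open>auto simp: mult_ac\<close>)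
    then show ?thesis by (simp add: sum_subtractf algebra_simps)
  qed
  show ?thesis
    unfolding controlled_def coord_lipschitz_def
  proof (intro conjI ballI)
    show "\<bar>u p - (\<Sum>k\<le>m. U k p)\<bar> \<le> \<eta> * weight_tail r m" if "p \<in> cdom X Y" for p
      by (rule sums_remainder_le_weight_tail[OF U_sums[OF that] _ r(1,3)])
         (use b that in \<open>auto simp: controlled_def\<close>)
    show "\<bar>(u (x, y) - (\<Sum>k\<le>m. U k (x, y))) - (u (x', y) - (\<Sum>k\<le>m. U k (x', y)))\<bar> \<le> \<eta> * weight_tail r m * \<bar>x - x'\<bar>"
      if "x \<in> {0..X}" "x' \<in> {0..X}" "y \<in> {0..Y}" for x x' y
      by (rule lip) (use b that in \<open>auto simp: controlled_def coord_lipschitz_def cdom_def\<close>)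
    show "\<bar>(u (x, y) - (\<Sum>k\<le>m. U k (x, y))) - (u (x, y') - (\<Sum>k\<le>m. U k (x, y')))\<bar> \<le> \<eta> * weight_tail r m * \<bar>y - y'\<bar>"
      if "x \<in> {0..X}" "y \<in> {0..Y}" "y' \<in> {0..Y}" for x y y'
      by (rule lip) (use b that in \<open>auto simp: controlled_def coord_lipschitz_def cdom_def\<close>)
  qed
qed

lemma error_norm1:
  "norm1 X Y N1 N2 (\<lambda>p. u p - (\<Sum>k\<le>m. U k p))
    \<le> ereal (2 * \<eta> * R / ((real m + 1) powr (1 + 1) * (R - mesh_size)) * r ^ (m + 1))"
proof -
  have "norm1 X Y N1 N2 (\<lambda>p. u p - (\<Sum>k\<le>m. U k p)) \<le> ereal (2 * (\<eta> * weight_tail r m))"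
  proof (rule norm1_le[OF error_controlled])
    fix i j x y assume ij: "i \<in> {1..N1}" "j \<in> {1..N2}" "(x, y) \<in> Cell i j"
    have "C11_on (dom X Y) u" "(x, y) \<in> dom X Y" using u_facts cell_facts(1)[OF ij] by auto
    then have ud: "(\<lambda>s. u (s, y)) differentiable (at x)" "(\<lambda>t. u (x, t)) differentiable (at y)"
      unfolding C11_on_def by auto
    have Ud: "(\<lambda>s. U k (s, y)) differentiable (at x)" "(\<lambda>t. U k (x, t)) differentiable (at y)" for k
      using U_facts(2)[OF ij(1,2), of k] ij(3) unfolding C11_on_def by auto
    show "(\<lambda>s. u (s, y) - (\<Sum>k\<le>m. U k (s, y))) differentiable (at x) \<and>
        (\<lambda>t. u (x, t) - (\<Sum>k\<le>m. U k (x, t))) differentiable (at y)"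
      by (intro conjI differentiable_diff differentiable_sum ud Ud ballI) auto
  qed
  also have "2 * (\<eta> * weight_tail r m) \<le> 2 * (\<eta> * (r ^ (m + 1) / ((real m + 1)\<^sup>2 * (1 - r))))"
    by (intro mult_left_mono weight_tail_geometric r) (use \<eta> in auto)
  also have "\<dots> = 2 * \<eta> * R / ((real m + 1) powr (1 + 1) * (R - mesh_size)) * r ^ (m + 1)"
  proof -
    have "(real m + 1) powr (1 + 1) = (real m + 1)\<^sup>2" using powr_realpow[of "real m + 1" 2] by simp
    moreover have "R * (1 - r) = R - mesh_size" using R(1) by (simp add: field_simps)
    moreover have "1 / (1 - r) = R / (R * (1 - r))" using R(1) by simp
    ultimately show ?thesis by (simp add: field_simps)
  qed
  finally show ?thesis by simp
qed

end

section \<open>Superexponential convergence\<close>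

lemma lipschitz_of_bounded_deriv:
  fixes g :: "real \<Rightarrow> real"
  assumes d: "g C1_differentiable_on {0<..<l}" and c: "continuous_on {0..l} g"
    and b: "bounded (deriv g ` {0<..<l})"
  shows "\<exists>\<Lambda>\<ge>0. \<forall>x\<in>{0..l}. \<forall>x'\<in>{0..l}. \<bar>g x - g x'\<bar> \<le> \<Lambda> * \<bar>x - x'\<bar>"
proof -
  obtain \<Lambda> where \<Lambda>: "\<Lambda> > 0" "\<And>x. x \<in> {0<..<l} \<Longrightarrow> \<bar>deriv g x\<bar> \<le> \<Lambda>"
    using b unfolding bounded_pos by auto
  have D: "DERIV g x :> deriv g x" if "0 < x" "x < l" for x
    using d that by (auto simp: C1_differentiable_on_eq DERIV_deriv_iff_real_differentiable)
  have main: "\<bar>g z - g x\<bar> \<le> \<Lambda> * \<bar>z - x\<bar>" if xz: "0 \<le> x" "x < z" "z \<le> l" for x z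
  proof -
    obtain D c where c: "x < c" "c < z" "DERIV g c :> D" "g z - g x = (z - x) * D"
    proof -
      have "continuous_on {x..z} g" by (rule continuous_on_subset[OF assms(2)]) (use xz in auto)
      moreover have "g differentiable (at s)" if "x < s" "s < z" for s
        using D[of s] that \<open>0 \<le> x\<close> \<open>z \<le> l\<close> by (auto simp: real_differentiable_def)
      ultimately show thesis using MVT[OF \<open>x < z\<close>, of g] that by blast
    qed
    have "\<bar>D\<bar> \<le> \<Lambda>" using \<Lambda>(2)[of c] DERIV_imp_deriv[OF c(3)] c that by auto
    from mult_left_mono[OF this, of "z - x"] show ?thesis using c that by (simp add: abs_mult mult.commute)
  qed
  have "\<bar>g x - g x'\<bar> \<le> \<Lambda> * \<bar>x - x'\<bar>" if "x \<in> {0..l}" "x' \<in> {0..l}" for x x'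
    using main[of x x'] main[of x' x] that by (cases x x' rule: linorder_cases) (auto simp: abs_minus_commute)
  then show ?thesis using \<Lambda>(1) by (intro exI[of _ \<Lambda>]) auto
qed

theorem theorem5p1:
  fixes X Y :: real and \<nu> :: "nat \<Rightarrow> real"
    and f :: "real \<times> real \<Rightarrow> real" and \<psi> \<phi> :: "real \<Rightarrow> real"
  assumes "X > 0" and "Y > 0"
    and "\<And>v :: real. summable (\<lambda>k. \<nu> k * v ^ k)"
    and "\<psi> C1_differentiable_on {0<..<X}" and "continuous_on {0..X} \<psi>"
    and "bounded (deriv \<psi> ` {0<..<X})"
    and "\<phi> C1_differentiable_on {0<..<Y}" and "continuous_on {0..Y} \<phi>"
    and "bounded (deriv \<phi> ` {0<..<Y})"
    and "continuous_on (cdom X Y) f"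
    and "\<psi> 0 = \<phi> 0"
    and "\<exists>u. goursat_solution X Y \<nu> f \<psi> \<phi> u"
    and "\<And>u v p. goursat_solution X Y \<nu> f \<psi> \<phi> u \<Longrightarrow> goursat_solution X Y \<nu> f \<psi> \<phi> v
           \<Longrightarrow> p \<in> cdom X Y \<Longrightarrow> u p = v p"
  shows "\<exists>c R \<epsilon> :: real. c > 0 \<and> R > 0 \<and> \<epsilon> > 0 \<and>
    (\<forall>u N1 N2 U (m :: nat).
       goursat_solution X Y \<nu> f \<psi> \<phi> u \<longrightarrow> N1 \<ge> 1 \<longrightarrow> N2 \<ge> 1 \<longrightarrow>
       sqrt ((X / real N1)\<^sup>2 + (Y / real N2)\<^sup>2) < R \<longrightarrow>
       fd_method X Y \<nu> f \<psi> \<phi> N1 N2 U \<longrightarrow>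
       (let h = sqrt ((X / real N1)\<^sup>2 + (Y / real N2)\<^sup>2) in
        norm1 X Y N1 N2 (\<lambda>p. u p - (\<Sum>k\<le>m. U k p))
          \<le> ereal (c * R / ((real m + 1) powr (1 + \<epsilon>) * (R - h)) * (h / R) ^ (m + 1))))"
proof -
  have \<nu>: "entire_series \<nu>" using assms(3) by (simp add: entire_series_def)
  obtain u0 where u0: "goursat_solution X Y \<nu> f \<psi> \<phi> u0" using assms(12) by blast
  have comp: "compact (cdom X Y)" unfolding cdom_def by (intro compact_Times compact_Icc)
  have bdd: "\<exists>B\<ge>0. \<forall>p\<in>cdom X Y. \<bar>g p\<bar> \<le> B" if "continuous_on (cdom X Y) g" for g :: "real \<times> real \<Rightarrow> real"
  proof -
    have "bounded (g ` cdom X Y)"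
      by (rule compact_imp_bounded[OF compact_continuous_image[OF that comp]])
    then obtain B where "B > 0" "\<And>x. x \<in> g ` cdom X Y \<Longrightarrow> norm x \<le> B" unfolding bounded_pos by blast
    then show ?thesis by (intro exI[of _ B]) auto
  qed
  obtain B where B: "B \<ge> 0" "\<And>p. p \<in> cdom X Y \<Longrightarrow> \<bar>u0 p\<bar> \<le> B"
    using bdd[of u0] u0 unfolding goursat_solution_def by blast
  obtain \<Phi> where \<Phi>: "\<Phi> \<ge> 0" "\<And>p. p \<in> cdom X Y \<Longrightarrow> \<bar>f p\<bar> \<le> \<Phi>" using bdd[OF assms(10)] by blast
  obtain \<Lambda>1 where \<Lambda>1: "\<Lambda>1 \<ge> 0" "\<And>x x'. x \<in> {0..X} \<Longrightarrow> x' \<in> {0..X} \<Longrightarrow> \<bar>\<psi> x - \<psi> x'\<bar> \<le> \<Lambda>1 * \<bar>x - x'\<bar>"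
    using lipschitz_of_bounded_deriv[OF assms(4-6)] by blast
  obtain \<Lambda>2 where \<Lambda>2: "\<Lambda>2 \<ge> 0" "\<And>x x'. x \<in> {0..Y} \<Longrightarrow> x' \<in> {0..Y} \<Longrightarrow> \<bar>\<phi> x - \<phi> x'\<bar> \<le> \<Lambda>2 * \<bar>x - x'\<bar>"
    using lipschitz_of_bounded_deriv[OF assms(7-9)] by blast
  \<comment> \<open>The order of choice matters: \<open>\<eta>\<close> depends on \<open>K\<close> and \<open>C\<close>, and \<open>R\<close> on \<open>\<eta>\<close>.\<close>
  define M \<Lambda> where "M = B + 1" and "\<Lambda> = \<Lambda>1 + \<Lambda>2"
  define C where "C = majorant \<nu> (M + 2)"
  define L where "L = (\<Phi> + C * M) * (X + Y) + \<Lambda>"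
  define K where "K = goursat_const (C * (1 + M)) X Y"
  define \<eta> where "\<eta> = 1 / (16 + 16 * K * C * (1 + M))"
  define R where "R = \<eta> / (1 + 128 * K * C * M * (L + 1))"
  have M: "M \<ge> 1" using B(1) by (simp add: M_def)
  have C: "C \<ge> 0" unfolding C_def by (rule majorant_nonneg[OF \<nu>]) (use M in simp)
  have L: "L \<ge> 0" unfolding L_def \<Lambda>_def using \<Phi> C M assms(1,2) \<Lambda>1 \<Lambda>2 by simp
  have K: "K \<ge> 0" unfolding K_def goursat_const_def using C M assms(1,2) by simp
  have k1: "16 * K * C * (1 + M) \<ge> 0" and k2: "128 * K * C * M * (L + 1) \<ge> 0" using K C M L by simp_all
  have \<eta>: "\<eta> > 0" "16 * \<eta> \<le> 1" "16 * K * C * (1 + M) * \<eta> \<le> 1"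
  proof -
    define P where "P = 16 * K * C * (1 + M)"
    have "\<eta> = 1 / (16 + P)" "P \<ge> 0" using k1 by (simp_all add: \<eta>_def P_def)
    then show "\<eta> > 0" "16 * \<eta> \<le> 1" "16 * K * C * (1 + M) * \<eta> \<le> 1"
      unfolding P_def[symmetric] by simp_all
  qed
  have R: "R > 0" "128 * K * C * M * (L + 1) * R \<le> \<eta>"
    using k2 \<eta>(1) unfolding R_def by (simp_all add: field_simps)
  have "norm1 X Y N1 N2 (\<lambda>p. u p - (\<Sum>k\<le>m. U k p))
      \<le> ereal (2 * \<eta> * R / ((real m + 1) powr (1 + 1) * (R - h)) * (h / R) ^ (m + 1))"
    if u: "goursat_solution X Y \<nu> f \<psi> \<phi> u" and N: "N1 \<ge> 1" "N2 \<ge> 1" and h: "h < R"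
      and U: "fd_method X Y \<nu> f \<psi> \<phi> N1 N2 U" and heq: "h = sqrt ((X / real N1)\<^sup>2 + (Y / real N2)\<^sup>2)"
    for u N1 N2 U m h
  proof -
    interpret mesh X Y N1 N2 using assms(1,2) N by unfold_locales
    have hm: "h = mesh_size" unfolding heq mesh_size_def ..
    have w: "\<Lambda>1 * \<bar>x - x'\<bar> \<le> \<Lambda> * \<bar>x - x'\<bar>" "\<Lambda>2 * \<bar>x - x'\<bar> \<le> \<Lambda> * \<bar>x - x'\<bar>" for x x'
      unfolding \<Lambda>_def using \<Lambda>1(1) \<Lambda>2(1) by (auto intro!: mult_right_mono)
    interpret fd_run X Y N1 N2 \<nu> f \<psi> \<phi> u U M \<Phi> \<Lambda> C L K \<eta> R
    proof
      show "\<bar>u p\<bar> \<le> M - 1" if "p \<in> cdom X Y" for p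
        using assms(13)[OF u u0 that] B(2)[OF that] by (simp add: M_def)
      show "\<bar>\<psi> x - \<psi> x'\<bar> \<le> \<Lambda> * \<bar>x - x'\<bar>" if "x \<in> {0..X}" "x' \<in> {0..X}" for x x'
        using order_trans[OF \<Lambda>1(2)[OF that] w(1)] .
      show "\<bar>\<phi> x - \<phi> x'\<bar> \<le> \<Lambda> * \<bar>x - x'\<bar>" if "x \<in> {0..Y}" "x' \<in> {0..Y}" for x x'
        using order_trans[OF \<Lambda>2(2)[OF that] w(2)] .
      show "\<Lambda> \<ge> 0" using \<Lambda>1 \<Lambda>2 by (simp add: \<Lambda>_def)
      show "mesh_size < R" using h hm by simp
    qed (fact \<nu> u U M \<Phi>(2) C_def L_def K_def \<eta> R)+
    show ?thesis using error_norm1 unfolding hm .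
  qed
  then show ?thesis
    using \<eta>(1) R(1) unfolding Let_def
    by (intro exI[of _ "2 * \<eta>"] exI[of _ R] exI[of _ "1::real"]) simp
qed

end
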